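(* Let $1\le p\le d-1$, let $L:\Lambda^p(\mathbb{R}^d)\to\mathbb{R}$ be smooth, and let $S$ be a non-degenerate real symmetric $d\times d$ matrix (of arbitrary signature). For $\alpha=\sum_{|J|=p}A_Jdy_J\in\Lambda^p(\mathbb{R}^d)$ let $T=T(A)$ be the $d\times d$ matrix with entries $$T_{ij}=L(A)\,\delta_i^j-\sum_{K\not\ni i,j}(-1)^{q(i,j;K)}A_I\,\frac{\partial L}{\partial A_J}(A),$$ where the sum runs over the $(p-1)$-subsets $K\subset\{1,\dots,d\}$ containing neither $i$ nor $j$, $I:=K\cup\{i\}$ and $J:=K\cup\{j\}$ are written as increasing $p$-tuples, and $q(i,j;K)$ is the number of indices $k\in K$ that lie between $i$ and $j$. Then the tensor $S^{-1}T$ (which, evaluated along a closed $p$-form that is a critical point of the second Variational Principle, is Divergence-free) is symmetric for every $\alpha\in\Lambda^p(\mathbb{R}^d)$ if and only if $L$ is invariant under the pullback action of the neutral component $G$ of the orthogonal group $\mathbf{O}(S)$, that is, $L(M^*\alpha)=L(\alpha)$ for all $M\in G$ and all $\alpha\in\Lambda^p(\mathbb{R}^d)$.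
   Context: Notation. For an increasing $p$-tuple $J=(j_1<\dots<j_p)$ of elements of $\{1,\dots,d\}$ (identified with a $p$-subset), $dy_J=dy_{j_1}\wedge\dots\wedge dy_{j_p}$. The $dy_J$ form the canonical basis of $\Lambda^p(\mathbb{R}^d)$, the space of alternating $p$-forms with constant coefficients. An element $\alpha=\sum_J A_Jdy_J$ is identified with its coordinates $A=(A_J)_{|J|=p}$, and $L$ is regarded as a smooth function of these coordinates, with partial derivatives $\partial L/\partial A_J$. Orthogonal group. $\mathbf{O}(S)=\{M\in\mathbf{M}_d(\mathbb{R}) : M^TSM=S\}$, and $G$ is the connected component of the identity in $\mathbf{O}(S)$. Pullback action. A matrix $M=(m_{ij})\in\mathbf{M}_d(\mathbb{R})$ acts linearly on $\Lambda^p(\mathbb{R}^d)$ by $M^*dy_i=\sum_j m_{ij}\,dy_j$ for $p=1$, and in general by $M^*dy_I=\sum_{|J|=p}M\binom{I}{J}\,dy_J$, where $M\binom{I}{J}$ is the minor of $M$ with rows $I$ and columns $J$. For the parenthetical remark: let $D\subset\mathbb{R}^d$ be an open domain. A closed $p$-form $\alpha=\sum_J A_J(y)\,dy_J$ on $D$ is a critical point of the second Variational Principle for $\mathcal{F}[\alpha]=\int_D L(A(y))\,dy$ if $\left.\frac{d}{d\epsilon}\right|_{\epsilon=0}\mathcal{F}[\phi_\epsilon^*\alpha]=0$ for every flow $\phi_\epsilon$ ($\frac{d\phi_\epsilon}{d\epsilon}=\xi(\phi_\epsilon)$, $\phi_0=\mathrm{Id}_D$) of a vector field $\xi\in C_c^\infty(D)^d$;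 it is assumed that $\alpha$ is regular enough for this derivative to make sense and be computed, after the change of variables $y=\phi_\epsilon(z)$, by differentiation under the integral sign, with $T(A(y))$ locally integrable. A matrix field $R$ on $D$ is Divergence-free if $\sum_j\partial_jR_{ij}=0$ for every $i$, in the sense of distributions. *)

theory Defs
  imports "HOL-Analysis.Analysis"
begin

text \<open>
  The index set \<open>{1..d}\<close> is a finite linearly ordered type \<open>'d\<close> with \<open>CARD('d) = d\<close>.
  The degree \<open>p\<close> is a natural number, so the space of alternating \<open>p\<close>-forms cannot be a
  type of its own: a form is given by its coordinates \<open>A $ J\<close> in the basis \<open>dy_J\<close>, with
  \<open>J\<close> ranging over all subsets of \<open>'d\<close>, and the forms of degree \<open>p\<close> make up the subspace below.
\<close>

type_synonym 'd form = "(real, 'd set) vec"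
type_synonym 'd vector = "(real, 'd) vec"
type_synonym 'd matrix = "((real, 'd) vec, 'd) vec"

definition forms :: "nat \<Rightarrow> (('d::finite) form) set" where
  "forms p = {A. \<forall>J. card J \<noteq> p \<longrightarrow> A $ J = 0}"

definition form_part :: "nat \<Rightarrow> ('d::finite) form \<Rightarrow> 'd form" where
  "form_part p A = (\<chi> J. if card J = p then A $ J else 0)"

primrec Ck :: "nat \<Rightarrow> ('a::real_normed_vector \<Rightarrow> 'b::real_normed_vector) \<Rightarrow> bool" where
  "Ck 0 f \<longleftrightarrow> continuous_on UNIV f"
| "Ck (Suc k) f \<longleftrightarrow>
     (\<forall>x. f differentiable (at x)) \<and> (\<forall>v. Ck k (\<lambda>x. frechet_derivative f (at x) v))"

definition smooth :: "('a::real_normed_vector \<Rightarrow> 'b::real_normed_vector) \<Rightarrow> bool" where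
  "smooth f \<longleftrightarrow> (\<forall>k. Ck k f)"

text \<open>
  Smoothness of \<open>L\<close> as a function of the coordinates \<open>A $ J\<close> with \<open>card J = p\<close>; the values of
  \<open>L\<close> outside \<open>forms p\<close> are irrelevant.
\<close>

definition smooth_on_forms :: "nat \<Rightarrow> (('d::finite) form \<Rightarrow> real) \<Rightarrow> bool" where
  "smooth_on_forms p L \<longleftrightarrow> smooth (\<lambda>A. L (form_part p A))"

definition partial_form ::
    "(('d::finite) form \<Rightarrow> real) \<Rightarrow> 'd set \<Rightarrow> 'd form \<Rightarrow> real" where
  "partial_form L J A = deriv (\<lambda>t. L (A + t *\<^sub>R axis J 1)) 0"

text \<open>
  The minor with rows \<open>I\<close> and columns \<open>J\<close> (\<open>card I = card J\<close>), by the Leibniz formula; the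
  increasing tuple of a subset is its \<open>sorted_list_of_set\<close>.
\<close>

definition minor :: "'d matrix \<Rightarrow> 'd::{finite,linorder} set \<Rightarrow> 'd set \<Rightarrow> real" where
  "minor M I J =
     (\<Sum>\<sigma> | \<sigma> permutes {..<card I}. of_int (sign \<sigma>) *
        (\<Prod>k<card I. M $ (sorted_list_of_set I ! k) $ (sorted_list_of_set J ! \<sigma> k)))"

text \<open>The linear extension of \<open>M\<^sup>* dy_I = (\<Sum>J. minor M I J dy_J)\<close>.\<close>

definition pullback ::
    "nat \<Rightarrow> 'd matrix \<Rightarrow> ('d::{finite,linorder}) form \<Rightarrow> 'd form" where
  "pullback p M A =
     (\<chi> J. if card J = p then (\<Sum>I | card I = p. A $ I * minor M I J) else 0)"

definition num_between :: "'d::{finite,linorder} \<Rightarrow> 'd \<Rightarrow> 'd set \<Rightarrow> nat" where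
  "num_between i j K = card {k \<in> K. min i j < k \<and> k < max i j}"

definition tensor ::
    "nat \<Rightarrow> (('d::{finite,linorder}) form \<Rightarrow> real) \<Rightarrow> 'd form \<Rightarrow> 'd matrix" where
  "tensor p L A =
     (\<chi> i j. L A * (if i = j then 1 else 0)
        - (\<Sum>K | card K = p - 1 \<and> i \<notin> K \<and> j \<notin> K.
             (- 1) ^ num_between i j K * A $ (insert i K) * partial_form L (insert j K) A))"

definition orthogonal_group :: "'d matrix \<Rightarrow> (('d::finite) matrix) set" where
  "orthogonal_group S = {M. transpose M ** S ** M = S}"

definition neutral_component :: "'d matrix \<Rightarrow> (('d::finite) matrix) set" where
  "neutral_component S = connected_component_set (orthogonal_group S) (mat 1)"


text \<open>Elements of \<open>C\<^sub>c\<^sup>\<infinity>(D)\<close>, extended by zero to the whole space.\<close>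

definition test_function ::
    "'a::real_normed_vector set \<Rightarrow> ('a \<Rightarrow> 'b::real_normed_vector) \<Rightarrow> bool" where
  "test_function D f \<longleftrightarrow>
     smooth f \<and> compact (closure {x. f x \<noteq> 0}) \<and> closure {x. f x \<noteq> 0} \<subseteq> D"

definition locally_integrable :: "(('d::finite) vector) set \<Rightarrow> ('d vector \<Rightarrow> real) \<Rightarrow> bool" where
  "locally_integrable D f \<longleftrightarrow> (\<forall>C. compact C \<and> C \<subseteq> D \<longrightarrow> set_integrable lebesgue C f)"

text \<open>
  \<open>d\<alpha> = 0\<close> in the sense of distributions; the coefficient of \<open>dy_I\<close> in \<open>d\<alpha>\<close>, for
  \<open>card I = p + 1\<close>, is the sum over \<open>j \<in> I\<close> of \<open>\<plusminus>\<partial>\<^sub>j A_(I - {j})\<close>.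
\<close>

definition closed_form ::
    "nat \<Rightarrow> ('d vector) set \<Rightarrow> ('d vector \<Rightarrow> ('d::{finite,linorder}) form) \<Rightarrow> bool" where
  "closed_form p D \<alpha> \<longleftrightarrow>
     (\<forall>y\<in>D. \<alpha> y \<in> forms p) \<and>
     (\<forall>J. locally_integrable D (\<lambda>y. \<alpha> y $ J)) \<and>
     (\<forall>I \<psi>. card I = p + 1 \<and> test_function D (\<psi> :: 'd vector \<Rightarrow> real) \<longrightarrow>
        (\<Sum>j\<in>I. (- 1) ^ card {i \<in> I. i < j} *
           (LINT y:D|lebesgue. \<alpha> y $ (I - {j}) * frechet_derivative \<psi> (at y) (axis j 1))) = 0)"

definition flow_on ::
    "(('d::finite) vector) set \<Rightarrow> ('d vector \<Rightarrow> 'd vector) \<Rightarrow> (real \<Rightarrow> 'd vector \<Rightarrow> 'd vector) \<Rightarrow> bool" where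
  "flow_on D \<xi> \<phi> \<longleftrightarrow>
     (\<forall>y\<in>D. \<phi> 0 y = y \<and>
        (\<forall>\<epsilon>. \<phi> \<epsilon> y \<in> D \<and> ((\<lambda>s. \<phi> s y) has_vector_derivative \<xi> (\<phi> \<epsilon> y)) (at \<epsilon>)))"

definition pullback_field ::
    "nat \<Rightarrow> ('d vector \<Rightarrow> 'd vector) \<Rightarrow> ('d vector \<Rightarrow> ('d::{finite,linorder}) form)
      \<Rightarrow> 'd vector \<Rightarrow> 'd form" where
  "pullback_field p \<Phi> \<alpha> z = pullback p (jacobian \<Phi> (at z)) (\<alpha> (\<Phi> z))"

definition action ::
    "('d vector) set \<Rightarrow> (('d::finite) form \<Rightarrow> real) \<Rightarrow> ('d vector \<Rightarrow> 'd form) \<Rightarrow> real" where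
  "action D L \<alpha> = (LINT y:D|lebesgue. L (\<alpha> y))"

text \<open>
  The integrand of \<open>action D L (\<phi>\<^sub>\<epsilon>\<^sup>*\<alpha>)\<close> after the change of variables \<open>y = \<phi>\<^sub>\<epsilon>(z)\<close>. The
  inverse of \<open>\<phi>\<^sub>\<epsilon>\<close> is \<open>\<phi>\<close> at time \<open>-\<epsilon>\<close>.
\<close>

definition transformed_integrand ::
    "nat \<Rightarrow> ('d form \<Rightarrow> real) \<Rightarrow> ('d vector \<Rightarrow> ('d::{finite,linorder}) form)
      \<Rightarrow> (real \<Rightarrow> 'd vector \<Rightarrow> 'd vector) \<Rightarrow> real \<Rightarrow> 'd vector \<Rightarrow> real" where
  "transformed_integrand p L \<alpha> \<phi> \<epsilon> y =
     L (pullback_field p (\<phi> \<epsilon>) \<alpha> (\<phi> (- \<epsilon>) y)) * \<bar>det (jacobian (\<phi> (- \<epsilon>)) (at y))\<bar>"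

text \<open>
  Regularity needed for the second Variational Principle: the action is finite along each flow
  for small \<open>\<epsilon>\<close>, its expression after the change of variables may be differentiated at \<open>0\<close>
  under the integral sign, and \<open>T(A(y))\<close> is locally integrable.
\<close>

definition variationally_regular ::
    "nat \<Rightarrow> ('d vector) set \<Rightarrow> ('d form \<Rightarrow> real)
      \<Rightarrow> ('d vector \<Rightarrow> ('d::{finite,linorder}) form) \<Rightarrow> bool" where
  "variationally_regular p D L \<alpha> \<longleftrightarrow>
     (\<forall>i j. locally_integrable D (\<lambda>y. tensor p L (\<alpha> y) $ i $ j)) \<and>
     (\<forall>\<xi> \<phi>. test_function D \<xi> \<and> flow_on D \<xi> \<phi> \<longrightarrow>
        (\<forall>\<^sub>F \<epsilon> in nhds 0. set_integrable lebesgue D (\<lambda>z. L (pullback_field p (\<phi> \<epsilon>) \<alpha> z))) \<and>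
        ((\<lambda>\<epsilon>. LINT y:D|lebesgue. transformed_integrand p L \<alpha> \<phi> \<epsilon> y) has_real_derivative
           (LINT y:D|lebesgue. deriv (\<lambda>\<epsilon>. transformed_integrand p L \<alpha> \<phi> \<epsilon> y) 0)) (at 0))"

definition critical_point ::
    "nat \<Rightarrow> ('d vector) set \<Rightarrow> ('d form \<Rightarrow> real)
      \<Rightarrow> ('d vector \<Rightarrow> ('d::{finite,linorder}) form) \<Rightarrow> bool" where
  "critical_point p D L \<alpha> \<longleftrightarrow>
     (\<forall>\<xi> \<phi>. test_function D \<xi> \<and> flow_on D \<xi> \<phi> \<longrightarrow>
        ((\<lambda>\<epsilon>. action D L (pullback_field p (\<phi> \<epsilon>) \<alpha>)) has_real_derivative 0) (at 0))"

text \<open>Row-wise divergence, in the sense of distributions.\<close>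

definition divergence_free ::
    "(('d::finite) vector) set \<Rightarrow> ('d vector \<Rightarrow> 'd matrix) \<Rightarrow> bool" where
  "divergence_free D R \<longleftrightarrow>
     (\<forall>i j. locally_integrable D (\<lambda>y. R y $ i $ j)) \<and>
     (\<forall>i \<psi>. test_function D (\<psi> :: 'd vector \<Rightarrow> real) \<longrightarrow>
        (\<Sum>j\<in>UNIV. LINT y:D|lebesgue. R y $ i $ j * frechet_derivative \<psi> (at y) (axis j 1)) = 0)"

end

theory Submission
  imports Defs
begin

text \<open>
  Both halves of the theorem come from one computation. If \<open>R\<close> is a differentiable curve of matrices
  with \<open>R 0 = 1\<close> and velocity \<open>X\<close> at \<open>0\<close>, then the derivative of \<open>L (R(t)\<^sup>* A)\<close> at \<open>0\<close> is
  \<open>L(A) tr X - \<Sum> X\<^sub>i\<^sub>j T\<^sub>i\<^sub>j(A)\<close> (\<open>lagrangian_derivative\<close>). This holds because the derivative at the identity of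
  the minor with rows \<open>I\<close> and columns \<open>J\<close> is a sum of entries \<open>X\<^sub>i\<^sub>j\<close> with exactly the signs that occur
  in the tensor \<open>T\<close>: replacing \<open>dy\<^sub>i\<close> by \<open>dy\<^sub>j\<close> inside \<open>dy\<^sub>I\<close> and sorting the factors again costs one sign
  for each index between \<open>i\<close> and \<open>j\<close>.
  
  For the equivalence, take \<open>X\<close> in the Lie algebra of \<open>O(S)\<close>, the matrices \<open>X\<close> for which \<open>S X\<close> is
  antisymmetric. Such an \<open>X\<close> has trace zero, and \<open>S\<^sup>-\<^sup>1 T\<close> is symmetric if and only if \<open>T\<close> is orthogonal to
  all of them (\<open>symmetric_iff_annihilates_orthogonal_algebra\<close>). So symmetry of \<open>S\<^sup>-\<^sup>1 T\<close> says that the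
  derivative of \<open>L (c(t)\<^sup>* A)\<close> vanishes along every differentiable curve \<open>c\<close> in \<open>O(S)\<close>; to move the base
  point of the computation from \<open>1\<close> to \<open>c(t)\<close> one needs \<open>(M N)\<^sup>* = N\<^sup>* M\<^sup>*\<close>, which is the Cauchy-Binet
  formula. Conversely, invariance of \<open>L\<close> along a curve through \<open>1\<close> with velocity \<open>2 X\<close> gives the
  orthogonality. The curves come from the Cayley transform: \<open>V U\<^sup>-\<^sup>1\<close> preserves \<open>S\<close> as soon as
  \<open>V\<^sup>T S V = U\<^sup>T S U\<close>. They join every element of \<open>O(S)\<close> near \<open>1\<close> to \<open>1\<close>, which makes invariance of \<open>L\<close> an
  open and closed condition on the neutral component.
  
  For the divergence, let \<open>\<psi>\<close> be a test function and \<open>\<xi> = \<psi> e\<^sub>k\<close>. After the change of variables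
  \<open>y = \<phi>\<^sub>\<epsilon>(z)\<close> along the flow of \<open>\<xi>\<close>, the same computation with \<open>X = D\<xi>(y)\<close> shows that the first variation of
  the action is \<open>- \<integral> \<Sum>\<^sub>j T\<^sub>k\<^sub>j \<partial>\<^sub>j\<psi>\<close>: the trace term cancels against the derivative of the Jacobian determinant.
  Criticality makes this zero, so the rows of \<open>T\<close> have vanishing weak divergence, and so have their linear
  combinations, the rows of \<open>S\<^sup>-\<^sup>1 T\<close>. The analytic part is to construct this flow, to differentiate it
  in its initial value, and to carry out the change of variables.
\<close>

section \<open>Minors and the Cauchy-Binet formula\<close>

text \<open>
  The rows and columns of a minor are numbered by positions in sorted lists, so the determinant is
  indexed by natural numbers below a size that varies with the degree.
\<close>

definition ndet :: "nat \<Rightarrow> (nat \<Rightarrow> nat \<Rightarrow> real) \<Rightarrow> real" where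
  "ndet p g = (\<Sum>\<sigma> | \<sigma> permutes {..<p}. of_int (sign \<sigma>) * (\<Prod>k<p. g k (\<sigma> k)))"

lemma minor_eq_ndet:
  "minor M I J = ndet (card I) (\<lambda>k l. M $ (sorted_list_of_set I ! k) $ (sorted_list_of_set J ! l))"
  by (simp add: minor_def ndet_def)

lemma ndet_cong:
  assumes "\<And>k l. k < p \<Longrightarrow> l < p \<Longrightarrow> g k l = h k l"
  shows "ndet p g = ndet p h"
  unfolding ndet_def
proof (rule sum.cong[OF refl], rule arg_cong2[where f = "(*)"], rule refl, rule prod.cong[OF refl])
  fix \<sigma> k assume "\<sigma> \<in> {\<sigma>. \<sigma> permutes {..<p}}" "k \<in> {..<p}"
  then show "g k (\<sigma> k) = h k (\<sigma> k)"
    using assms permutes_in_image[of \<sigma> "{..<p}" k] by auto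
qed

lemma ndet_permute_rows:
  assumes "\<tau> permutes {..<p}"
  shows "ndet p (\<lambda>k. g (\<tau> k)) = of_int (sign \<tau>) * ndet p g"
proof -
  have "ndet p (\<lambda>k. g (\<tau> k)) =
      (\<Sum>\<sigma> | \<sigma> permutes {..<p}. of_int (sign (\<sigma> \<circ> \<tau>)) * (\<Prod>k<p. g (\<tau> k) ((\<sigma> \<circ> \<tau>) k)))"
    unfolding ndet_def by (rule sum_permutations_compose_right[OF assms])
  also have "\<dots> = (\<Sum>\<sigma> | \<sigma> permutes {..<p}. of_int (sign \<tau>) * (of_int (sign \<sigma>) * (\<Prod>k<p. g k (\<sigma> k))))"
  proof (rule sum.cong[OF refl])
    fix \<sigma> assume "\<sigma> \<in> {\<sigma>. \<sigma> permutes {..<p}}"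
    then have s: "sign (\<sigma> \<circ> \<tau>) = sign \<sigma> * sign \<tau>"
      using assms by (intro sign_compose permutation_permutes[THEN iffD2]) auto
    have "(\<Prod>k<p. g k (\<sigma> k)) = (\<Prod>k<p. g (\<tau> k) ((\<sigma> \<circ> \<tau>) k))"
      using prod.permute[OF assms, of "\<lambda>k. g k (\<sigma> k)"] by (simp add: o_def)
    then show "of_int (sign (\<sigma> \<circ> \<tau>)) * (\<Prod>k<p. g (\<tau> k) ((\<sigma> \<circ> \<tau>) k)) =
        real_of_int (sign \<tau>) * (of_int (sign \<sigma>) * (\<Prod>k<p. g k (\<sigma> k)))"
      using s by simp
  qed
  finally show ?thesis
    by (simp add: ndet_def sum_distrib_left)
qed

lemma ndet_swap_rows:
  assumes "a < p" "b < p" "a \<noteq> b"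
  shows "ndet p (\<lambda>k. g (Transposition.transpose a b k)) = - ndet p g"
  using ndet_permute_rows[OF permutes_swap_id, of a p b g] assms by (simp add: sign_swap_id)

lemma ndet_equal_rows:
  assumes "a < p" "b < p" "a \<noteq> b" "g a = g b"
  shows "ndet p g = 0"
proof -
  have "(\<lambda>k. g (Transposition.transpose a b k)) = g"
    using assms(4) by (auto simp: fun_eq_iff Transposition.transpose_def)
  then show ?thesis
    using ndet_swap_rows[OF assms(1-3), of g] by simp
qed

text \<open>
  Multilinearity in the rows: every row of the product matrix is a linear combination of rows of \<open>b\<close>,
  and expanding them all picks one row \<open>b (f k)\<close> for each \<open>k\<close>.
\<close>

lemma ndet_mult_expand:
  fixes a :: "nat \<Rightarrow> 'c::finite \<Rightarrow> real"
  shows "ndet p (\<lambda>k l. \<Sum>c\<in>UNIV. a k c * b c l) =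
    (\<Sum>f\<in>{..<p} \<rightarrow>\<^sub>E UNIV. (\<Prod>k<p. a k (f k)) * ndet p (\<lambda>k. b (f k)))"
proof -
  have "ndet p (\<lambda>k l. \<Sum>c\<in>UNIV. a k c * b c l) =
     (\<Sum>\<sigma> | \<sigma> permutes {..<p}. \<Sum>f\<in>{..<p} \<rightarrow>\<^sub>E UNIV.
        (\<Prod>k<p. a k (f k)) * (of_int (sign \<sigma>) * (\<Prod>k<p. b (f k) (\<sigma> k))))"
    unfolding ndet_def
    by (subst prod_sum_PiE) (simp_all add: sum_distrib_left prod.distrib algebra_simps)
  also have "\<dots> = (\<Sum>f\<in>{..<p} \<rightarrow>\<^sub>E UNIV. (\<Prod>k<p. a k (f k)) * ndet p (\<lambda>k. b (f k)))"
    unfolding ndet_def by (subst sum.swap) (simp add: sum_distrib_left)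
  finally show ?thesis .
qed

lemma bij_betw_nth_sorted:
  "finite K \<Longrightarrow> bij_betw (\<lambda>k. sorted_list_of_set K ! k) {..<card K} K"
  by (rule bij_betw_nth) auto

text \<open>
  An injective map from positions to indices is a \<open>p\<close>-subset, its image, together with the order in
  which the elements are listed.
\<close>

lemma bij_betw_injective_maps:
  "bij_betw (\<lambda>(K, \<tau>). restrict (\<lambda>k. sorted_list_of_set K ! \<tau> k) {..<p})
     ({K :: 'c::{finite,linorder} set. card K = p} \<times> {\<tau>. \<tau> permutes {..<p}})
     {f \<in> {..<p} \<rightarrow>\<^sub>E UNIV. inj_on f {..<p}}"
  (is "bij_betw ?F ?D ?R")
proof -
  have bij: "bij_betw (\<lambda>k. sorted_list_of_set K ! \<tau> k) {..<q} K"
    if "card K = q" "\<tau> permutes {..<q}" for K :: "'c set" and \<tau> q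
    using bij_betw_trans[OF permutes_imp_bij[OF that(2)]] bij_betw_nth_sorted[of K] that(1)
    by (force simp: o_def)
  have inj: "inj_on ?F ?D"
  proof (rule inj_onI, clarify)
    fix K \<tau> K' \<tau>'
    assume eq: "restrict (\<lambda>k. sorted_list_of_set K ! \<tau> k) {..<card K} =
          restrict (\<lambda>k. sorted_list_of_set K' ! \<tau>' k) {..<card K}"
      and p: "card (K' :: 'c set) = card K"
      and perm: "\<tau> permutes {..<card K}" "\<tau>' permutes {..<card K}"
    have eq': "sorted_list_of_set K ! \<tau> k = sorted_list_of_set K' ! \<tau>' k" if "k < card K" for k
      using fun_cong[OF eq, of k] that by simp
    have "K = (\<lambda>k. sorted_list_of_set K ! \<tau> k) ` {..<card K}"
      using bij[OF _ perm(1)] by (simp add: bij_betw_def)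
    also have "\<dots> = (\<lambda>k. sorted_list_of_set K' ! \<tau>' k) ` {..<card K}"
      using eq' by auto
    also have "\<dots> = K'"
      using bij[OF p perm(2)] by (simp add: bij_betw_def)
    finally have K: "K = K'" .
    have "\<tau> k = \<tau>' k" for k
    proof (cases "k < card K")
      case True
      then have "\<tau> k < card K" "\<tau>' k < card K"
        using perm permutes_in_image by fastforce+
      then show ?thesis
        using eq'[OF True] K nth_eq_iff_index_eq[of "sorted_list_of_set K" "\<tau> k" "\<tau>' k"] by simp
    next
      case False
      then show ?thesis
        using perm by (simp add: permutes_not_in)
    qed
    then show "K = K' \<and> \<tau> = \<tau>'"
      using K by auto
  qed
  have "f \<in> ?F ` ?D" if f: "f \<in> ?R" for f
  proof -
    define K where "K = f ` {..<p}"
    have c: "card K = p"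
      using f by (simp add: K_def card_image)
    define h where "h = inv_into {..<p} (\<lambda>k. sorted_list_of_set K ! k)"
    have b: "bij_betw (\<lambda>k. sorted_list_of_set K ! k) {..<p} K"
      using bij_betw_nth_sorted[of K] c by simp
    have "bij_betw f {..<p} K"
      using f by (simp add: K_def bij_betw_def)
    then have hf: "bij_betw (\<lambda>k. h (f k)) {..<p} {..<p}"
      using bij_betw_trans[OF _ bij_betw_inv_into[OF b]] by (force simp: o_def h_def)
    define \<tau> where "\<tau> k = (if k < p then h (f k) else k)" for k
    have "bij_betw \<tau> {..<p} {..<p}"
      using hf by (subst bij_betw_cong[of _ _ "\<lambda>k. h (f k)"]) (auto simp: \<tau>_def)
    then have \<tau>: "\<tau> permutes {..<p}"
      by (rule bij_imp_permutes) (simp add: \<tau>_def)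
    have "f k = ?F (K, \<tau>) k" for k
    proof (cases "k < p")
      case True
      then have "f k \<in> K" by (simp add: K_def)
      then show ?thesis
        using True b f_inv_into_f[of "f k" "\<lambda>k. sorted_list_of_set K ! k" "{..<p}"]
        by (simp add: \<tau>_def h_def bij_betw_def)
    next
      case False
      then show ?thesis using f by (auto simp: PiE_def extensional_def)
    qed
    then have "f = ?F (K, \<tau>)" by (rule ext)
    then show ?thesis using c \<tau> by blast
  qed
  moreover have "?F ` ?D \<subseteq> ?R"
  proof (rule image_subsetI)
    fix x assume "x \<in> ?D"
    then obtain K \<tau> where x: "x = (K, \<tau>)" "card K = p" "\<tau> permutes {..<p}" by blast
    then have "inj_on (\<lambda>k. sorted_list_of_set K ! \<tau> k) {..<p}"
      using bij[OF x(2,3)] by (simp add: bij_betw_def)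
    then show "?F x \<in> ?R" using x(1) by (auto simp: inj_on_def)
  qed
  ultimately show ?thesis
    using inj unfolding bij_betw_def by blast
qed

text \<open>
  In the expansion by rows a map \<open>f\<close> that repeats a value contributes a determinant with two equal
  rows. The injective maps are grouped by their image \<open>K\<close>; within a group the sign of the permutation
  is what turns \<open>\<Prod> a k (f k)\<close> into the determinant of the columns \<open>K\<close> of \<open>a\<close>.
\<close>

theorem Cauchy_Binet:
  fixes a :: "nat \<Rightarrow> 'c::{finite,linorder} \<Rightarrow> real"
  shows "ndet p (\<lambda>k l. \<Sum>c\<in>UNIV. a k c * b c l) =
    (\<Sum>K | card K = p. ndet p (\<lambda>k l. a k (sorted_list_of_set K ! l)) *
       ndet p (\<lambda>k. b (sorted_list_of_set K ! k)))"
proof -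
  let ?G = "\<lambda>f. (\<Prod>k<p. a k (f k)) * ndet p (\<lambda>k. b (f k))"
  have "ndet p (\<lambda>k l. \<Sum>c\<in>UNIV. a k c * b c l) = sum ?G {f \<in> {..<p} \<rightarrow>\<^sub>E UNIV. inj_on f {..<p}}"
    unfolding ndet_mult_expand
  proof (rule sum.mono_neutral_right)
    show "finite (({..<p} :: nat set) \<rightarrow>\<^sub>E (UNIV :: 'c set))" by (rule finite_PiE) auto
    show "\<forall>f\<in>({..<p} \<rightarrow>\<^sub>E UNIV) - {f \<in> {..<p} \<rightarrow>\<^sub>E UNIV. inj_on f {..<p}}. ?G f = 0"
    proof
      fix f :: "nat \<Rightarrow> 'c" assume "f \<in> ({..<p} \<rightarrow>\<^sub>E UNIV) - {f \<in> {..<p} \<rightarrow>\<^sub>E UNIV. inj_on f {..<p}}"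
      then obtain x y where "x < p" "y < p" "x \<noteq> y" "f x = f y"
        by (auto simp: inj_on_def)
      then show "?G f = 0"
        using ndet_equal_rows[of x p y "\<lambda>k. b (f k)"] by simp
    qed
  qed auto
  also have "\<dots> = (\<Sum>(K, \<tau>)\<in>{K. card K = p} \<times> {\<tau>. \<tau> permutes {..<p}}.
      ?G (restrict (\<lambda>k. sorted_list_of_set K ! \<tau> k) {..<p}))"
    using sum.reindex_bij_betw[OF bij_betw_injective_maps, of ?G p, symmetric]
    by (simp add: case_prod_unfold)
  also have "\<dots> = (\<Sum>K | card K = p. \<Sum>\<tau> | \<tau> permutes {..<p}.
      (of_int (sign \<tau>) * (\<Prod>k<p. a k (sorted_list_of_set K ! \<tau> k))) *
        ndet p (\<lambda>k. b (sorted_list_of_set K ! k)))"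
    unfolding sum.cartesian_product[symmetric]
  proof (intro sum.cong refl)
    fix K :: "'c set" and \<tau> assume "\<tau> \<in> {\<tau>. \<tau> permutes {..<p}}"
    then have "ndet p (\<lambda>k. b (sorted_list_of_set K ! \<tau> k)) =
        of_int (sign \<tau>) * ndet p (\<lambda>k. b (sorted_list_of_set K ! k))"
      using ndet_permute_rows[of \<tau> p "\<lambda>k. b (sorted_list_of_set K ! k)"] by simp
    moreover have "ndet p (\<lambda>k. b (restrict (\<lambda>k. sorted_list_of_set K ! \<tau> k) {..<p} k)) =
        ndet p (\<lambda>k. b (sorted_list_of_set K ! \<tau> k))"
      by (rule ndet_cong) simp
    ultimately show "?G (restrict (\<lambda>k. sorted_list_of_set K ! \<tau> k) {..<p}) =
      (of_int (sign \<tau>) * (\<Prod>k<p. a k (sorted_list_of_set K ! \<tau> k))) *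
        ndet p (\<lambda>k. b (sorted_list_of_set K ! k))"
      by simp
  qed
  also have "\<dots> = (\<Sum>K | card K = p. ndet p (\<lambda>k l. a k (sorted_list_of_set K ! l)) *
       ndet p (\<lambda>k. b (sorted_list_of_set K ! k)))"
    by (simp add: sum_distrib_right[symmetric] ndet_def[of p "\<lambda>k l. a k (_ ! l)"])
  finally show ?thesis .
qed

lemma minor_mult:
  assumes "card I = p"
  shows "minor (M ** N) I J = (\<Sum>K | card K = p. minor M I K * minor N K J)"
proof -
  have "minor (M ** N) I J = ndet p (\<lambda>k l. \<Sum>c\<in>UNIV. M $ (sorted_list_of_set I ! k) $ c * N $ c $ (sorted_list_of_set J ! l))"
    by (simp add: minor_eq_ndet assms matrix_matrix_mult_def)
  also have "\<dots> = (\<Sum>K | card K = p. minor M I K * minor N K J)"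
    unfolding Cauchy_Binet by (rule sum.cong) (auto simp: minor_eq_ndet assms)
  finally show ?thesis .
qed

lemma pullback_in_forms: "pullback p M A \<in> forms p"
  by (simp add: forms_def pullback_def)

theorem pullback_mult: "pullback p (M ** N) A = pullback p N (pullback p M A)"
proof -
  have "(\<Sum>I | card I = p. A $ I * minor (M ** N) I J) =
        (\<Sum>K | card K = p. (\<Sum>I | card I = p. A $ I * minor M I K) * minor N K J)" for J
  proof -
    have "(\<Sum>I | card I = p. A $ I * minor (M ** N) I J) =
        (\<Sum>I | card I = p. \<Sum>K | card K = p. A $ I * minor M I K * minor N K J)"
      by (intro sum.cong refl) (simp add: minor_mult sum_distrib_left mult.assoc)
    then show ?thesis
      by (subst (asm) sum.swap) (simp add: sum_distrib_right)
  qed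
  then show ?thesis
    by (auto simp: pullback_def vec_eq_iff intro!: sum.cong)
qed


section \<open>The derivative of a minor at the identity\<close>

abbreviation kron :: "'a \<Rightarrow> 'a \<Rightarrow> real" where "kron x y \<equiv> (if x = y then 1 else 0)"

lemma prod_kron:
  "finite S \<Longrightarrow> (\<Prod>k\<in>S. kron (f k) (g k)) = (if \<forall>k\<in>S. f k = g k then 1 else 0)"
  by (induction S rule: finite_induct) auto

lemma ndet_kron_self:
  assumes "distinct ys"
  shows "ndet (length ys) (\<lambda>k l. kron (ys ! k) (ys ! l)) = 1"
proof -
  let ?p = "length ys"
  have "(\<Prod>k<?p. kron (ys ! k) (ys ! \<sigma> k)) = kron \<sigma> id" if \<sigma>: "\<sigma> permutes {..<?p}" for \<sigma>
  proof -
    have "(\<forall>k\<in>{..<?p}. ys ! k = ys ! \<sigma> k) \<longleftrightarrow> (\<forall>k\<in>{..<?p}. \<sigma> k = k)"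
      using assms permutes_in_image[OF \<sigma>] by (auto simp: nth_eq_iff_index_eq)
    also have "\<dots> \<longleftrightarrow> \<sigma> = id"
      using permutes_not_in[OF \<sigma>] by (auto simp: fun_eq_iff)
    finally show ?thesis
      by (subst prod_kron) auto
  qed
  then have "ndet ?p (\<lambda>k l. kron (ys ! k) (ys ! l)) =
      (\<Sum>\<sigma> | \<sigma> permutes {..<?p}. of_int (sign \<sigma>) * kron \<sigma> id)"
    unfolding ndet_def by (intro sum.cong refl) auto
  also have "\<dots> = (\<Sum>\<sigma> | \<sigma> permutes {..<?p}. if \<sigma> = id then 1 else 0)"
    by (intro sum.cong refl) auto
  also have "\<dots> = 1"
    by (subst sum.delta) (auto simp: finite_permutations permutes_id)
  finally show ?thesis .
qed

lemma ndet_kron_missing: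
  assumes "x \<in> set xs" "x \<notin> set ys" "length xs = length ys"
  shows "ndet (length ys) (\<lambda>k l. kron (xs ! k) (ys ! l)) = 0"
  unfolding ndet_def
proof (rule sum.neutral, rule ballI)
  fix \<sigma> assume "\<sigma> \<in> {\<sigma>. \<sigma> permutes {..<length ys}}"
  then have \<sigma>: "\<sigma> permutes {..<length ys}" by simp
  obtain k where k: "k < length xs" "xs ! k = x"
    using assms(1) by (auto simp: in_set_conv_nth)
  have "ys ! \<sigma> k \<in> set ys"
    using permutes_in_image[OF \<sigma>, of k] k(1) assms(3) by auto
  then have "xs ! k \<noteq> ys ! \<sigma> k"
    using k(2) assms(2) by metis
  then have "(\<Prod>k<length ys. kron (xs ! k) (ys ! \<sigma> k)) = 0"
    using k(1) assms(3) by (subst prod_kron) auto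
  then show "of_int (sign \<sigma>) * (\<Prod>k<length ys. kron (xs ! k) (ys ! \<sigma> k)) = 0"
    by simp
qed

lemma ndet_kron_swap:
  assumes "p = length (as @ x # y # bs)"
  shows "ndet p (\<lambda>k l. kron ((as @ x # y # bs) ! k) (ys ! l)) =
    - ndet p (\<lambda>k l. kron ((as @ y # x # bs) ! k) (ys ! l))"
proof -
  let ?n = "length as"
  have "(as @ x # y # bs) ! k = (as @ y # x # bs) ! Transposition.transpose ?n (Suc ?n) k" for k
    by (auto simp: Transposition.transpose_def nth_append nth_Cons' )
  then have "ndet p (\<lambda>k l. kron ((as @ x # y # bs) ! k) (ys ! l)) =
     ndet p (\<lambda>k. (\<lambda>k l. kron ((as @ y # x # bs) ! k) (ys ! l)) (Transposition.transpose ?n (Suc ?n) k))"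
    by (intro ndet_cong) simp
  also have "\<dots> = - ndet p (\<lambda>k l. kron ((as @ y # x # bs) ! k) (ys ! l))"
    by (rule ndet_swap_rows) (use assms in auto)
  finally show ?thesis .
qed

lemma ndet_kron_move:
  assumes "p = length (as @ j # bs @ cs)"
  shows "ndet p (\<lambda>k l. kron ((as @ j # bs @ cs) ! k) (ys ! l)) =
    (-1) ^ length bs * ndet p (\<lambda>k l. kron ((as @ bs @ j # cs) ! k) (ys ! l))"
  using assms
proof (induction bs arbitrary: as)
  case (Cons b bs)
  show ?case
    using ndet_kron_swap[of p as j b "bs @ cs" ys] Cons.IH[of "as @ [b]"] Cons.prems by simp
qed simp

lemma sorted_list_of_set_Un:
  fixes A B :: "'c::{finite,linorder} set"
  assumes "\<And>a b. a \<in> A \<Longrightarrow> b \<in> B \<Longrightarrow> a < b"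
  shows "sorted_list_of_set (A \<union> B) = sorted_list_of_set A @ sorted_list_of_set B"
proof (rule sorted_distinct_set_unique)
  show "sorted (sorted_list_of_set A @ sorted_list_of_set B)"
    using assms by (auto simp: sorted_append less_imp_le)
  show "distinct (sorted_list_of_set A @ sorted_list_of_set B)"
    using assms by force
qed auto

lemma sorted_list_of_set_insert_split:
  fixes K :: "'c::{finite,linorder} set"
  assumes "i \<notin> K"
  shows "sorted_list_of_set (insert i K) =
    sorted_list_of_set {x\<in>K. x < i} @ i # sorted_list_of_set {x\<in>K. i < x}"
proof -
  have "insert i K = {x\<in>K. x < i} \<union> ({i} \<union> {x\<in>K. i < x})"
    using assms by auto
  also have "sorted_list_of_set \<dots> = sorted_list_of_set {x\<in>K. x < i} @ sorted_list_of_set {i} @ sorted_list_of_set {x\<in>K. i < x}"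
    by (subst sorted_list_of_set_Un, force, subst sorted_list_of_set_Un) auto
  finally show ?thesis by simp
qed

text \<open>
  The coefficient of \<open>dy\<^sub>J\<close> in the product obtained from \<open>dy\<^sub>I\<close> by replacing the factor \<open>dy\<^sub>i\<close> with \<open>dy\<^sub>j\<close>. If
  \<open>j\<close> already occurs the product is zero. Otherwise the factors have to be sorted, and \<open>dy\<^sub>j\<close>, which
  stands at the place of \<open>dy\<^sub>i\<close>, moves past those whose indices lie between \<open>i\<close> and \<open>j\<close>.
\<close>

lemma ndet_kron_replace:
  fixes I J :: "'c::{finite,linorder} set"
  assumes "card I = p" "card J = p" "i \<in> I"
  shows "ndet p (\<lambda>k l. kron (if sorted_list_of_set I ! k = i then j else sorted_list_of_set I ! k)
            (sorted_list_of_set J ! l)) =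
    (if j \<notin> I - {i} \<and> J = insert j (I - {i}) then (-1) ^ num_between i j (I - {i}) else 0)"
proof -
  define K where "K = I - {i}"
  have I: "I = insert i K" and iK: "i \<notin> K" using assms(3) by (auto simp: K_def)
  define f where "f x = (if x = i then j else x)" for x
  let ?xs = "map f (sorted_list_of_set I)" and ?ys = "sorted_list_of_set J"
  have len: "length ?xs = p" "length ?ys = p" using assms by simp_all
  have setxs: "set ?xs = insert j K"
  proof -
    have "set ?xs = f ` I" by simp
    then show ?thesis using iK by (auto simp: I f_def)
  qed
  have ndet: "ndet p (\<lambda>k l. kron (if sorted_list_of_set I ! k = i then j else sorted_list_of_set I ! k)
            (?ys ! l)) = ndet p (\<lambda>k l. kron (?xs ! k) (?ys ! l))"
    by (rule ndet_cong) (use assms in \<open>simp add: f_def\<close>)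
  consider "j \<in> K" | "j \<notin> K" "J \<noteq> insert j K" | "j \<notin> K" "J = insert j K" by blast
  then have "ndet p (\<lambda>k l. kron (?xs ! k) (?ys ! l)) =
      (if j \<notin> K \<and> J = insert j K then (-1) ^ num_between i j K else 0)"
  proof cases
    case 1
    then have "i \<noteq> j" "j \<in> set (sorted_list_of_set I)" "i \<in> set (sorted_list_of_set I)"
      using iK by (simp_all only: set_sorted_list_of_set[OF finite] I) auto
    then obtain a b where "a < p" "sorted_list_of_set I ! a = i" "b < p" "sorted_list_of_set I ! b = j"
      using assms(1) by (metis in_set_conv_nth sorted_list_of_set.length_sorted_key_list_of_set)
    then have "ndet p (\<lambda>k l. kron (?xs ! k) (?ys ! l)) = 0"
      using \<open>i \<noteq> j\<close> assms(1) by (intro ndet_equal_rows[of a p b]) (auto simp: f_def)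
    then show ?thesis using 1 by simp
  next
    case 2
    have "card (insert j K) = p"
      using 2(1) assms(1) iK I by simp
    then have "\<not> insert j K \<subseteq> J"
      using 2(2) assms(2) card_subset_eq[of J "insert j K"] by auto
    then obtain x where "x \<in> set ?xs" "x \<notin> set ?ys"
      using setxs by auto
    then show ?thesis
      using ndet_kron_missing[of x ?xs ?ys] len 2 by simp
  next
    case 3
    let ?s = sorted_list_of_set
    have f: "map f (?s {x\<in>K. P x}) = ?s {x\<in>K. P x}" for P
      using iK by (intro map_idI) (auto simp: f_def)
    have xs: "?xs = ?s {x\<in>K. x < i} @ j # ?s {x\<in>K. i < x}"
      by (simp only: I sorted_list_of_set_insert_split[OF iK] map_append list.map f) (simp add: f_def)
    have ys: "?ys = ?s {x\<in>K. x < j} @ j # ?s {x\<in>K. j < x}"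
      by (simp only: 3(2) sorted_list_of_set_insert_split[OF 3(1)])
    have trich: "x < i \<or> i < x" "x < j \<or> j < x" if "x \<in> K" for x
      using that iK 3(1) linorder_neqE by metis+
    have one: "ndet p (\<lambda>k l. kron (?ys ! k) (?ys ! l)) = 1"
      using ndet_kron_self[of ?ys] len by simp
    have eq: "ndet p (\<lambda>k l. kron (?xs ! k) (?ys ! l)) = (-1) ^ num_between i j K"
    proof (cases i j rule: linorder_cases)
      case less
      let ?B = "{x\<in>K. i < x \<and> x < j}"
      have "{x\<in>K. i < x} = ?B \<union> {x\<in>K. j < x}"
        using less trich by (auto dest: less_trans)
      then have 1: "?s {x\<in>K. i < x} = ?s ?B @ ?s {x\<in>K. j < x}"
        by (simp only:, intro sorted_list_of_set_Un) (auto dest: less_trans)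
      have "{x\<in>K. x < j} = {x\<in>K. x < i} \<union> ?B"
        using less trich by (auto dest: less_trans)
      then have 2: "?s {x\<in>K. x < j} = ?s {x\<in>K. x < i} @ ?s ?B"
        by (simp only:, intro sorted_list_of_set_Un) (auto dest: less_trans)
      have "num_between i j K = length (?s ?B)"
        using less by (simp add: num_between_def min_def max_def)
      moreover have "p = length (?s {x\<in>K. x < i} @ j # ?s ?B @ ?s {x\<in>K. j < x})"
        using len(1) xs 1 by simp
      ultimately show ?thesis
        using ndet_kron_move[of p "?s {x\<in>K. x < i}" j "?s ?B" "?s {x\<in>K. j < x}" ?ys] one xs ys 1 2
        by simp
    next
      case equal
      then have "num_between i j K = 0"
        unfolding num_between_def by (subst card_eq_0_iff) auto
      then show ?thesis
        using equal one xs ys by simp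
    next
      case greater
      let ?B = "{x\<in>K. j < x \<and> x < i}"
      have "{x\<in>K. j < x} = ?B \<union> {x\<in>K. i < x}"
        using greater trich by (auto dest: less_trans)
      then have 1: "?s {x\<in>K. j < x} = ?s ?B @ ?s {x\<in>K. i < x}"
        by (simp only:, intro sorted_list_of_set_Un) (auto dest: less_trans)
      have "{x\<in>K. x < i} = {x\<in>K. x < j} \<union> ?B"
        using greater trich by (auto dest: less_trans)
      then have 2: "?s {x\<in>K. x < i} = ?s {x\<in>K. x < j} @ ?s ?B"
        by (simp only:, intro sorted_list_of_set_Un) (auto dest: less_trans)
      have n: "num_between i j K = length (?s ?B)"
        using greater by (simp add: num_between_def min_def max_def)
      have "p = length (?s {x\<in>K. x < j} @ j # ?s ?B @ ?s {x\<in>K. i < x})"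
        using len(2) ys 1 by simp
      then have "ndet p (\<lambda>k l. kron (?ys ! k) (?ys ! l)) =
         (-1) ^ length (?s ?B) * ndet p (\<lambda>k l. kron (?xs ! k) (?ys ! l))"
        using ndet_kron_move[of p "?s {x\<in>K. x < j}" j "?s ?B" "?s {x\<in>K. i < x}" ?ys] xs ys 1 2
        by simp
      then have "(-1) ^ length (?s ?B) * ndet p (\<lambda>k l. kron (?xs ! k) (?ys ! l)) = 1"
        using one by simp
      then show ?thesis
        unfolding n by (cases "even (length (?s ?B))") auto
    qed
    then show ?thesis using 3 by simp
  qed
  then show ?thesis unfolding ndet K_def .
qed

text \<open>
  The action of the matrix \<open>X\<close> on forms as a derivation: every factor \<open>dy\<^sub>i\<close> of \<open>dy\<^sub>I\<close> is replaced in turn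
  by \<open>\<Sum>\<^sub>j X\<^sub>i\<^sub>j dy\<^sub>j\<close>.
\<close>

definition infinitesimal_pullback :: "nat \<Rightarrow> 'd matrix \<Rightarrow> ('d::{finite,linorder}) form \<Rightarrow> 'd form" where
  "infinitesimal_pullback p X A = (\<chi> J. if card J = p then
     (\<Sum>I | card I = p. A $ I * (\<Sum>i\<in>I. \<Sum>j\<in>UNIV. X $ i $ j *
        (if j \<notin> I - {i} \<and> J = insert j (I - {i}) then (- 1) ^ num_between i j (I - {i}) else 0))) else 0)"

lemma has_derivative_minor:
  "((\<lambda>M :: ('d::{finite,linorder}) matrix. minor M I J) has_derivative
     (\<lambda>X. \<Sum>\<sigma> | \<sigma> permutes {..<card I}. of_int (sign \<sigma>) *
        (\<Sum>k<card I. X $ (sorted_list_of_set I ! k) $ (sorted_list_of_set J ! \<sigma> k) *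
          (\<Prod>l\<in>{..<card I} - {k}. M $ (sorted_list_of_set I ! l) $ (sorted_list_of_set J ! \<sigma> l))))) (at M)"
proof -
  have c: "((\<lambda>M :: 'd matrix. M $ a $ b) has_derivative (\<lambda>X. X $ a $ b)) (at M)" for a b
    by (rule bounded_linear_imp_has_derivative)
       (rule bounded_linear_compose[OF bounded_linear_vec_nth bounded_linear_vec_nth])
  show ?thesis
    unfolding minor_def
    by (intro has_derivative_sum has_derivative_mult_right has_derivative_prod c)
qed

text \<open>
  By the product rule one row at a time is replaced by a row of \<open>X\<close>, while all the others stay rows of
  the identity matrix. Expanding that row in basis vectors leaves the determinants computed in
  \<open>ndet_kron_replace\<close>.
\<close>

lemma has_derivative_minor_mat_1:
  fixes I J :: "('d::{finite,linorder}) set"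
  assumes p: "card I = p" "card J = p"
  shows "((\<lambda>M. minor M I J) has_derivative
     (\<lambda>X. \<Sum>i\<in>I. \<Sum>j\<in>UNIV. X $ i $ j *
        (if j \<notin> I - {i} \<and> J = insert j (I - {i}) then (- 1) ^ num_between i j (I - {i}) else 0))) (at (mat 1))"
proof -
  let ?I = "\<lambda>k. sorted_list_of_set I ! k" and ?J = "\<lambda>k. sorted_list_of_set J ! k"
  let ?c = "\<lambda>i j. ndet p (\<lambda>k l. kron (if ?I k = i then j else ?I k) (?J l))"
  have "(\<Sum>\<sigma> | \<sigma> permutes {..<p}. of_int (sign \<sigma>) *
        (\<Sum>k<p. X $ ?I k $ ?J (\<sigma> k) * (\<Prod>l\<in>{..<p} - {k}. mat 1 $ ?I l $ ?J (\<sigma> l)))) =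
      (\<Sum>i\<in>I. \<Sum>j\<in>UNIV. X $ i $ j * ?c i j)" (is "?L = _") for X :: "'d matrix"
  proof -
    have prod: "(\<Prod>l<p. kron (if ?I l = ?I k then j else ?I l) (?J (\<sigma> l))) =
        kron j (?J (\<sigma> k)) * (\<Prod>l\<in>{..<p} - {k}. mat 1 $ ?I l $ ?J (\<sigma> l))" if "k < p" for k j \<sigma>
    proof -
      have "?I l \<noteq> ?I k" if "l \<in> {..<p} - {k}" for l
        using that \<open>k < p\<close> p(1) by (auto simp: nth_eq_iff_index_eq)
      then have "(\<Prod>l\<in>{..<p} - {k}. kron (if ?I l = ?I k then j else ?I l) (?J (\<sigma> l))) =
          (\<Prod>l\<in>{..<p} - {k}. mat 1 $ ?I l $ ?J (\<sigma> l))"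
        by (intro prod.cong) (auto simp: mat_def)
      then show ?thesis
        using \<open>k < p\<close> by (subst prod.remove[of _ k]) auto
    qed
    have "?L = (\<Sum>\<sigma> | \<sigma> permutes {..<p}. \<Sum>k<p. \<Sum>j\<in>UNIV. X $ ?I k $ j *
        (of_int (sign \<sigma>) * (\<Prod>l<p. kron (if ?I l = ?I k then j else ?I l) (?J (\<sigma> l)))))"
    proof (intro sum.cong refl, subst sum_distrib_left, intro sum.cong refl)
      fix \<sigma> k assume k: "k \<in> {..<p}"
      let ?P = "\<Prod>l\<in>{..<p} - {k}. mat 1 $ ?I l $ ?J (\<sigma> l) :: real"
      have "(\<Sum>j\<in>UNIV. X $ ?I k $ j * (of_int (sign \<sigma>) * (\<Prod>l<p. kron (if ?I l = ?I k then j else ?I l) (?J (\<sigma> l))))) =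
        (\<Sum>j\<in>UNIV. if j = ?J (\<sigma> k) then of_int (sign \<sigma>) * (X $ ?I k $ j * ?P) else 0)"
        using k by (intro sum.cong refl) (simp add: prod)
      then show "of_int (sign \<sigma>) * (X $ ?I k $ ?J (\<sigma> k) * ?P) =
        (\<Sum>j\<in>UNIV. X $ ?I k $ j * (of_int (sign \<sigma>) * (\<Prod>l<p. kron (if ?I l = ?I k then j else ?I l) (?J (\<sigma> l)))))"
        by simp
    qed
    also have "\<dots> = (\<Sum>k<p. \<Sum>j\<in>UNIV. \<Sum>\<sigma> | \<sigma> permutes {..<p}. X $ ?I k $ j *
        (of_int (sign \<sigma>) * (\<Prod>l<p. kron (if ?I l = ?I k then j else ?I l) (?J (\<sigma> l)))))"
      by (subst sum.swap) (intro sum.cong refl sum.swap)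
    also have "\<dots> = (\<Sum>k<p. \<Sum>j\<in>UNIV. X $ ?I k $ j * ?c (?I k) j)"
      by (simp add: ndet_def sum_distrib_left)
    also have "\<dots> = (\<Sum>i\<in>I. \<Sum>j\<in>UNIV. X $ i $ j * ?c i j)"
      using sum.reindex_bij_betw[OF bij_betw_nth_sorted[of I], of "\<lambda>i. \<Sum>j\<in>UNIV. X $ i $ j * ?c i j"] p
      by simp
    finally show ?thesis .
  qed
  also have "(\<Sum>i\<in>I. \<Sum>j\<in>UNIV. X $ i $ j * ?c i j) = (\<Sum>i\<in>I. \<Sum>j\<in>UNIV. X $ i $ j *
        (if j \<notin> I - {i} \<and> J = insert j (I - {i}) then (- 1) ^ num_between i j (I - {i}) else 0))" for X :: "'d matrix"
    by (intro sum.cong refl) (subst ndet_kron_replace[OF p], auto)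
  finally have eq: "(\<Sum>\<sigma> | \<sigma> permutes {..<p}. of_int (sign \<sigma>) *
        (\<Sum>k<p. X $ ?I k $ ?J (\<sigma> k) * (\<Prod>l\<in>{..<p} - {k}. mat 1 $ ?I l $ ?J (\<sigma> l)))) =
     (\<Sum>i\<in>I. \<Sum>j\<in>UNIV. X $ i $ j *
        (if j \<notin> I - {i} \<and> J = insert j (I - {i}) then (- 1) ^ num_between i j (I - {i}) else 0))"
    for X :: "'d matrix" .
  show ?thesis
    using has_derivative_minor[of I J "mat 1"] unfolding p(1) eq .
qed

lemma has_derivative_vec:
  fixes f :: "'a::real_normed_vector \<Rightarrow> (real, 'n::finite) vec"
  assumes "\<And>i. ((\<lambda>x. f x $ i) has_derivative (\<lambda>h. f' h $ i)) (at a within S)"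
  shows "(f has_derivative f') (at a within S)"
  unfolding has_derivative_componentwise_within[of f]
  using assms by (auto simp: Basis_vec_def inner_axis)

lemma has_derivative_pullback_mat_1:
  "((\<lambda>M. pullback p M A) has_derivative (\<lambda>X. infinitesimal_pullback p X A)) (at (mat 1))"
proof (rule has_derivative_vec)
  fix J
  show "((\<lambda>M. pullback p M A $ J) has_derivative (\<lambda>X. infinitesimal_pullback p X A $ J)) (at (mat 1))"
  proof (cases "card J = p")
    case True
    then show ?thesis
      unfolding pullback_def infinitesimal_pullback_def vec_lambda_beta if_P[OF True]
      by (intro has_derivative_sum has_derivative_mult_right has_derivative_minor_mat_1) auto
  qed (simp add: pullback_def infinitesimal_pullback_def)
qed

text \<open>
  This is where the tensor comes from: with \<open>P J\<close> the partial derivatives of \<open>L\<close>, the sum over \<open>K\<close> on the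
  right is \<open>L \<delta>\<^sub>i\<^sub>j - T\<^sub>i\<^sub>j\<close>. A pair \<open>I, J\<close> that contributes to \<open>X\<^sub>i\<^sub>j\<close> is determined by \<open>K = I - {i} = J - {j}\<close>.
\<close>

lemma infinitesimal_pullback_pairing:
  fixes P :: "('d::{finite,linorder}) set \<Rightarrow> real"
  assumes "1 \<le> p"
  shows "(\<Sum>J | card J = p. infinitesimal_pullback p X A $ J * P J) =
    (\<Sum>i\<in>UNIV. \<Sum>j\<in>UNIV. X $ i $ j *
      (\<Sum>K | card K = p - 1 \<and> i \<notin> K \<and> j \<notin> K. (- 1) ^ num_between i j K * A $ (insert i K) * P (insert j K)))"
proof -
  let ?s = "\<lambda>i j I. (- 1) ^ num_between i j (I - {i}) :: real"
  let ?F = "\<lambda>i j I. if j \<notin> I - {i} then ?s i j I * A $ I * P (insert j (I - {i})) else 0"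
  have pick: "(\<Sum>J | card J = p. (if j \<notin> I - {i} \<and> J = insert j (I - {i}) then ?s i j I else 0) * P J) =
       (if j \<notin> I - {i} then ?s i j I * P (insert j (I - {i})) else 0)"
    if "card I = p" "i \<in> I" for i j I
  proof -
    have "(\<Sum>J | card J = p. (if j \<notin> I - {i} \<and> J = insert j (I - {i}) then ?s i j I else 0) * P J) =
      (\<Sum>J | card J = p. if J = insert j (I - {i}) then (if j \<notin> I - {i} then ?s i j I * P J else 0) else 0)"
      by (intro sum.cong) auto
    moreover have "card (insert j (I - {i})) = p" if "j \<notin> I - {i}"
      using that \<open>card I = p\<close> \<open>i \<in> I\<close> assms by (simp add: card_insert_if)
    ultimately show ?thesis
      by (subst (asm) sum.delta) auto
  qed
  have "(\<Sum>J | card J = p. infinitesimal_pullback p X A $ J * P J) =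
     (\<Sum>J | card J = p. \<Sum>I | card I = p. \<Sum>i\<in>I. \<Sum>j\<in>UNIV. X $ i $ j * A $ I *
        ((if j \<notin> I - {i} \<and> J = insert j (I - {i}) then ?s i j I else 0) * P J))"
    by (intro sum.cong refl)
       (simp add: infinitesimal_pullback_def sum_distrib_left sum_distrib_right mult_ac)
  also have "\<dots> = (\<Sum>I | card I = p. \<Sum>J | card J = p. \<Sum>i\<in>I. \<Sum>j\<in>UNIV. X $ i $ j * A $ I *
        ((if j \<notin> I - {i} \<and> J = insert j (I - {i}) then ?s i j I else 0) * P J))"
    by (rule sum.swap)
  also have "\<dots> = (\<Sum>I | card I = p. \<Sum>i\<in>I. \<Sum>J | card J = p. \<Sum>j\<in>UNIV. X $ i $ j * A $ I *
        ((if j \<notin> I - {i} \<and> J = insert j (I - {i}) then ?s i j I else 0) * P J))"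
    by (intro sum.cong refl sum.swap)
  also have "\<dots> = (\<Sum>I | card I = p. \<Sum>i\<in>I. \<Sum>j\<in>UNIV. \<Sum>J | card J = p. X $ i $ j * A $ I *
        ((if j \<notin> I - {i} \<and> J = insert j (I - {i}) then ?s i j I else 0) * P J))"
    by (intro sum.cong refl sum.swap)
  also have "\<dots> = (\<Sum>I | card I = p. \<Sum>i\<in>I. \<Sum>j\<in>UNIV. X $ i $ j * ?F i j I)"
    by (intro sum.cong refl) (simp only: sum_distrib_left[symmetric] pick mem_Collect_eq, simp)
  also have "\<dots> = (\<Sum>i\<in>UNIV. \<Sum>I | card I = p \<and> i \<in> I. \<Sum>j\<in>UNIV. X $ i $ j * ?F i j I)"
    using sum.swap_restrict[of "{I :: 'd set. card I = p}" "UNIV :: 'd set" "\<lambda>I i. \<Sum>j\<in>UNIV. X $ i $ j * ?F i j I" "\<lambda>I i. i \<in> I"]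
    by simp
  also have "\<dots> = (\<Sum>i\<in>UNIV. \<Sum>j\<in>UNIV. X $ i $ j * (\<Sum>I | card I = p \<and> i \<in> I. ?F i j I))"
    by (intro sum.cong refl, subst sum.swap) (simp add: sum_distrib_left)
  also have "\<dots> = (\<Sum>i\<in>UNIV. \<Sum>j\<in>UNIV. X $ i $ j *
      (\<Sum>K | card K = p - 1 \<and> i \<notin> K \<and> j \<notin> K. (- 1) ^ num_between i j K * A $ (insert i K) * P (insert j K)))"
  proof -
    have "(\<Sum>I | card I = p \<and> i \<in> I. ?F i j I) = (\<Sum>K | card K = p - 1 \<and> i \<notin> K \<and> j \<notin> K. (- 1) ^ num_between i j K * A $ (insert i K) * P (insert j K))" for i j
    proof -
      have "(\<Sum>I | card I = p \<and> i \<in> I. ?F i j I) = (\<Sum>I | card I = p \<and> i \<in> I \<and> j \<notin> I - {i}. ?F i j I)"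
        by (rule sum.mono_neutral_right) auto
      also have "\<dots> = (\<Sum>K | card K = p - 1 \<and> i \<notin> K \<and> j \<notin> K. (- 1) ^ num_between i j K * A $ (insert i K) * P (insert j K))"
      proof (rule sum.reindex_bij_witness[where i = "insert i" and j = "\<lambda>I. I - {i}"])
        fix K assume "K \<in> {K. card K = p - 1 \<and> i \<notin> K \<and> j \<notin> K}"
        then show "insert i K \<in> {I. card I = p \<and> i \<in> I \<and> j \<notin> I - {i}}"
          using assms by auto
      qed (use assms in \<open>auto simp: insert_absorb\<close>)
      finally show ?thesis .
    qed
    then show ?thesis by simp
  qed
  finally show ?thesis .
qed

section \<open>Calculus of determinants and inverse matrices\<close>

lemma matrix_inv_mult:
  fixes A :: "real^'n^'n"
  assumes "invertible A"
  shows "A ** matrix_inv A = mat 1" "matrix_inv A ** A = mat 1"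
  using someI_ex[of "\<lambda>A'. A ** A' = mat 1 \<and> A' ** A = mat 1"] assms
  by (auto simp: invertible_def matrix_inv_def)

lemma bounded_bilinear_matrix_mult:
  "bounded_bilinear ((**) :: real^'n^'m \<Rightarrow> real^'k^'n \<Rightarrow> real^'k^'m)"
proof -
  have "bilinear ((**) :: real^'n^'m \<Rightarrow> real^'k^'n \<Rightarrow> real^'k^'m)"
    unfolding bilinear_def
    by (intro conjI allI linearI)
       (simp_all add: matrix_matrix_mult_def vec_eq_iff sum.distrib sum_distrib_left algebra_simps)
  then show ?thesis
    using bilinear_conv_bounded_bilinear by blast
qed

lemmas has_vector_derivative_matrix_mult =
  bounded_bilinear.has_vector_derivative[OF bounded_bilinear_matrix_mult]
lemmas continuous_on_matrix_mult = bounded_bilinear.continuous_on[OF bounded_bilinear_matrix_mult]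

lemma bounded_linear_transpose: "bounded_linear (transpose :: real^'n^'m \<Rightarrow> real^'m^'n)"
  by (intro linear_conv_bounded_linear[THEN iffD1] linearI) (auto simp: transpose_def vec_eq_iff)

lemma bounded_linear_entry: "bounded_linear (\<lambda>M :: real^'n^'m. M $ i $ j)"
  by (rule bounded_linear_compose[OF bounded_linear_vec_nth bounded_linear_vec_nth])

lemma has_derivative_det:
  "(det has_derivative (\<lambda>X. \<Sum>\<sigma> | \<sigma> permutes UNIV. of_int (sign \<sigma>) *
      (\<Sum>i\<in>UNIV. X $ i $ \<sigma> i * (\<Prod>k\<in>UNIV - {i}. M $ k $ \<sigma> k)))) (at (M :: real^'n^'n))"
  unfolding det_def[abs_def]
  by (intro has_derivative_sum has_derivative_mult_right has_derivative_prod
      bounded_linear_imp_has_derivative bounded_linear_entry)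

text \<open>
  Only the identity permutation contributes: any other one moves an index besides \<open>i\<close>, and so selects an
  off-diagonal entry of the identity matrix.
\<close>

lemma has_derivative_det_mat_1: "(det has_derivative trace) (at (mat 1 :: real^'n^'n))"
proof -
  have eq: "(\<Sum>\<sigma> | \<sigma> permutes UNIV. of_int (sign \<sigma>) *
      (\<Sum>i\<in>UNIV. X $ i $ \<sigma> i * (\<Prod>k\<in>UNIV - {i}. mat 1 $ k $ \<sigma> k))) = trace X" for X :: "real^'n^'n"
  proof -
    have "(\<Sum>i\<in>UNIV. X $ i $ \<sigma> i * (\<Prod>k\<in>UNIV - {i}. mat 1 $ k $ \<sigma> k)) = (if \<sigma> = id then trace X else 0)"
      if \<sigma>: "\<sigma> permutes UNIV" for \<sigma> :: "'n \<Rightarrow> 'n"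
    proof (cases "\<sigma> = id")
      case True
      then show ?thesis by (simp add: trace_def mat_def)
    next
      case False
      have "\<exists>k\<in>UNIV - {i}. \<sigma> k \<noteq> k" for i
      proof (rule ccontr)
        assume a: "\<not> (\<exists>k\<in>UNIV - {i}. \<sigma> k \<noteq> k)"
        then have "\<sigma> i = i"
          using permutes_inj[OF \<sigma>] by (metis DiffI UNIV_I injD singletonD)
        then show False using False a by (auto simp: fun_eq_iff)
      qed
      then have "(\<Prod>k\<in>UNIV - {i}. mat 1 $ k $ \<sigma> k :: real) = 0" for i
        by (intro prod_zero) (auto simp: mat_def, metis)
      then show ?thesis using False by (simp only: mult_zero_right sum.neutral_const if_False)
    qed
    then have "(\<Sum>\<sigma> | \<sigma> permutes UNIV. of_int (sign \<sigma>) *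
      (\<Sum>i\<in>UNIV. X $ i $ \<sigma> i * (\<Prod>k\<in>UNIV - {i}. mat 1 $ k $ \<sigma> k))) =
      (\<Sum>\<sigma> | \<sigma> permutes (UNIV :: 'n set). if \<sigma> = id then trace X else 0)"
      by (intro sum.cong refl) auto
    also have "\<dots> = trace X"
      by (subst sum.delta) (auto simp: finite_permutations permutes_id)
    finally show ?thesis .
  qed
  show ?thesis
    using has_derivative_det[of "mat 1 :: real^'n^'n"] unfolding eq .
qed

lemma continuous_on_det: "continuous_on S (det :: real^'n^'n \<Rightarrow> real)"
  by (intro continuous_at_imp_continuous_on ballI has_derivative_continuous[OF has_derivative_det])

lemma open_invertible: "open {A :: real^'n^'n. invertible A}"
  unfolding invertible_det_nz
  by (rule open_Collect_neq) (auto intro: continuous_on_det)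

text \<open>
  Cramer's rule writes the entries of the inverse as quotients of determinants, in a neighbourhood of
  \<open>A\<close> because the invertible matrices form an open set.
\<close>

lemma differentiable_matrix_inv:
  fixes A :: "real^'n^'n"
  assumes "invertible A"
  shows "matrix_inv differentiable (at A)"
proof -
  define C where "C i j A = (\<chi> a b. if b = i then axis j 1 $ a else A $ a $ b)" for i j and A :: "real^'n^'n"
  have cr: "matrix_inv A $ i $ j = det (C i j A) / det A" if A: "invertible A" for i j and A :: "real^'n^'n"
  proof -
    have "det A \<noteq> 0" using A invertible_det_nz by blast
    moreover have "A *v (matrix_inv A *v axis j 1) = axis j 1"
      by (simp only: matrix_vector_mul_assoc matrix_inv_mult(1)[OF A] matrix_vector_mul_lid)
    ultimately have "matrix_inv A *v axis j 1 = (\<chi> k. det (C k j A) / det A)"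
      unfolding C_def by (rule iffD1[OF cramer])
    then have "(matrix_inv A *v axis j 1) $ i = (\<chi> k. det (C k j A) / det A) $ i"
      by (rule arg_cong)
    then show ?thesis
      by (simp only: matrix_vector_mult_basis column_def vec_lambda_beta)
  qed
  have "(\<lambda>A. matrix_inv A $ i) differentiable (at A)" for i
  proof -
    have "(\<lambda>A. det (C i j A) / det A) differentiable (at A)" for j
    proof (rule differentiable_divide)
      have "linear (\<lambda>A. C i j A - C i j 0)"
        by (rule linearI) (simp_all add: C_def vec_eq_iff)
      then have "bounded_linear (\<lambda>A. C i j A - C i j 0)"
        by (simp add: linear_conv_bounded_linear)
      then have "(\<lambda>A. (C i j A - C i j 0) + C i j 0) differentiable (at A)"
        by (intro differentiable_add bounded_linear_imp_differentiable differentiable_const)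
      then have "C i j differentiable (at A)" by simp
      moreover have "det differentiable (at (C i j A))"
        using has_derivative_det differentiableI by blast
      ultimately show "(\<lambda>A. det (C i j A)) differentiable (at A)"
        using differentiable_chain_at[of "C i j" A det] by (simp add: o_def)
      show "det differentiable (at A)"
        using has_derivative_det differentiableI by blast
      show "det A \<noteq> 0"
        using assms by (simp add: invertible_det_nz)
    qed
    then obtain D where D: "\<And>j. ((\<lambda>A. det (C i j A) / det A) has_derivative D j) (at A)"
      unfolding differentiable_def by metis
    have "((\<lambda>A. matrix_inv A $ i) has_derivative (\<lambda>X. \<chi> j. D j X)) (at A)"
    proof (rule has_derivative_vec)
      fix j
      show "((\<lambda>A. matrix_inv A $ i $ j) has_derivative (\<lambda>X. (\<chi> j. D j X) $ j)) (at A)"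
        unfolding vec_lambda_beta
        by (rule has_derivative_transform_within_open[OF D open_invertible]) (use assms cr in auto)
    qed
    then show ?thesis by (rule differentiableI)
  qed
  then obtain D where D: "\<And>i. ((\<lambda>A. matrix_inv A $ i) has_derivative D i) (at A)"
    unfolding differentiable_def by metis
  have "(matrix_inv has_derivative (\<lambda>X. \<chi> i. D i X)) (at A)"
    proof (subst has_derivative_componentwise_within, rule ballI)
    fix b :: "real^'n^'n" assume "b \<in> Basis"
    then obtain i u where b: "b = axis i u" by (auto simp: Basis_vec_def)
    then show "((\<lambda>x. matrix_inv x \<bullet> b) has_derivative (\<lambda>x. (\<chi> i. D i x) \<bullet> b)) (at A)"
      using has_derivative_inner_left[OF D[of i], of u] by (simp add: inner_axis)
  qed
  then show ?thesis by (rule differentiableI)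
qed

section \<open>The Lagrangian along a curve of matrices\<close>

lemma pullback_mat_1:
  assumes "1 \<le> p" "A \<in> forms p"
  shows "pullback p (mat 1) A = A"
proof -
  have "minor (mat 1) I J = (if J = I then 1 else 0)" if IJ: "card I = p" "card J = p" for I J :: "'a::{finite,linorder} set"
  proof -
    obtain i where i: "i \<in> I"
      using IJ assms(1) by (metis card.empty ex_in_conv not_one_le_zero)
    have "minor (mat 1) I J = ndet p (\<lambda>k l. kron (if sorted_list_of_set I ! k = i then i else sorted_list_of_set I ! k)
            (sorted_list_of_set J ! l))"
      unfolding minor_eq_ndet IJ by (rule ndet_cong) (auto simp: mat_def)
    also have "\<dots> = (if J = I then 1 else 0)"
    proof -
      have "num_between i i (I - {i}) = 0"
        unfolding num_between_def min.idem max.idem by (subst card_eq_0_iff) auto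
      then show ?thesis
        using i by (subst ndet_kron_replace[OF IJ i]) (auto simp: insert_absorb)
    qed
    finally show ?thesis .
  qed
  then have "(\<Sum>I | card I = p. A $ I * minor (mat 1) I J) = A $ J" if "card J = p" for J
  proof -
    have "(\<Sum>I | card I = p. A $ I * minor (mat 1) I J) = (\<Sum>I | card I = p. if I = J then A $ I else 0)"
      using that \<open>\<And>J I. card I = p \<Longrightarrow> card J = p \<Longrightarrow> minor (mat 1) I J = (if J = I then 1 else 0)\<close>
      by (intro sum.cong refl) auto
    then show ?thesis using that by (simp add: sum.delta')
  qed
  then show ?thesis
    using assms(2) by (auto simp: pullback_def forms_def vec_eq_iff)
qed

lemma form_part_forms: "A \<in> forms p \<Longrightarrow> form_part p A = A"
  by (auto simp: forms_def form_part_def vec_eq_iff)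

lemma differentiable_of_smooth_on_forms:
  assumes "smooth_on_forms p L"
  shows "(\<lambda>A. L (form_part p A)) differentiable (at A)"
proof -
  have "Ck (Suc 0) (\<lambda>A. L (form_part p A))"
    using assms by (auto simp: smooth_on_forms_def smooth_def)
  then show ?thesis by simp
qed

lemma frechet_derivative_on_forms:
  assumes "smooth_on_forms p L" and A: "A \<in> forms p" and B: "B \<in> forms p"
  shows "frechet_derivative (\<lambda>A. L (form_part p A)) (at A) B =
    (\<Sum>J | card J = p. B $ J * partial_form L J A)"
proof -
  let ?F = "\<lambda>A. L (form_part p A)"
  let ?D = "frechet_derivative ?F (at A)"
  have D: "(?F has_derivative ?D) (at A)"
    using differentiable_of_smooth_on_forms[OF assms(1)] frechet_derivative_works by blast
  have lin: "linear ?D" using D has_derivative_linear by blast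
  have part: "partial_form L J A = ?D (axis J 1)" if "card J = p" for J
  proof -
    have path: "((\<lambda>t. A + t *\<^sub>R axis J 1) has_vector_derivative axis J 1) (at 0)"
      by (auto intro!: derivative_eq_intros)
    have "((\<lambda>t. ?F (A + t *\<^sub>R axis J 1)) has_derivative (\<lambda>h. ?D (h *\<^sub>R axis J 1))) (at 0)"
      using has_derivative_compose[OF path[unfolded has_vector_derivative_def], of ?F ?D] D by simp
    then have "((\<lambda>t. ?F (A + t *\<^sub>R axis J 1)) has_real_derivative ?D (axis J 1)) (at 0)"
      by (simp add: has_field_derivative_def linear_scale[OF lin] mult_commute_abs)
    moreover have "form_part p (A + t *\<^sub>R axis J 1) = A + t *\<^sub>R axis J 1" for t
      using A that by (intro form_part_forms) (auto simp: forms_def axis_def)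
    ultimately show ?thesis
      by (simp add: partial_form_def DERIV_imp_deriv)
  qed
  have "B = (\<Sum>J\<in>UNIV. B $ J *\<^sub>R axis J 1)"
    using basis_expansion[of B] by (simp add: scalar_mult_eq_scaleR)
  also have "\<dots> = (\<Sum>J | card J = p. B $ J *\<^sub>R axis J 1)"
    using B by (intro sum.mono_neutral_right) (auto simp: forms_def)
  finally have "?D B = ?D (\<Sum>J | card J = p. B $ J *\<^sub>R axis J 1)" by simp
  also have "\<dots> = (\<Sum>J | card J = p. B $ J * ?D (axis J 1))"
    by (simp add: linear_sum[OF lin] linear_scale[OF lin])
  finally show ?thesis using part by simp
qed

lemma infinitesimal_pullback_in_forms: "infinitesimal_pullback p X A \<in> forms p"
  by (simp add: forms_def infinitesimal_pullback_def)

text \<open>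
  The chain rule for \<open>R\<close>, the pullback of \<open>A\<close> and \<open>L\<close>. The trace appears because the diagonal of \<open>T\<close> contains
  the additional term \<open>L(A)\<close>.
\<close>

lemma lagrangian_derivative:
  assumes p: "1 \<le> p" and L: "smooth_on_forms p L" and A: "A \<in> forms p"
    and R0: "R 0 = mat 1" and R: "(R has_vector_derivative X) (at 0)"
  shows "((\<lambda>t. L (pullback p (R t) A)) has_real_derivative
     (L A * trace X - (\<Sum>i\<in>UNIV. \<Sum>j\<in>UNIV. X $ i $ j * tensor p L A $ i $ j))) (at 0)"
proof -
  let ?F = "\<lambda>A. L (form_part p A)"
  let ?D = "frechet_derivative ?F (at A)"
  have D: "(?F has_derivative ?D) (at A)"
    using differentiable_of_smooth_on_forms[OF L] frechet_derivative_works by blast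
  have lin: "linear ?D" using D has_derivative_linear by blast
  have 1: "((\<lambda>t. pullback p (R t) A) has_derivative (\<lambda>h. infinitesimal_pullback p (h *\<^sub>R X) A)) (at 0)"
    using has_derivative_compose[OF R[unfolded has_vector_derivative_def], of "\<lambda>M. pullback p M A" "\<lambda>X. infinitesimal_pullback p X A"]
    unfolding R0 using has_derivative_pullback_mat_1 by blast
  have pl: "linear (\<lambda>X. infinitesimal_pullback p X A)"
    using has_derivative_pullback_mat_1 has_derivative_linear by blast
  have "((\<lambda>t. ?F (pullback p (R t) A)) has_derivative (\<lambda>h. ?D (infinitesimal_pullback p (h *\<^sub>R X) A))) (at 0)"
    using has_derivative_compose[OF 1, of ?F ?D] D R0 pullback_mat_1[OF p A] by simp
  then have 2: "((\<lambda>t. L (pullback p (R t) A)) has_real_derivative ?D (infinitesimal_pullback p X A)) (at 0)"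
    by (simp add: has_field_derivative_def linear_scale[OF lin] linear_scale[OF pl] mult_commute_abs
        form_part_forms[OF pullback_in_forms])
  have "?D (infinitesimal_pullback p X A) = (\<Sum>i\<in>UNIV. \<Sum>j\<in>UNIV. X $ i $ j *
      (\<Sum>K | card K = p - 1 \<and> i \<notin> K \<and> j \<notin> K. (- 1) ^ num_between i j K * A $ (insert i K) * partial_form L (insert j K) A))"
    by (simp add: frechet_derivative_on_forms[OF L A infinitesimal_pullback_in_forms] infinitesimal_pullback_pairing[OF p])
  also have "\<dots> = (\<Sum>i\<in>UNIV. \<Sum>j\<in>UNIV. X $ i $ j * (L A * (if i = j then 1 else 0) - tensor p L A $ i $ j))"
    by (intro sum.cong refl) (simp add: tensor_def)
  also have "\<dots> = (\<Sum>i\<in>UNIV. \<Sum>j\<in>UNIV. if i = j then L A * X $ i $ j else 0)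
       - (\<Sum>i\<in>UNIV. \<Sum>j\<in>UNIV. X $ i $ j * tensor p L A $ i $ j)"
    unfolding sum_subtractf[symmetric] by (intro sum.cong refl) (auto simp: algebra_simps)
  also have "(\<Sum>i\<in>UNIV. \<Sum>j\<in>UNIV. if i = j then L A * X $ i $ j else 0) = L A * trace X"
    by (simp add: trace_def sum_distrib_left)
  finally show ?thesis using 2 by simp
qed


section \<open>The Lie algebra of the orthogonal group\<close>

text \<open>
  The Lie algebra of \<open>O(S)\<close>. For symmetric \<open>S\<close> the condition says that \<open>S X\<close> is antisymmetric.
\<close>

definition orthogonal_algebra :: "'d matrix \<Rightarrow> (('d::finite) matrix) set" where
  "orthogonal_algebra S = {X. transpose X ** S + S ** X = 0}"

text \<open>
  The source of all curves in \<open>O(S)\<close> used below. With \<open>U = 1 - t X\<close> and \<open>V = 1 + t X\<close> for \<open>X\<close> in the Lie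
  algebra, \<open>V U\<^sup>-\<^sup>1\<close> is the Cayley transform of \<open>t X\<close>.
\<close>

lemma quotient_in_orthogonal_group:
  fixes S U V :: "('d::finite) matrix"
  assumes "invertible U" "transpose V ** S ** V = transpose U ** S ** U"
  shows "V ** matrix_inv U \<in> orthogonal_group S"
proof -
  let ?W = "matrix_inv U"
  have "transpose (V ** ?W) ** S ** (V ** ?W) = transpose ?W ** (transpose V ** S ** V) ** ?W"
    by (simp add: matrix_transpose_mul matrix_mul_assoc)
  also have "\<dots> = transpose (U ** ?W) ** S ** (U ** ?W)"
    by (simp add: assms(2) matrix_transpose_mul matrix_mul_assoc)
  also have "\<dots> = S"
    by (simp add: matrix_inv_mult[OF assms(1)] transpose_mat)
  finally show ?thesis by (simp add: orthogonal_group_def)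
qed

lemma invertible_of_orthogonal_group:
  fixes S M :: "('d::finite) matrix"
  assumes "M \<in> orthogonal_group S" "invertible S"
  shows "invertible M"
proof -
  have "matrix_inv S ** transpose M ** S ** M = mat 1"
    using assms by (simp add: orthogonal_group_def matrix_mul_assoc[symmetric] matrix_inv_mult)
  then show ?thesis
    by (metis invertible_left_inverse)
qed

lemma orthogonal_group_inverse_mult:
  fixes S M N :: "('d::finite) matrix"
  assumes "M \<in> orthogonal_group S" "N \<in> orthogonal_group S" "invertible S"
  shows "matrix_inv M ** N \<in> orthogonal_group S"
proof -
  note inv = matrix_inv_mult[OF invertible_of_orthogonal_group[OF assms(1,3)]]
  have "S = transpose (M ** matrix_inv M) ** S ** (M ** matrix_inv M)"
    by (simp add: inv transpose_mat)
  also have "\<dots> = transpose (matrix_inv M) ** (transpose M ** S ** M) ** matrix_inv M"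
    by (simp add: matrix_transpose_mul matrix_mul_assoc)
  finally have "transpose (matrix_inv M) ** S ** matrix_inv M = S"
    using assms(1) by (simp add: orthogonal_group_def)
  moreover have "transpose (matrix_inv M ** N) ** S ** (matrix_inv M ** N) =
      transpose N ** (transpose (matrix_inv M) ** S ** matrix_inv M) ** N"
    by (simp add: matrix_transpose_mul matrix_mul_assoc)
  ultimately show ?thesis
    using assms(2) by (simp add: orthogonal_group_def)
qed

text \<open>
  The condition makes \<open>X\<close> similar to \<open>- X\<^sup>T\<close>, so that the trace equals its own negative.
\<close>

lemma trace_orthogonal_algebra:
  fixes S X :: "('d::finite) matrix"
  assumes "X \<in> orthogonal_algebra S" "invertible S"
  shows "trace X = 0"
proof -
  have "S ** X = - (transpose X ** S)"
    using assms(1) by (simp add: orthogonal_algebra_def add_eq_0_iff)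
  then have "S ** X = - transpose X ** S"
    by (simp add: matrix_matrix_mult_def vec_eq_iff sum_negf)
  then have "X = matrix_inv S ** (- transpose X ** S)"
    by (metis assms(2) matrix_inv_mult(2) matrix_mul_assoc matrix_mul_lid)
  then have "trace X = trace (- transpose X ** S ** matrix_inv S)"
    using trace_mul_sym by metis
  also have "\<dots> = - trace X"
    by (simp add: matrix_mul_assoc[symmetric] matrix_inv_mult[OF assms(2)])
       (simp add: trace_def transpose_def sum_negf)
  finally show ?thesis by simp
qed

lemma pairing_eq_trace:
  "(\<Sum>i\<in>UNIV. \<Sum>j\<in>UNIV. X $ i $ j * T $ i $ j) = trace (transpose X ** (T :: real^'n^'m))"
  unfolding trace_def matrix_matrix_mult_def transpose_def by (simp, rule sum.swap)

text \<open>
  Write \<open>W = S\<^sup>-\<^sup>1 T\<close> and \<open>Y = S X\<close>. The pairing of \<open>X\<close> with \<open>T\<close> equals that of \<open>Y\<close> with \<open>W\<close>, and as \<open>X\<close> ranges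
  over the Lie algebra, \<open>Y\<close> ranges over the antisymmetric matrices; their orthogonal complement is the
  space of symmetric matrices.
\<close>

lemma symmetric_iff_annihilates_orthogonal_algebra:
  fixes S T :: "('d::finite) matrix"
  assumes S: "transpose S = S" "invertible S"
  shows "transpose (matrix_inv S ** T) = matrix_inv S ** T \<longleftrightarrow>
    (\<forall>X\<in>orthogonal_algebra S. (\<Sum>i\<in>UNIV. \<Sum>j\<in>UNIV. X $ i $ j * T $ i $ j) = 0)"
proof -
  define W where "W = matrix_inv S ** T"
  have T: "T = S ** W"
    by (simp add: W_def matrix_mul_assoc matrix_inv_mult[OF S(2)])
  have pair: "(\<Sum>i\<in>UNIV. \<Sum>j\<in>UNIV. X $ i $ j * T $ i $ j) = (\<Sum>i\<in>UNIV. \<Sum>j\<in>UNIV. (S ** X) $ i $ j * W $ i $ j)"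
    for X
    unfolding pairing_eq_trace T by (simp add: matrix_transpose_mul S matrix_mul_assoc)
  show ?thesis
    unfolding W_def[symmetric]
  proof
    assume W: "transpose W = W"
    show "\<forall>X\<in>orthogonal_algebra S. (\<Sum>i\<in>UNIV. \<Sum>j\<in>UNIV. X $ i $ j * T $ i $ j) = 0"
    proof
      fix X assume X: "X \<in> orthogonal_algebra S"
      define Y where "Y = S ** X"
      have "transpose Y + Y = 0"
        using X by (simp add: orthogonal_algebra_def matrix_transpose_mul Y_def S)
      then have Y: "Y $ i $ j = - Y $ j $ i" for i j
        by (simp add: vec_eq_iff transpose_def) (metis add_eq_0_iff)
      have W: "W $ i $ j = W $ j $ i" for i j
        using W by (simp add: vec_eq_iff transpose_def)
      let ?s = "\<Sum>i\<in>UNIV. \<Sum>j\<in>UNIV. Y $ i $ j * W $ i $ j"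
      have "?s = (\<Sum>i\<in>UNIV. \<Sum>j\<in>UNIV. Y $ j $ i * W $ j $ i)"
        by (rule sum.swap)
      also have "\<dots> = (\<Sum>i\<in>UNIV. \<Sum>j\<in>UNIV. - (Y $ i $ j * W $ i $ j))"
        by (intro sum.cong refl, subst Y, subst W) simp
      also have "\<dots> = - ?s" by (simp add: sum_negf)
      finally have "?s = 0" by simp
      then show "(\<Sum>i\<in>UNIV. \<Sum>j\<in>UNIV. X $ i $ j * T $ i $ j) = 0"
        unfolding pair Y_def .
    qed
  next
    assume ann: "\<forall>X\<in>orthogonal_algebra S. (\<Sum>i\<in>UNIV. \<Sum>j\<in>UNIV. X $ i $ j * T $ i $ j) = 0"
    define Y where "Y = W - transpose W"
    define X where "X = matrix_inv S ** Y"
    have SX: "S ** X = Y"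
      by (simp add: X_def matrix_mul_assoc matrix_inv_mult[OF S(2)])
    have "transpose X ** S = transpose (S ** X)"
      by (simp add: matrix_transpose_mul S)
    then have "X \<in> orthogonal_algebra S"
      unfolding orthogonal_algebra_def mem_Collect_eq SX by (simp add: Y_def transpose_def vec_eq_iff)
    then have 0: "(\<Sum>i\<in>UNIV. \<Sum>j\<in>UNIV. Y $ i $ j * W $ i $ j) = 0"
      using ann[rule_format, of X] unfolding pair SX by blast
    have "(\<Sum>i\<in>UNIV. \<Sum>j\<in>UNIV. Y $ i $ j * W $ j $ i) = (\<Sum>i\<in>UNIV. \<Sum>j\<in>UNIV. Y $ j $ i * W $ i $ j)"
      by (rule sum.swap)
    also have "\<dots> = (\<Sum>i\<in>UNIV. \<Sum>j\<in>UNIV. - (Y $ i $ j * W $ i $ j))"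
      by (intro sum.cong refl) (simp add: Y_def transpose_def algebra_simps)
    also have "\<dots> = 0" using 0 by (simp add: sum_negf)
    finally have "(\<Sum>i\<in>UNIV. \<Sum>j\<in>UNIV. Y $ i $ j * Y $ i $ j) = 0"
      using 0 by (simp add: Y_def[of] transpose_def right_diff_distrib sum_subtractf)
    then have "Y \<bullet> Y = 0" by (simp add: inner_vec_def)
    then show "transpose W = W" by (simp add: Y_def)
  qed
qed

text \<open>
  Differentiate \<open>c\<^sup>T S c = S\<close> and substitute \<open>c' = c Z\<close>.
\<close>

lemma orthogonal_path_derivative:
  fixes S :: "'d::finite matrix"
  assumes S: "invertible S"
    and c: "(c has_vector_derivative c') (at t)"
    and ev: "\<forall>\<^sub>F s in nhds t. c s \<in> orthogonal_group S"
  shows "matrix_inv (c t) ** c' \<in> orthogonal_algebra S"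
proof -
  have ct: "c t \<in> orthogonal_group S"
    using eventually_nhds_x_imp_x[OF ev] .
  note inv = matrix_inv_mult[OF invertible_of_orthogonal_group[OF ct S]]
  define Z where "Z = matrix_inv (c t) ** c'"
  have c': "c' = c t ** Z"
    by (simp add: Z_def matrix_mul_assoc inv)
  have tr: "((\<lambda>s. transpose (c s)) has_vector_derivative transpose c') (at t)"
    using bounded_linear.has_vector_derivative[OF bounded_linear_transpose c] .
  have 1: "((\<lambda>s. transpose (c s) ** S) has_vector_derivative transpose c' ** S) (at t)"
    using has_vector_derivative_matrix_mult[OF tr has_vector_derivative_const[of S]]
    by (simp add: bounded_bilinear.zero_right[OF bounded_bilinear_matrix_mult])
  have 2: "((\<lambda>s. transpose (c s) ** S ** c s) has_vector_derivative
      transpose (c t) ** S ** c' + transpose c' ** S ** c t) (at t)"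
    using has_vector_derivative_matrix_mult[OF 1 c] .
  have "((\<lambda>s. transpose (c s) ** S ** c s) has_vector_derivative 0) (at t)"
  proof -
    obtain T where T: "open T" "t \<in> T" "\<And>s. s \<in> T \<Longrightarrow> c s \<in> orthogonal_group S"
      using ev unfolding eventually_nhds by blast
    show ?thesis
      by (rule has_vector_derivative_transform_within_open[OF has_vector_derivative_const[of S] T(1,2)])
         (use T(3) in \<open>simp add: orthogonal_group_def\<close>)
  qed
  then have "transpose (c t) ** S ** c' + transpose c' ** S ** c t = 0"
    using 2 vector_derivative_unique_at by blast
  moreover have "transpose (c t) ** S ** c' = transpose (c t) ** S ** c t ** Z"
    by (simp add: c' matrix_mul_assoc)
  moreover have "transpose c' ** S ** c t = transpose Z ** (transpose (c t) ** S ** c t)"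
    by (simp add: c' matrix_mul_assoc matrix_transpose_mul)
  ultimately show ?thesis
    using ct unfolding orthogonal_group_def orthogonal_algebra_def Z_def[symmetric]
    by (simp add: add.commute)
qed

lemma eventually_nhds_of_isCont:
  assumes "isCont U t" "open T" "U t \<in> T"
  shows "\<forall>\<^sub>F s in nhds t. U s \<in> T"
proof -
  have "\<forall>\<^sub>F s in at t. U s \<in> T"
    using assms by (auto simp: isCont_def intro: topological_tendstoD)
  then show ?thesis
    using assms(3) by (auto simp: eventually_at_filter elim: eventually_mono)
qed

text \<open>
  The second property, the product rule for \<open>(V U\<^sup>-\<^sup>1) U = V\<close>, determines the velocity \<open>c'\<close> without a
  formula for the derivative of the inverse.
\<close>

lemma differentiable_quotient_path:
  fixes U V :: "real \<Rightarrow> real^'n^'n"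
  assumes "invertible (U t)" "(U has_vector_derivative U') (at t)" "(V has_vector_derivative V') (at t)"
  obtains c' where "((\<lambda>s. V s ** matrix_inv (U s)) has_vector_derivative c') (at t)"
    "c' ** U t + V t ** matrix_inv (U t) ** U' = V'"
proof -
  obtain D where "(matrix_inv has_derivative D) (at (U t))"
    using differentiable_matrix_inv[OF assms(1)] differentiable_def by blast
  then have "((\<lambda>s. matrix_inv (U s)) has_derivative (\<lambda>h. D (h *\<^sub>R U'))) (at t)"
    using has_derivative_compose[OF assms(2)[unfolded has_vector_derivative_def]] by blast
  moreover have "linear D"
    using \<open>(matrix_inv has_derivative D) (at (U t))\<close> has_derivative_linear by blast
  ultimately have "((\<lambda>s. matrix_inv (U s)) has_vector_derivative D U') (at t)"
    by (simp add: has_vector_derivative_def linear_scale)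
  from has_vector_derivative_matrix_mult[OF assms(3) this]
  obtain c' where c': "((\<lambda>s. V s ** matrix_inv (U s)) has_vector_derivative c') (at t)" by blast
  have "((\<lambda>s. (V s ** matrix_inv (U s)) ** U s) has_vector_derivative
      V t ** matrix_inv (U t) ** U' + c' ** U t) (at t)"
    using has_vector_derivative_matrix_mult[OF c' assms(2)] .
  moreover have "isCont U t"
    using assms(2) has_vector_derivative_continuous by blast
  then have "\<forall>\<^sub>F s in nhds t. U s \<in> {A. invertible A}"
    using assms(1) open_invertible by (intro eventually_nhds_of_isCont) auto
  then obtain T where T: "open T" "t \<in> T" "\<And>s. s \<in> T \<Longrightarrow> invertible (U s)"
    unfolding eventually_nhds by blast
  ultimately have "(V has_vector_derivative V t ** matrix_inv (U t) ** U' + c' ** U t) (at t)"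
    by (elim has_vector_derivative_transform_within_open[OF _ T(1,2)])
       (simp add: matrix_mul_assoc[symmetric] matrix_inv_mult T(3))
  then have "V t ** matrix_inv (U t) ** U' + c' ** U t = V'"
    using assms(3) vector_derivative_unique_at by blast
  then show ?thesis
    using c' that by (simp add: add.commute)
qed

section \<open>Symmetry of the tensor and invariance\<close>

text \<open>
  Writing \<open>c(t + h) = c(t) R(h)\<close> gives \<open>c(t + h)\<^sup>* A = R(h)\<^sup>* (c(t)\<^sup>* A)\<close>, so the derivative at \<open>t\<close> is one at the
  identity, for the form \<open>c(t)\<^sup>* A\<close> and a velocity in the Lie algebra.
\<close>

lemma lagrangian_derivative_along_orthogonal_path:
  assumes p: "1 \<le> p" and L: "smooth_on_forms p L" and S: "transpose S = S" "invertible S"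
    and sym: "\<forall>A\<in>forms p. transpose (matrix_inv S ** tensor p L A) = matrix_inv S ** tensor p L A"
    and c: "(c has_vector_derivative c') (at t)"
    and ev: "\<forall>\<^sub>F s in nhds t. c s \<in> orthogonal_group S"
  shows "((\<lambda>s. L (pullback p (c s) A)) has_real_derivative 0) (at t)"
proof -
  have ct: "c t \<in> orthogonal_group S"
    using eventually_nhds_x_imp_x[OF ev] .
  note inv = matrix_inv_mult[OF invertible_of_orthogonal_group[OF ct S(2)]]
  define B where "B = pullback p (c t) A"
  define Z where "Z = matrix_inv (c t) ** c'"
  define R where "R h = matrix_inv (c t) ** c (t + h)" for h
  have Z: "Z \<in> orthogonal_algebra S"
    unfolding Z_def by (rule orthogonal_path_derivative[OF S(2) c ev])
  have B: "B \<in> forms p" by (simp add: B_def pullback_in_forms)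
  have "((\<lambda>h. c (t + h)) has_vector_derivative c') (at 0)"
  proof -
    have "((\<lambda>h. t + h) has_vector_derivative 1) (at 0)"
      by (auto intro!: derivative_eq_intros)
    then show ?thesis
      using vector_diff_chain_at[of "\<lambda>h. t + h" 1 0 c c'] c by (simp add: o_def)
  qed
  then have R: "(R has_vector_derivative Z) (at 0)"
    unfolding R_def Z_def
    by (rule bounded_linear.has_vector_derivative[OF bounded_bilinear.bounded_linear_right[OF bounded_bilinear_matrix_mult]])
  have "((\<lambda>h. L (pullback p (R h) B)) has_real_derivative
      (L B * trace Z - (\<Sum>i\<in>UNIV. \<Sum>j\<in>UNIV. Z $ i $ j * tensor p L B $ i $ j))) (at 0)"
    by (rule lagrangian_derivative[OF p L B _ R]) (simp add: R_def inv)
  also have "L B * trace Z - (\<Sum>i\<in>UNIV. \<Sum>j\<in>UNIV. Z $ i $ j * tensor p L B $ i $ j) = 0"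
    using symmetric_iff_annihilates_orthogonal_algebra[OF S, of "tensor p L B"] sym B Z
      trace_orthogonal_algebra[OF Z S(2)] by simp
  also have "(\<lambda>h. L (pullback p (R h) B)) = (\<lambda>h. L (pullback p (c (t + h)) A))"
    by (simp add: R_def B_def pullback_mult[symmetric] matrix_mul_assoc inv)
  finally show ?thesis
    by (simp add: DERIV_shift[of _ _ 0 t, simplified add_0] add.commute)
qed

text \<open>
  Near \<open>1\<close> the Cayley transform is a chart of \<open>O(S)\<close>, and scaling the chart gives a curve from \<open>1\<close> to \<open>R\<close>.
  In terms of \<open>R\<close> this curve is \<open>V(t) U(t)\<^sup>-\<^sup>1\<close>, where \<open>V\<close> and \<open>U\<close> arise from each other by exchanging the
  weights of \<open>R\<close> and \<open>1\<close>; this exchange preserves the quadratic form below because \<open>R\<close> preserves \<open>S\<close>.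
\<close>

lemma invariant_near_identity:
  fixes S :: "'d::{finite,linorder} matrix"
  assumes p: "1 \<le> p" and L: "smooth_on_forms p L" and S: "transpose S = S" "invertible S"
    and sym: "\<forall>A\<in>forms p. transpose (matrix_inv S ** tensor p L A) = matrix_inv S ** tensor p L A"
  obtains \<delta> where "0 < \<delta>"
    "\<And>R A. R \<in> orthogonal_group S \<Longrightarrow> R \<in> ball (mat 1) \<delta> \<Longrightarrow> A \<in> forms p \<Longrightarrow> L (pullback p R A) = L A"
proof -
  have "invertible (mat 1 :: 'd matrix)"
    unfolding invertible_def by (auto intro: exI[of _ "mat 1"])
  then obtain \<delta> where \<delta>: "0 < \<delta>" "ball (mat 1) \<delta> \<subseteq> {M :: 'd matrix. invertible M}"
    using openE[OF open_invertible, of "mat 1"] by auto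
  have "L (pullback p R A) = L A"
    if R: "R \<in> orthogonal_group S" "R \<in> ball (mat 1) \<delta>" and A: "A \<in> forms p" for R A
  proof -
    define U where "U t = ((1 - t) / 2) *\<^sub>R R + ((1 + t) / 2) *\<^sub>R (mat 1 :: 'd matrix)" for t :: real
    define V where "V t = ((1 + t) / 2) *\<^sub>R R + ((1 - t) / 2) *\<^sub>R (mat 1 :: 'd matrix)" for t :: real
    define c where "c t = V t ** matrix_inv (U t)" for t
    have U': "(U has_vector_derivative (- (1/2) *\<^sub>R R + (1/2) *\<^sub>R mat 1)) (at t)" for t
      unfolding U_def by (auto intro!: derivative_eq_intros simp: has_real_derivative_iff_has_vector_derivative[symmetric])
    have V': "(V has_vector_derivative ((1/2) *\<^sub>R R + (- (1/2)) *\<^sub>R mat 1)) (at t)" for t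
      unfolding V_def by (auto intro!: derivative_eq_intros simp: has_real_derivative_iff_has_vector_derivative[symmetric])
    have inv: "invertible (U t)" if "t \<in> {0..1}" for t
    proof -
      have "U t \<in> ball (mat 1) \<delta>"
        unfolding U_def using R(2) \<delta>(1) that
        by (intro convexD[OF convex_ball]) (auto simp: field_simps)
      then show ?thesis using \<delta>(2) by auto
    qed
    \<comment> \<open>The right-hand side is symmetric in \<open>a\<close> and \<open>b\<close>, so exchanging the weights keeps the form.\<close>
    have expand: "transpose (a *\<^sub>R R + b *\<^sub>R mat 1) ** S ** (a *\<^sub>R R + b *\<^sub>R mat 1) =
        (a * a + b * b) *\<^sub>R S + (a * b) *\<^sub>R (transpose R ** S + S ** R)" for a b :: real
    proof -
      have "transpose (a *\<^sub>R R + b *\<^sub>R mat 1) = a *\<^sub>R transpose R + b *\<^sub>R mat 1"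
        by (simp add: transpose_def vec_eq_iff mat_def)
      moreover have "transpose R ** S ** R = S"
        using R(1) by (simp add: orthogonal_group_def)
      ultimately show ?thesis
        by (simp add: bounded_bilinear.add_left[OF bounded_bilinear_matrix_mult]
            bounded_bilinear.add_right[OF bounded_bilinear_matrix_mult]
            bounded_bilinear.scaleR_left[OF bounded_bilinear_matrix_mult]
            bounded_bilinear.scaleR_right[OF bounded_bilinear_matrix_mult] algebra_simps)
    qed
    have cO: "c t \<in> orthogonal_group S" if "invertible (U t)" for t
      unfolding c_def
      by (rule quotient_in_orthogonal_group[OF that]) (simp add: U_def V_def expand algebra_simps)
    have "((\<lambda>s. L (pullback p (c s) A)) has_real_derivative 0) (at t)" if t: "t \<in> {0..1}" for t
    proof -
      obtain c' where "(c has_vector_derivative c') (at t)"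
        using differentiable_quotient_path[OF inv[OF t] U' V'] unfolding c_def by blast
      moreover have "\<forall>\<^sub>F s in nhds t. U s \<in> {M. invertible M}"
        using inv[OF t] has_vector_derivative_continuous[OF U'] open_invertible
        by (intro eventually_nhds_of_isCont) auto
      then have "\<forall>\<^sub>F s in nhds t. c s \<in> orthogonal_group S"
        by eventually_elim (simp add: cO)
      ultimately show ?thesis
        by (rule lagrangian_derivative_along_orthogonal_path[OF p L S sym])
    qed
    note D = this
    have "L (pullback p (c 1) A) = L (pullback p (c 0) A)"
    proof (rule DERIV_isconst_end[of 0 1])
      show "continuous_on {0..1} (\<lambda>s. L (pullback p (c s) A))"
        using D DERIV_isCont by (intro continuous_at_imp_continuous_on ballI) blast
      show "((\<lambda>s. L (pullback p (c s) A)) has_real_derivative 0) (at t)" if "0 < t" "t < 1" for t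
        using D that by simp
    qed simp
    moreover have "c 1 = R"
    proof -
      have "matrix_inv (U 1) = mat 1"
        using matrix_inv_mult(1)[OF inv[of 1]] by (simp add: U_def)
      then show ?thesis by (simp add: c_def V_def)
    qed
    moreover have "c 0 = mat 1"
    proof -
      have "V 0 = U 0" by (simp add: U_def V_def)
      then show ?thesis using matrix_inv_mult(1)[OF inv[of 0]] by (simp add: c_def)
    qed
    ultimately show ?thesis
      using pullback_mat_1[OF p A] by simp
  qed
  then show ?thesis using \<delta>(1) that by blast
qed

lemma mat_1_orthogonal_group: "mat 1 \<in> orthogonal_group S"
  by (simp add: orthogonal_group_def transpose_mat)

text \<open>
  By functoriality, the set of matrices that leave \<open>L\<close> invariant and its complement are both stable under
  multiplication with elements of \<open>O(S)\<close> close to the identity, hence open in the connected group.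
\<close>

theorem invariant_if_symmetric:
  fixes S :: "'d::{finite,linorder} matrix"
  assumes p: "1 \<le> p" and L: "smooth_on_forms p L" and S: "transpose S = S" "invertible S"
    and sym: "\<forall>A\<in>forms p. transpose (matrix_inv S ** tensor p L A) = matrix_inv S ** tensor p L A"
    and M: "M \<in> neutral_component S"
  shows "\<forall>A\<in>forms p. L (pullback p M A) = L A"
proof -
  let ?C = "neutral_component S"
  obtain \<delta> where \<delta>: "0 < \<delta>"
    "\<And>R A. R \<in> orthogonal_group S \<Longrightarrow> R \<in> ball (mat 1) \<delta> \<Longrightarrow> A \<in> forms p \<Longrightarrow> L (pullback p R A) = L A"
    using invariant_near_identity[OF p L S sym] by blast
  have sub: "?C \<subseteq> orthogonal_group S"
    by (simp add: neutral_component_def connected_component_subset)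
  show ?thesis
  proof (rule connected_induction_simple[where P = "\<lambda>M. \<forall>A\<in>forms p. L (pullback p M A) = L A" and S = ?C])
    show "connected ?C" by (simp add: neutral_component_def)
    show "mat 1 \<in> ?C"
      unfolding neutral_component_def mem_Collect_eq
      by (rule connected_component_refl[OF mat_1_orthogonal_group])
    show "M \<in> ?C" by fact
    show "\<forall>A\<in>forms p. L (pullback p (mat 1) A) = L A"
      by (simp add: pullback_mat_1[OF p])
    fix a assume a: "a \<in> ?C"
    then have aO: "a \<in> orthogonal_group S" using sub by blast
    note inv = matrix_inv_mult[OF invertible_of_orthogonal_group[OF aO S(2)]]
    have near: "L (pullback p N A) = L (pullback p a A)"
      if N: "N \<in> ?C" "matrix_inv a ** N \<in> ball (mat 1) \<delta>" for N and A :: "'d form"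
    proof -
      have "pullback p N A = pullback p (matrix_inv a ** N) (pullback p a A)"
        by (simp add: pullback_mult[symmetric] matrix_mul_assoc inv)
      moreover have "matrix_inv a ** N \<in> orthogonal_group S"
        using orthogonal_group_inverse_mult[OF aO _ S(2)] N(1) sub by blast
      ultimately show ?thesis
        using \<delta>(2)[OF _ N(2) pullback_in_forms] by simp
    qed
    have "continuous_on ?C (\<lambda>N. matrix_inv a ** N)"
      by (intro linear_continuous_on bounded_bilinear.bounded_linear_right[OF bounded_bilinear_matrix_mult])
    then have "openin (top_of_set ?C) (?C \<inter> (\<lambda>N. matrix_inv a ** N) -` ball (mat 1) \<delta>)"
      by (rule continuous_openin_preimage_gen) simp
    moreover have "a \<in> ?C \<inter> (\<lambda>N. matrix_inv a ** N) -` ball (mat 1) \<delta>"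
      using a \<delta>(1) by (simp add: inv)
    moreover have step: "\<forall>A\<in>forms p. L (pullback p y A) = L A"
      if x: "x \<in> ?C \<inter> (\<lambda>N. matrix_inv a ** N) -` ball (mat 1) \<delta>"
        and y: "y \<in> ?C \<inter> (\<lambda>N. matrix_inv a ** N) -` ball (mat 1) \<delta>"
        and P: "\<forall>A\<in>forms p. L (pullback p x A) = L A" for x y
    proof
      fix A :: "'d form" assume "A \<in> forms p"
      then have "L (pullback p x A) = L A" using P by simp
      moreover have "L (pullback p x A) = L (pullback p a A)" "L (pullback p y A) = L (pullback p a A)"
        using x y by (simp_all only: Int_iff vimage_eq near)
      ultimately show "L (pullback p y A) = L A" by simp
    qed
    ultimately show "\<exists>T. openin (top_of_set ?C) T \<and> a \<in> T \<and> (\<forall>x\<in>T. \<forall>y\<in>T.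
        (\<forall>A\<in>forms p. L (pullback p x A) = L A) \<longrightarrow> (\<forall>A\<in>forms p. L (pullback p y A) = L A))"
      by (intro exI conjI) (assumption, assumption, rule ballI, rule ballI, rule impI, rule step)
  qed
qed

text \<open>
  The Cayley transforms of \<open>t X\<close> for small \<open>t\<close> form a connected subset of \<open>O(S)\<close> through the identity, so
  they lie in the neutral component. Their velocity at \<open>0\<close> is \<open>2 X\<close>.
\<close>

theorem symmetric_if_invariant:
  fixes S :: "'d::{finite,linorder} matrix"
  assumes p: "1 \<le> p" and L: "smooth_on_forms p L" and S: "transpose S = S" "invertible S"
    and invariant: "\<forall>M\<in>neutral_component S. \<forall>A\<in>forms p. L (pullback p M A) = L A"
    and A: "A \<in> forms p"
  shows "transpose (matrix_inv S ** tensor p L A) = matrix_inv S ** tensor p L A"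
  unfolding symmetric_iff_annihilates_orthogonal_algebra[OF S]
proof
  fix X assume X: "X \<in> orthogonal_algebra S"
  define U where "U t = mat 1 - t *\<^sub>R X" for t :: real
  define V where "V t = mat 1 + t *\<^sub>R X" for t :: real
  define c where "c t = V t ** matrix_inv (U t)" for t
  have U': "(U has_vector_derivative - X) (at t)" for t
    unfolding U_def by (auto intro!: derivative_eq_intros)
  have V': "(V has_vector_derivative X) (at t)" for t
    unfolding V_def by (auto intro!: derivative_eq_intros)
  have UV0: "U 0 = mat 1" "V 0 = mat 1" by (simp_all add: U_def V_def)
  have inv1: "invertible (mat 1 :: 'd matrix)"
    unfolding invertible_def by (auto intro: exI[of _ "mat 1"])
  have expand: "transpose (mat 1 + t *\<^sub>R X) ** S ** (mat 1 + t *\<^sub>R X) = S + (t * t) *\<^sub>R (transpose X ** S ** X)" for t :: real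
  proof -
    have "transpose (mat 1 + t *\<^sub>R X) = mat 1 + t *\<^sub>R transpose X"
      by (simp add: transpose_def vec_eq_iff mat_def)
    then have "transpose (mat 1 + t *\<^sub>R X) ** S ** (mat 1 + t *\<^sub>R X) =
       S + t *\<^sub>R (transpose X ** S + S ** X) + (t * t) *\<^sub>R (transpose X ** S ** X)"
      by (simp add: bounded_bilinear.add_left[OF bounded_bilinear_matrix_mult]
            bounded_bilinear.add_right[OF bounded_bilinear_matrix_mult]
            bounded_bilinear.scaleR_left[OF bounded_bilinear_matrix_mult]
            bounded_bilinear.scaleR_right[OF bounded_bilinear_matrix_mult] algebra_simps)
    then show ?thesis using X by (simp add: orthogonal_algebra_def)
  qed
  have cO: "c t \<in> orthogonal_group S" if "invertible (U t)" for t
    unfolding c_def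
  proof (rule quotient_in_orthogonal_group[OF that])
    show "transpose (V t) ** S ** V t = transpose (U t) ** S ** U t"
      unfolding V_def U_def expand using expand[of "- t"] by simp
  qed
  have "\<forall>\<^sub>F s in nhds (0 :: real). U s \<in> {M. invertible M}"
    using inv1 UV0 has_vector_derivative_continuous[OF U'] open_invertible
    by (intro eventually_nhds_of_isCont) auto
  then obtain \<tau> where \<tau>: "0 < \<tau>" "\<And>t. t \<in> ball 0 \<tau> \<Longrightarrow> invertible (U t)"
    by (auto simp: eventually_nhds_metric dist_commute)
  obtain c' where c': "(c has_vector_derivative c') (at 0)" "c' ** U 0 + V 0 ** matrix_inv (U 0) ** - X = X"
  proof (rule differentiable_quotient_path[OF _ U' V'])
    show "invertible (U 0)" using UV0 inv1 by simp
  qed (auto simp: c_def[abs_def])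
  have m1: "matrix_inv (mat 1 :: 'd matrix) = mat 1"
    using matrix_inv_mult(1)[OF inv1] by simp
  have c0: "c 0 = mat 1"
    by (simp add: c_def UV0 m1)
  have "c' = 2 *\<^sub>R X"
    using c'(2) by (simp add: UV0 m1 scaleR_2 algebra_simps)
  then have c'': "(c has_vector_derivative 2 *\<^sub>R X) (at 0)" using c' by simp
  have "c t \<in> neutral_component S" if "t \<in> ball 0 \<tau>" for t
  proof -
    have "continuous_on (ball 0 \<tau>) c"
    proof (rule continuous_at_imp_continuous_on, rule ballI)
      fix s :: real assume "s \<in> ball 0 \<tau>"
      then have "invertible (U s)" by (rule \<tau>(2))
      then obtain d where "(c has_vector_derivative d) (at s)"
        using differentiable_quotient_path[OF _ U' V'] unfolding c_def by blast
      then show "isCont c s" by (rule has_vector_derivative_continuous)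
    qed
    then have "connected (c ` ball 0 \<tau>)"
      by (rule connected_continuous_image) simp
    moreover have "mat 1 \<in> c ` ball 0 \<tau>" using c0 \<tau>(1) by (metis centre_in_ball imageI)
    moreover have "c ` ball 0 \<tau> \<subseteq> orthogonal_group S" using cO \<tau>(2) by auto
    ultimately show ?thesis
      using connected_component_maximal[of "mat 1" "c ` ball 0 \<tau>" "orthogonal_group S"] that
      unfolding neutral_component_def by blast
  qed
  then have "\<forall>t\<in>ball 0 \<tau>. L (pullback p (c t) A) = L A"
    using invariant A by blast
  then have "((\<lambda>t. L (pullback p (c t) A)) has_real_derivative 0) (at 0)"
    using \<tau>(1) by (intro has_field_derivative_transform_within_open[OF DERIV_const[of "L A"], of "ball 0 \<tau>"]) auto
  then have "L A * trace (2 *\<^sub>R X) - (\<Sum>i\<in>UNIV. \<Sum>j\<in>UNIV. (2 *\<^sub>R X) $ i $ j * tensor p L A $ i $ j) = 0"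
    by (rule DERIV_unique[OF lagrangian_derivative[OF p L A c0 c'']])
  moreover have "(\<Sum>i\<in>UNIV. \<Sum>j\<in>UNIV. (2 *\<^sub>R X) $ i $ j * tensor p L A $ i $ j) =
      2 * (\<Sum>i\<in>UNIV. \<Sum>j\<in>UNIV. X $ i $ j * tensor p L A $ i $ j)"
    by (simp add: sum_distrib_left mult.assoc)
  moreover have "trace (2 *\<^sub>R X) = 0"
  proof -
    have "trace (2 *\<^sub>R X) = 2 * trace X"
      by (simp add: trace_def sum_distrib_left)
    then show ?thesis
      by (simp only: trace_orthogonal_algebra[OF X S(2)] mult_zero_right)
  qed
  ultimately show "(\<Sum>i\<in>UNIV. \<Sum>j\<in>UNIV. X $ i $ j * tensor p L A $ i $ j) = 0"
    by (simp only: mult_zero_right diff_0 neg_equal_0_iff_equal mult_eq_0_iff zero_neq_numeral[symmetric] simp_thms)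
qed

section \<open>Change of variables\<close>

text \<open>
  The change of variables theorem concerns vectors indexed by a type in the class \<open>wellorder\<close>. This
  copy of a finite linearly ordered type is an instance of the class; passing to it renames the
  coordinates, which changes neither Lebesgue measure nor determinants.
\<close>

typedef 'a wellordered = "UNIV :: 'a set" ..

instance wellordered :: (finite) finite
proof
  have "(UNIV :: 'a wellordered set) = Abs_wellordered ` UNIV"
    by (metis Rep_wellordered_inverse surj_def)
  then show "finite (UNIV :: 'a wellordered set)"
    by (metis finite finite_imageI)
qed

instantiation wellordered :: (linorder) linorder
begin
definition "x \<le> y \<longleftrightarrow> Rep_wellordered x \<le> Rep_wellordered y"
definition "x < y \<longleftrightarrow> Rep_wellordered x < Rep_wellordered y"
instance
  by standard (auto simp: less_eq_wellordered_def less_wellordered_def Rep_wellordered_inject[symmetric])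
end

instance wellordered :: ("{finite,linorder}") wellorder
proof
  fix P :: "'a wellordered \<Rightarrow> bool" and a
  assume step: "\<And>x. (\<And>y. y < x \<Longrightarrow> P y) \<Longrightarrow> P x"
  have "wf {(x, y :: 'a wellordered). x < y}"
  proof (rule finite_acyclic_wf)
    have "trans {(x, y :: 'a wellordered). x < y}" by (auto intro: transI)
    then show "acyclic {(x, y :: 'a wellordered). x < y}" by (simp add: acyclic_def trancl_id)
  qed simp
  then show "P a"
    by (induction a rule: wf_induct_rule) (use step in auto)
qed

definition relabel :: "('b \<Rightarrow> 'a) \<Rightarrow> real^'a \<Rightarrow> real^'b" where
  "relabel \<pi> x = (\<chi> i. x $ \<pi> i)"

lemma bounded_linear_relabel: "bounded_linear (relabel (\<pi> :: 'b::finite \<Rightarrow> 'a::finite))"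
  by (intro linear_conv_bounded_linear[THEN iffD1] linearI) (auto simp: relabel_def vec_eq_iff)

lemma prod_Basis_vec:
  "(\<Prod>b\<in>(Basis :: (real^'n) set). f (x \<bullet> b)) = (\<Prod>i\<in>UNIV. f (x $ i))"
proof -
  have "(Basis :: (real^'n) set) = range (\<lambda>i. axis i 1)"
    by (auto simp: Basis_vec_def)
  then show ?thesis
    by (subst \<open>Basis = _\<close>, subst prod.reindex) (auto simp: inj_def axis_eq_axis inner_axis)
qed

lemma lborel_relabel:
  fixes \<pi> :: "'b::finite \<Rightarrow> 'a::finite"
  assumes "bij \<pi>"
  shows "(lborel :: (real^'b) measure) = distr lborel borel (relabel \<pi>)"
proof (rule lborel_eqI)
  fix l u :: "real^'b"
  assume le: "\<And>b. b \<in> Basis \<Longrightarrow> l \<bullet> b \<le> u \<bullet> b"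
  have [measurable]: "relabel \<pi> \<in> borel_measurable borel"
    using bounded_linear_relabel by (intro borel_measurable_continuous_onI linear_continuous_on)
  let ?r = "relabel (inv \<pi>) :: real^'b \<Rightarrow> real^'a"
  have [simp]: "inv \<pi> (\<pi> i) = i" "\<pi> (inv \<pi> j) = j" for i j
    using assms by (auto simp: bij_is_inj bij_is_surj surj_f_inv_f)
  have "relabel \<pi> -` box l u = box (?r l) (?r u)"
  proof -
    have all: "(\<forall>j. Q j) \<longleftrightarrow> (\<forall>i. Q (\<pi> i))" for Q
      using assms by (metis bij_pointE)
    show ?thesis
      by (rule set_eqI) (simp add: mem_box_cart relabel_def all)
  qed
  moreover have "\<And>b. b \<in> Basis \<Longrightarrow> ?r l \<bullet> b \<le> ?r u \<bullet> b"
  proof -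
    have "l $ i \<le> u $ i" for i
      using le[of "axis i 1"] by (simp add: inner_axis)
    then show "?r l \<bullet> b \<le> ?r u \<bullet> b" if "b \<in> Basis" for b
      using that by (auto simp: Basis_vec_def inner_axis relabel_def)
  qed
  ultimately have "emeasure (distr lborel borel (relabel \<pi>)) (box l u) = (\<Prod>b\<in>Basis. (?r u - ?r l) \<bullet> b)"
    by (simp add: emeasure_distr emeasure_lborel_box)
  also have "\<dots> = (\<Prod>j\<in>UNIV. (?r u - ?r l) $ j)"
    using prod_Basis_vec[of "\<lambda>x. x"] by metis
  also have "\<dots> = (\<Prod>i\<in>UNIV. (u - l) $ i)"
    by (intro arg_cong[where f = ennreal] prod.reindex_bij_witness[of _ \<pi> "inv \<pi>"]) (auto simp: relabel_def)
  also have "\<dots> = (\<Prod>b\<in>Basis. (u - l) \<bullet> b)"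
    using prod_Basis_vec[of "\<lambda>x. x"] by metis
  finally show "emeasure (distr lborel borel (relabel \<pi>)) (box l u) = (\<Prod>b\<in>Basis. (u - l) \<bullet> b)" .
qed simp

lemma lebesgue_relabel:
  fixes \<pi> :: "'b::finite \<Rightarrow> 'a::finite"
  assumes "bij \<pi>"
  shows "relabel \<pi> \<in> lebesgue \<rightarrow>\<^sub>M lebesgue"
    and "(lebesgue :: (real^'b) measure) = distr lebesgue lebesgue (relabel \<pi>)"
proof -
  have m[measurable]: "relabel \<pi> \<in> borel_measurable borel"
    using bounded_linear_relabel by (intro borel_measurable_continuous_onI linear_continuous_on)
  have d: "distr lebesgue lborel (relabel \<pi>) = (lborel :: (real^'b) measure)"
  proof -
    have "distr lebesgue lborel (relabel \<pi>) = distr lborel lborel (relabel \<pi>)"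
      by (rule distr_completion) simp
    also have "\<dots> = distr lborel borel (relabel \<pi>)"
      by (rule distr_cong) auto
    finally show ?thesis using lborel_relabel[OF assms] by simp
  qed
  then show "relabel \<pi> \<in> lebesgue \<rightarrow>\<^sub>M lebesgue"
    by (intro completion.measurable_completion2) (auto simp: measurable_completion)
  have "lebesgue = completion (distr lebesgue lborel (relabel \<pi>))"
    by (simp add: d)
  also have "\<dots> = distr lebesgue lebesgue (relabel \<pi>)"
    by (rule completion.completion_distr_eq) (auto simp: d measurable_completion)
  finally show "(lebesgue :: (real^'b) measure) = distr lebesgue lebesgue (relabel \<pi>)" .
qed

lemma integrable_relabel:
  fixes \<pi> :: "'b::finite \<Rightarrow> 'a::finite" and f :: "real^'b \<Rightarrow> real"
  assumes "bij \<pi>" "integrable lebesgue f"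
  shows "integrable lebesgue (\<lambda>x. f (relabel \<pi> x))"
    and "(LINT x|lebesgue. f (relabel \<pi> x)) = (LINT y|lebesgue. f y)"
proof -
  have i: "integrable (distr lebesgue lebesgue (relabel \<pi>)) f"
    using assms lebesgue_relabel(2)[OF assms(1)] by simp
  show "integrable lebesgue (\<lambda>x. f (relabel \<pi> x))"
    by (rule integrable_distr[OF lebesgue_relabel(1)[OF assms(1)] i])
  have "(LINT y|lebesgue. f y) = (LINT y|distr lebesgue lebesgue (relabel \<pi>). f y)"
    using lebesgue_relabel(2)[OF assms(1)] by simp
  also have "\<dots> = (LINT x|lebesgue. f (relabel \<pi> x))"
    by (rule integral_distr[OF lebesgue_relabel(1)[OF assms(1)]])
       (use assms(2) in \<open>rule borel_measurable_integrable\<close>)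
  finally show "(LINT x|lebesgue. f (relabel \<pi> x)) = (LINT y|lebesgue. f y)" by simp
qed

text \<open>
  Conjugation with \<open>\<pi>\<close> maps the permutations of one index type onto those of the other and keeps the
  sign.
\<close>

lemma det_relabel:
  fixes A :: "real^'a^'a" and \<pi> :: "'b::finite \<Rightarrow> 'a::finite"
  assumes "bij \<pi>"
  shows "det (\<chi> i j. A $ \<pi> i $ \<pi> j) = det A"
proof -
  have b: "bij_betw \<pi> UNIV UNIV" and i: "inj \<pi>" using assms by (auto simp: bij_is_inj)
  have [simp]: "inv \<pi> (\<pi> i) = i" "\<pi> (inv \<pi> j) = j" for i j
    using assms by (auto simp: bij_is_inj bij_is_surj surj_f_inv_f)
  let ?m = "map_permutation UNIV \<pi>" and ?n = "map_permutation UNIV (inv \<pi>)"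
  have b': "bij_betw (inv \<pi>) UNIV UNIV" using assms by (simp add: bij_imp_bij_inv)
  have "det (\<chi> i j. A $ \<pi> i $ \<pi> j) = (\<Sum>\<sigma> | \<sigma> permutes UNIV. of_int (sign \<sigma>) * (\<Prod>i\<in>UNIV. A $ \<pi> i $ \<pi> (\<sigma> i)))"
    by (simp add: det_def)
  also have "\<dots> = (\<Sum>\<tau> | \<tau> permutes UNIV. of_int (sign \<tau>) * (\<Prod>i\<in>UNIV. A $ i $ \<tau> i))"
  proof (rule sum.reindex_bij_witness[of _ ?n ?m])
    fix \<sigma> :: "'b \<Rightarrow> 'b" assume "\<sigma> \<in> {\<sigma>. \<sigma> permutes UNIV}"
    then have \<sigma>: "\<sigma> permutes UNIV" by simp
    show "?n (?m \<sigma>) = \<sigma>" by (rule map_permutation_compose_inv[OF b \<sigma>]) simp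
    show "?m \<sigma> \<in> {\<tau>. \<tau> permutes UNIV}" using map_permutation_permutes[OF b \<sigma>] by simp
    have "?m \<sigma> (\<pi> i) = \<pi> (\<sigma> i)" for i
      by (rule map_permutation_apply[OF i]) simp
    then have "(\<Prod>i\<in>UNIV. A $ i $ ?m \<sigma> i) = (\<Prod>i\<in>UNIV. A $ \<pi> i $ \<pi> (\<sigma> i))"
      using prod.reindex_bij_betw[OF b, of "\<lambda>i. A $ i $ ?m \<sigma> i"] by simp
    then show "of_int (sign (?m \<sigma>)) * (\<Prod>i\<in>UNIV. A $ i $ ?m \<sigma> i) =
        of_int (sign \<sigma>) * (\<Prod>i\<in>UNIV. A $ \<pi> i $ \<pi> (\<sigma> i))"
      using sign_map_permutation[OF i \<sigma>] by simp
  next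
    fix \<tau> :: "'a \<Rightarrow> 'a" assume "\<tau> \<in> {\<tau>. \<tau> permutes UNIV}"
    then have \<tau>: "\<tau> permutes UNIV" by simp
    show "?m (?n \<tau>) = \<tau>" by (rule map_permutation_compose_inv[OF b' \<tau>]) simp
    show "?n \<tau> \<in> {\<tau>. \<tau> permutes UNIV}" using map_permutation_permutes[OF b' \<tau>] by simp
  qed
  finally show ?thesis by (simp add: det_def)
qed

lemma change_of_variables_wellorder:
  fixes f :: "real^'m::{finite,wellorder} \<Rightarrow> real" and g :: "real^'m::_ \<Rightarrow> real^'m::_"
  assumes S: "S \<in> sets lebesgue"
    and g: "\<And>x. x \<in> S \<Longrightarrow> (g has_derivative g' x) (at x within S)"
    and inj: "inj_on g S" and f: "set_integrable lebesgue (g ` S) f"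
  shows "set_integrable lebesgue S (\<lambda>x. \<bar>det (matrix (g' x))\<bar> * f (g x))"
    and "(LINT x:S|lebesgue. \<bar>det (matrix (g' x))\<bar> * f (g x)) = (LINT y:g ` S|lebesgue. f y)"
proof -
  have v: "(\<lambda>y. vec (f y) :: real^1) absolutely_integrable_on g ` S"
    using f by (simp add: absolutely_integrable_on_1_iff)
  have *: "(\<lambda>x. \<bar>det (matrix (g' x))\<bar> *\<^sub>R (vec (f (g x)) :: real^1)) absolutely_integrable_on S \<and>
     integral S (\<lambda>x. \<bar>det (matrix (g' x))\<bar> *\<^sub>R (vec (f (g x)) :: real^1)) = integral (g ` S) (\<lambda>y. vec (f y))"
    using has_absolute_integral_change_of_variables[OF S g inj, of "\<lambda>y. vec (f y) :: real^1" "integral (g ` S) (\<lambda>y. vec (f y))"] v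
    by simp
  have eq: "\<bar>det (matrix (g' x))\<bar> *\<^sub>R (vec (f (g x)) :: real^1) = vec (\<bar>det (matrix (g' x))\<bar> * f (g x))" for x
    by (simp add: vec_eq_iff)
  show i: "set_integrable lebesgue S (\<lambda>x. \<bar>det (matrix (g' x))\<bar> * f (g x))"
    using * unfolding eq by (simp add: absolutely_integrable_on_1_iff)
  have "integral S (\<lambda>x. \<bar>det (matrix (g' x))\<bar> * f (g x)) = integral (g ` S) f"
    using * unfolding eq by (simp add: integral_on_1_eq o_def)
  then show "(LINT x:S|lebesgue. \<bar>det (matrix (g' x))\<bar> * f (g x)) = (LINT y:g ` S|lebesgue. f y)"
    using set_lebesgue_integral_eq_integral(2)[OF i] set_lebesgue_integral_eq_integral(2)[OF f] by simp
qed

theorem change_of_variables: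
  fixes f :: "real^'d::{finite,linorder} \<Rightarrow> real" and g :: "real^'d::_ \<Rightarrow> real^'d::_"
  assumes S: "S \<in> sets lebesgue"
    and g: "\<And>x. x \<in> S \<Longrightarrow> (g has_derivative g' x) (at x within S)"
    and inj: "inj_on g S" and f: "set_integrable lebesgue (g ` S) f"
  shows "(LINT x:S|lebesgue. \<bar>det (matrix (g' x))\<bar> * f (g x)) = (LINT y:g ` S|lebesgue. f y)"
proof -
  let ?h = "relabel Rep_wellordered :: real^'d::_ \<Rightarrow> real^'d wellordered" and ?k = "relabel Abs_wellordered :: real^'d wellordered \<Rightarrow> real^'d::_"
  have bij: "bij (Rep_wellordered :: 'd wellordered \<Rightarrow> 'd)" "bij (Abs_wellordered :: 'd \<Rightarrow> 'd wellordered)"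
    by (rule bijI', auto simp: Rep_wellordered_inject, metis Abs_wellordered_inverse UNIV_I,
        rule bijI', auto simp: Abs_wellordered_inject, metis Rep_wellordered_inverse)
  have kh[simp]: "?k (?h x) = x" for x by (simp add: relabel_def vec_eq_iff Abs_wellordered_inverse)
  have hk[simp]: "?h (?k x) = x" for x by (simp add: relabel_def vec_eq_iff Rep_wellordered_inverse)
  note lin = bounded_linear_relabel
  define G where "G x = ?h (g (?k x))" for x
  define G' where "G' x v = ?h (g' (?k x) (?k v))" for x v
  have img: "?h ` S = ?k -` S"
    by (auto simp: image_iff) (metis hk)
  have im2: "G ` (?h ` S) = ?h ` (g ` S)" by (auto simp: G_def image_image)
  have img3: "?h ` (g ` S) = ?k -` (g ` S)"
    by (auto simp: image_iff) (metis hk)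
  have S': "?h ` S \<in> sets lebesgue"
    unfolding img using measurable_sets[OF lebesgue_relabel(1)[OF bij(2)] S] by simp
  have der: "(G has_derivative G' x) (at x within ?h ` S)" if "x \<in> ?h ` S" for x
  proof -
    have x: "?k x \<in> S" using that img by auto
    have "(?k has_derivative ?k) (at x within ?h ` S)"
      using lin by (rule bounded_linear_imp_has_derivative)
    moreover have "(g has_derivative g' (?k x)) (at (?k x) within ?k ` (?h ` S))"
      using g[OF x] by (simp add: image_image)
    ultimately have "((\<lambda>x. g (?k x)) has_derivative (\<lambda>v. g' (?k x) (?k v))) (at x within ?h ` S)"
      by (rule has_derivative_in_compose)
    then show ?thesis
      unfolding G_def G'_def by (rule bounded_linear.has_derivative[OF lin])
  qed
  have inj': "inj_on G (?h ` S)"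
    using inj by (auto simp: inj_on_def G_def) (metis kh)
  have det: "det (matrix (G' x)) = det (matrix (g' (?k x)))" for x
  proof -
    have "?k (axis j 1) = axis (Rep_wellordered j) 1" for j
      by (auto simp: relabel_def axis_def vec_eq_iff Abs_wellordered_inverse Rep_wellordered_inverse)
    then have "matrix (G' x) = (\<chi> i j. matrix (g' (?k x)) $ Rep_wellordered i $ Rep_wellordered j)"
      by (simp add: matrix_def G'_def relabel_def vec_eq_iff)
    then show ?thesis
      using det_relabel[OF bij(1), of "matrix (g' (?k x))"] by simp
  qed
  have f': "set_integrable lebesgue (G ` (?h ` S)) (\<lambda>y. f (?k y))"
    using integrable_relabel(1)[OF bij(2) f[unfolded set_integrable_def]]
    unfolding im2 img3 by (simp add: set_integrable_def indicator_def)
  note cv = change_of_variables_wellorder[OF S' der inj' f']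
  have "(LINT y:g ` S|lebesgue. f y) = (LINT y:G ` (?h ` S)|lebesgue. f (?k y))"
    using integrable_relabel(2)[OF bij(2) f[unfolded set_integrable_def]]
    unfolding im2 img3 by (simp add: set_lebesgue_integral_def indicator_def)
  also have "\<dots> = (LINT x:?h ` S|lebesgue. \<bar>det (matrix (G' x))\<bar> * f (?k (G x)))"
    using cv(2) by simp
  also have "\<dots> = (LINT x:S|lebesgue. \<bar>det (matrix (g' x))\<bar> * f (g x))"
    using integrable_relabel(2)[OF bij(1) cv(1)[unfolded set_integrable_def]]
    unfolding img by (simp add: set_lebesgue_integral_def indicator_def det G_def)
  finally show ?thesis by simp
qed

section \<open>Global solutions of Lipschitz differential equations\<close>

text \<open>
  Since \<open>(\<parallel>e\<parallel>\<^sup>2)' \<le> 2 K \<parallel>e\<parallel>\<^sup>2 + 2 B \<parallel>e\<parallel> \<le> (2 K + 1) \<parallel>e\<parallel>\<^sup>2 + B\<^sup>2\<close>, the function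
  \<open>(\<parallel>e\<parallel>\<^sup>2 + B\<^sup>2) exp (- (2 K + 1) t)\<close> is nonincreasing. The square avoids the point where the norm is not
  differentiable.
\<close>

lemma gronwall_forward:
  fixes e :: "real \<Rightarrow> 'a::real_inner"
  assumes "0 \<le> T" "0 \<le> K"
    and e: "\<And>t. t \<in> {0..T} \<Longrightarrow> (e has_vector_derivative e' t) (at t)"
    and bound: "\<And>t. t \<in> {0..T} \<Longrightarrow> norm (e' t) \<le> K * norm (e t) + B"
  shows "(norm (e T))\<^sup>2 \<le> ((norm (e 0))\<^sup>2 + B\<^sup>2) * exp ((2 * K + 1) * T)"
proof -
  define h where "h t = (e t \<bullet> e t + B\<^sup>2) * exp (- ((2 * K + 1) * t))" for t
  have "h T \<le> h 0"
  proof (rule DERIV_nonpos_imp_nonincreasing[OF assms(1)])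
    fix t assume t: "0 \<le> t" "t \<le> T"
    have "((\<lambda>t. e t \<bullet> e t) has_derivative (\<lambda>h. h * (2 * (e t \<bullet> e' t)))) (at t)"
      using has_derivative_inner[OF e[of t, unfolded has_vector_derivative_def] e[of t, unfolded has_vector_derivative_def]] t
      by (simp add: inner_commute algebra_simps)
    moreover have "(\<lambda>h. h * (2 * (e t \<bullet> e' t))) = (*) (2 * (e t \<bullet> e' t))"
      by (rule ext) (rule mult.commute)
    ultimately have e2: "((\<lambda>t. e t \<bullet> e t) has_real_derivative (2 * (e t \<bullet> e' t))) (at t)"
      by (simp only: has_field_derivative_def)
    have der: "(h has_real_derivative
        (2 * (e t \<bullet> e' t) - (2 * K + 1) * (e t \<bullet> e t + B\<^sup>2)) * exp (- ((2 * K + 1) * t))) (at t)"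
      unfolding h_def
      by (rule derivative_eq_intros e2 refl | simp add: algebra_simps)+
    have "e t \<bullet> e' t \<le> norm (e t) * (K * norm (e t) + B)"
      using Cauchy_Schwarz_ineq2[of "e t" "e' t"] bound[of t] t
      by (smt (verit) atLeastAtMost_iff mult_left_mono norm_ge_zero)
    moreover have "2 * (norm (e t) * B) \<le> (norm (e t))\<^sup>2 + B\<^sup>2"
      using sum_squares_bound[of "norm (e t)" B] by simp
    moreover have "0 \<le> 2 * K * B\<^sup>2" using assms(2) by simp
    ultimately have "2 * (e t \<bullet> e' t) - (2 * K + 1) * (e t \<bullet> e t + B\<^sup>2) \<le> 0"
      by (simp add: power2_norm_eq_inner[symmetric] power2_eq_square algebra_simps)
    then show "\<exists>y. (h has_real_derivative y) (at t) \<and> y \<le> 0"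
      using der by (intro exI conjI) (auto intro!: mult_nonpos_nonneg)
  qed
  then have le: "(e T \<bullet> e T + B\<^sup>2) * exp (- ((2 * K + 1) * T)) \<le> e 0 \<bullet> e 0 + B\<^sup>2"
    by (simp add: h_def)
  have "a \<le> b * exp c" if "a * exp (- c) \<le> b" for a b c :: real
    using that by (simp add: exp_minus divide_inverse[symmetric] pos_divide_le_eq)
  from this[OF le] have "e T \<bullet> e T + B\<^sup>2 \<le> (e 0 \<bullet> e 0 + B\<^sup>2) * exp ((2 * K + 1) * T)" .
  then show ?thesis
    by (simp add: power2_norm_eq_inner) (smt (verit) zero_le_power2)
qed

lemma has_vector_derivative_reflect:
  assumes "(e has_vector_derivative e') (at (- t))"
  shows "((\<lambda>s. e (- s)) has_vector_derivative - e') (at t)"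
proof -
  have "(uminus has_vector_derivative (- 1 :: real)) (at t)"
    using has_vector_derivative_minus[OF has_vector_derivative_id] by simp
  then show ?thesis
    using vector_diff_chain_at[of uminus "- 1" t e e'] assms by (simp add: o_def)
qed

lemma gronwall:
  fixes e :: "real \<Rightarrow> 'a::real_inner"
  assumes "0 \<le> K"
    and e: "\<And>t. \<bar>t\<bar> \<le> T \<Longrightarrow> (e has_vector_derivative e' t) (at t)"
    and bound: "\<And>t. \<bar>t\<bar> \<le> T \<Longrightarrow> norm (e' t) \<le> K * norm (e t) + B"
    and t: "\<bar>t\<bar> \<le> T"
  shows "(norm (e t))\<^sup>2 \<le> ((norm (e 0))\<^sup>2 + B\<^sup>2) * exp ((2 * K + 1) * \<bar>t\<bar>)"
proof (cases "0 \<le> t")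
  case True
  then show ?thesis
    using gronwall_forward[of t K e e' B] assms by force
next
  case False
  have "(norm (e (- (- t))))\<^sup>2 \<le> ((norm (e (- 0)))\<^sup>2 + B\<^sup>2) * exp ((2 * K + 1) * (- t))"
  proof (rule gronwall_forward)
    fix s assume "s \<in> {0..- t}"
    then have s: "\<bar>- s\<bar> \<le> T" using t False by auto
    show "((\<lambda>s. e (- s)) has_vector_derivative - e' (- s)) (at s)"
      by (rule has_vector_derivative_reflect[OF e[OF s]])
    show "norm (- e' (- s)) \<le> K * norm (e (- s)) + B" using bound[OF s] by simp
  qed (use False assms in auto)
  then show ?thesis using False by simp
qed

lemma ode_unique:
  fixes x y :: "real \<Rightarrow> 'a::real_inner"
  assumes lip: "\<And>t a b. norm (f t a - f t b) \<le> K * norm (a - b)" and "0 \<le> K"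
    and x: "\<And>t. (x has_vector_derivative f t (x t)) (at t)"
    and y: "\<And>t. (y has_vector_derivative f t (y t)) (at t)"
    and "x 0 = y 0"
  shows "x t = y t"
proof -
  have "(norm (x t - y t))\<^sup>2 \<le> ((norm (x 0 - y 0))\<^sup>2 + 0\<^sup>2) * exp ((2 * K + 1) * \<bar>t\<bar>)"
    by (rule gronwall[where T = "\<bar>t\<bar>" and e' = "\<lambda>t. f t (x t) - f t (y t)"])
       (use lip assms(2) in \<open>auto intro!: has_vector_derivative_diff x y\<close>)
  then show ?thesis using assms(5) by simp
qed

lemma antiderivative_exists:
  fixes g :: "real \<Rightarrow> 'a::euclidean_space"
  assumes "continuous_on UNIV g"
  obtains G where "G 0 = 0" "\<And>t. (G has_vector_derivative g t) (at t)"
proof -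
  obtain F where F: "\<And>t. (F has_vector_derivative g t) (at t)"
    using einterval_antiderivative[of "-\<infinity>" "\<infinity>" g] assms
    by (auto simp: continuous_on_eq_continuous_at)
  have "((\<lambda>t. F t - F 0) has_vector_derivative g t) (at t)" for t
    using has_vector_derivative_diff[OF F[of t] has_vector_derivative_const[of "F 0"]] by simp
  then show ?thesis
    using that[of "\<lambda>t. F t - F 0"] by simp
qed

lemma antiderivative_exp_bound_forward:
  fixes G :: "real \<Rightarrow> 'a::real_normed_vector"
  assumes "0 < c" "0 \<le> C" "G 0 = 0"
    and G: "\<And>t. (G has_vector_derivative g t) (at t)"
    and g: "\<And>t. norm (g t) \<le> C * exp (c * \<bar>t\<bar>)"
    and t: "0 \<le> t"
  shows "norm (G t) \<le> C / c * exp (c * t)"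
proof (cases "t = 0")
  case False
  then have "0 < t" using t by simp
  have "norm (G t - G 0) \<le> C / c * exp (c * t) - C / c * exp (c * 0)"
  proof (rule differentiable_bound_general[OF \<open>0 < t\<close>])
    show "continuous_on {0..t} G"
      using G by (intro continuous_at_imp_continuous_on) (blast intro: has_vector_derivative_continuous)
    show "continuous_on {0..t} (\<lambda>t. C / c * exp (c * t))"
      by (intro continuous_intros)
    fix s assume "0 < s" "s < t"
    show "(G has_vector_derivative g s) (at s)" by (rule G)
    show "((\<lambda>t. C / c * exp (c * t)) has_vector_derivative C * exp (c * s)) (at s)"
      using \<open>0 < c\<close>
      by (auto intro!: derivative_eq_intros simp: has_real_derivative_iff_has_vector_derivative[symmetric])
    show "norm (g s) \<le> C * exp (c * s)" using g[of s] \<open>0 < s\<close> by simp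
  qed
  also have "\<dots> \<le> C / c * exp (c * t)" using assms by simp
  finally show ?thesis using assms(3) by simp
qed (use assms in simp)

text \<open>
  The estimate that makes the Picard operator a contraction: integration gains the factor \<open>1 / c\<close> in a
  norm with weight \<open>exp (- c \<bar>t\<bar>)\<close>.
\<close>

lemma antiderivative_exp_bound:
  fixes G :: "real \<Rightarrow> 'a::real_normed_vector"
  assumes "0 < c" "0 \<le> C" "G 0 = 0"
    and G: "\<And>t. (G has_vector_derivative g t) (at t)"
    and g: "\<And>t. norm (g t) \<le> C * exp (c * \<bar>t\<bar>)"
  shows "norm (G t) \<le> C / c * exp (c * \<bar>t\<bar>)"
proof (cases "0 \<le> t")
  case True
  then show ?thesis using antiderivative_exp_bound_forward[of c C G g t] assms by simp
next
  case False
  have "norm (G (- (- t))) \<le> C / c * exp (c * (- t))"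
  proof (rule antiderivative_exp_bound_forward[of c C "\<lambda>t. G (- t)" "\<lambda>t. - g (- t)"])
    show "((\<lambda>t. G (- t)) has_vector_derivative - g (- s)) (at s)" for s
      by (rule has_vector_derivative_reflect[OF G])
    show "norm (- g (- s)) \<le> C * exp (c * \<bar>s\<bar>)" for s using g[of "- s"] by simp
  qed (use False assms in auto)
  then show ?thesis using False by simp
qed

text \<open>
  Picard iteration on the whole line at once. With solutions written as \<open>x0 + w u\<close> for the weight
  \<open>w(t) = exp (2 K \<bar>t\<bar>)\<close> and a bounded continuous \<open>u\<close>, the integral operator is a contraction with
  factor \<open>1/2\<close>, so that no continuation of local solutions is needed.
\<close>

theorem ode_exists:
  fixes f :: "real \<Rightarrow> 'a::euclidean_space \<Rightarrow> 'a"
  assumes cont: "continuous_on UNIV (\<lambda>(t, a). f t a)"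
    and K: "0 < K" and lip: "\<And>t a b. norm (f t a - f t b) \<le> K * norm (a - b)"
    and B: "\<And>t. norm (f t x0) \<le> B"
  obtains x where "x 0 = x0" "\<And>t. (x has_vector_derivative f t (x t)) (at t)"
proof -
  define w where "w t = exp (2 * K * \<bar>t\<bar>)" for t :: real
  have w1: "1 \<le> w t" for t using K by (simp add: w_def)
  then have w0: "0 < w t" for t by (smt (verit))
  have wc: "continuous_on UNIV w"
    unfolding w_def by (intro continuous_intros)
  have B0: "0 \<le> B" using B[of 0] norm_ge_zero order_trans by blast
  define g where "g u t = f t (x0 + w t *\<^sub>R apply_bcontfun u t)" for u :: "real \<Rightarrow>\<^sub>C 'a" and t
  have gc: "continuous_on UNIV (g u)" for u
  proof -
    have "continuous_on UNIV (\<lambda>t. (t, x0 + w t *\<^sub>R apply_bcontfun u t))"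
      by (intro continuous_intros wc) auto
    from continuous_on_compose2[OF cont this] show ?thesis
      by (simp add: g_def[abs_def])
  qed
  have "\<exists>G. G 0 = 0 \<and> (\<forall>t. (G has_vector_derivative g u t) (at t))" for u
    using antiderivative_exists[OF gc] by metis
  then obtain G where G0: "\<And>u. G u 0 = 0" and G: "\<And>u t. (G u has_vector_derivative g u t) (at t)"
    by metis
  have u_le: "norm (apply_bcontfun u t) \<le> norm u" for u :: "real \<Rightarrow>\<^sub>C 'a" and t
    by (rule norm_bounded)
  have gb: "norm (g u t) \<le> (B + K * norm u) * exp (2 * K * \<bar>t\<bar>)" for u t
  proof -
    have "norm (g u t) \<le> norm (g u t - f t x0) + norm (f t x0)"
      by (metis add.commute norm_triangle_sub)
    also have "\<dots> \<le> K * (w t * norm u) + B * w t"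
    proof (rule add_mono)
      have "norm (g u t - f t x0) \<le> K * norm (w t *\<^sub>R apply_bcontfun u t)"
        using lip[of t "x0 + w t *\<^sub>R apply_bcontfun u t" x0] by (simp add: g_def)
      also have "\<dots> \<le> K * (w t * norm u)"
        using K w0[of t] u_le[of u t] by (simp add: mult_left_mono)
      finally show "norm (g u t - f t x0) \<le> K * (w t * norm u)" .
      have "B * 1 \<le> B * w t" using B0 w1[of t] by (intro mult_left_mono) auto
      then show "norm (f t x0) \<le> B * w t" using B[of t] by simp
    qed
    finally show ?thesis by (simp add: w_def algebra_simps)
  qed
  have Gb: "norm (G u t) \<le> (B + K * norm u) / (2 * K) * w t" for u t
    unfolding w_def by (rule antiderivative_exp_bound[OF _ _ G0 G gb]) (use K B0 in auto)
  have mem: "(\<lambda>t. (1 / w t) *\<^sub>R G u t) \<in> bcontfun" for u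
  proof (rule bcontfun_normI)
    have "continuous_on UNIV (G u)"
      using G by (intro continuous_at_imp_continuous_on) (blast intro: has_vector_derivative_continuous)
    then show "continuous_on UNIV (\<lambda>t. (1 / w t) *\<^sub>R G u t)"
      using w0 by (intro continuous_intros wc) (auto simp: less_imp_neq[symmetric])
    show "norm ((1 / w t) *\<^sub>R G u t) \<le> (B + K * norm u) / (2 * K)" for t
      using Gb[of u t] w0[of t] by (simp add: divide_le_eq)
  qed
  define \<Gamma> where "\<Gamma> u = Bcontfun (\<lambda>t. (1 / w t) *\<^sub>R G u t)" for u
  have \<Gamma>: "apply_bcontfun (\<Gamma> u) t = (1 / w t) *\<^sub>R G u t" for u t
    unfolding \<Gamma>_def using Bcontfun_inverse[OF mem[of u]] by simp
  have contr: "dist (\<Gamma> u) (\<Gamma> v) \<le> (1/2) * dist u v" for u v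
  proof (rule dist_bound)
    fix t
    have "norm (G u t - G v t) \<le> K * dist u v / (2 * K) * exp (2 * K * \<bar>t\<bar>)"
    proof (rule antiderivative_exp_bound[of "2 * K" "K * dist u v" "\<lambda>t. G u t - G v t" "\<lambda>t. g u t - g v t"])
      show "((\<lambda>t. G u t - G v t) has_vector_derivative g u s - g v s) (at s)" for s
        by (intro has_vector_derivative_diff G)
      fix s
      have "norm (g u s - g v s) \<le> K * norm (w s *\<^sub>R (apply_bcontfun u s - apply_bcontfun v s))"
        using lip[of s "x0 + w s *\<^sub>R apply_bcontfun u s" "x0 + w s *\<^sub>R apply_bcontfun v s"]
        by (simp add: g_def scaleR_diff_right)
      also have "\<dots> = K * (w s * dist (apply_bcontfun u s) (apply_bcontfun v s))"
        using w0[of s] by (simp add: dist_norm)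
      also have "\<dots> \<le> K * (w s * dist u v)"
        using K w0[of s] dist_bounded[of u s v] by (intro mult_left_mono) auto
      finally show "norm (g u s - g v s) \<le> K * dist u v * exp (2 * K * \<bar>s\<bar>)"
        by (simp add: w_def algebra_simps)
    qed (use K G0 in auto)
    then have "norm (G u t - G v t) \<le> (1/2) * dist u v * w t"
      using K by (simp add: w_def)
    then show "dist (apply_bcontfun (\<Gamma> u) t) (apply_bcontfun (\<Gamma> v) t) \<le> (1/2) * dist u v"
      using w0[of t] by (simp add: \<Gamma> dist_norm scaleR_diff_right[symmetric] divide_le_eq)
  qed
  obtain u where u: "\<Gamma> u = u"
    using banach_fix_type[of "1/2" \<Gamma>] contr by auto
  define x where "x t = x0 + G u t" for t
  have "G u t = w t *\<^sub>R apply_bcontfun u t" for t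
    using \<Gamma>[of u t] w0[of t] by (simp add: u)
  then have "g u t = f t (x t)" for t by (simp add: g_def x_def)
  moreover have "(x has_vector_derivative g u t) (at t)" for t
    unfolding x_def using has_vector_derivative_add[OF has_vector_derivative_const G] by simp
  ultimately show ?thesis
    using that[of x] by (simp add: x_def G0)
qed

lemma has_derivative_of_quadratic_bound:
  fixes f :: "'a::real_normed_vector \<Rightarrow> 'b::real_normed_vector"
  assumes "bounded_linear f'" and bound: "\<And>h. norm (f (x + h) - f x - f' h) \<le> C * (norm h)\<^sup>2"
  shows "(f has_derivative f') (at x)"
  unfolding has_derivative_at
proof
  have "(\<lambda>h :: 'a. C * norm h) \<midarrow>0\<rightarrow> C * norm (0 :: 'a)"
    by (rule tendsto_mult[OF tendsto_const tendsto_norm[OF tendsto_ident_at]])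
  then have lim: "(\<lambda>h :: 'a. C * norm h) \<midarrow>0\<rightarrow> 0" by simp
  show "(\<lambda>h. norm (f (x + h) - f x - f' h) / norm h) \<midarrow>0\<rightarrow> 0"
  proof (rule tendsto_sandwich[OF _ _ tendsto_const lim])
    show "\<forall>\<^sub>F h in at 0. norm (f (x + h) - f x - f' h) / norm h \<le> C * norm h"
      using bound by (auto simp: eventually_at_filter divide_le_eq power2_eq_square mult.assoc)
  qed auto
qed fact

lemma bounded_linear_matrix_vector_mult_left: "bounded_linear (\<lambda>A :: real^'n^'m. A *v v)"
  by (intro linear_conv_bounded_linear[THEN iffD1] linearI)
     (simp_all add: matrix_vector_mult_def vec_eq_iff sum.distrib sum_distrib_left algebra_simps)

section \<open>The flow of a vector field\<close>

text \<open>
  A vector field with derivative \<open>D\<xi>\<close>, given by the estimates that its flow depends on. The quadratic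
  Taylor bound is what a Lipschitz continuous derivative provides. The constant \<open>K\<close> serves as a common
  bound for the field, its derivative acting on vectors and its derivative acting on matrices.
\<close>

locale flow_field =
  fixes \<xi> :: "real^'n \<Rightarrow> real^'n" and D\<xi> :: "real^'n \<Rightarrow> real^'n^'n" and K C :: real
  assumes K: "0 < K" and C: "0 \<le> C"
    and lip: "\<And>a b. norm (\<xi> a - \<xi> b) \<le> K * norm (a - b)"
    and taylor: "\<And>a b. norm (\<xi> b - \<xi> a - D\<xi> a *v (b - a)) \<le> C * (norm (b - a))\<^sup>2"
    and cont: "continuous_on UNIV D\<xi>"
    and bound: "\<And>a M :: real^'n^'n. norm (D\<xi> a ** M) \<le> K * norm M"
    and bound_vec: "\<And>a v. norm (D\<xi> a *v v) \<le> K * norm v"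
begin

lemma continuous_field: "continuous_on UNIV \<xi>"
  by (rule lipschitz_on_continuous_on[of K])
     (use K lip in \<open>auto intro!: lipschitz_onI simp: dist_norm\<close>)

lemma flow_exists: "\<exists>x. x 0 = y \<and> (\<forall>t. (x has_vector_derivative \<xi> (x t)) (at t))"
proof (rule ode_exists[of "\<lambda>t. \<xi>" K y "norm (\<xi> y)"])
  show "continuous_on UNIV (\<lambda>(t :: real, a). \<xi> a)"
    unfolding case_prod_unfold by (rule continuous_on_compose2[OF continuous_field]) (auto intro!: continuous_intros)
qed (use K lip in auto)

definition flow :: "real \<Rightarrow> real^'n \<Rightarrow> real^'n" where
  "flow t y = (SOME x. x 0 = y \<and> (\<forall>t. (x has_vector_derivative \<xi> (x t)) (at t))) t"

lemma flow_0 [simp]: "flow 0 y = y"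
  and flow_derivative: "((\<lambda>t. flow t y) has_vector_derivative \<xi> (flow t y)) (at t)"
  using someI_ex[OF flow_exists[of y]] unfolding flow_def by auto

lemma flow_unique:
  assumes "\<And>t. (x has_vector_derivative \<xi> (x t)) (at t)"
  shows "x t = flow t (x 0)"
  by (rule ode_unique[of "\<lambda>t. \<xi>" K x "\<lambda>t. flow t (x 0)"])
     (use K lip assms flow_derivative in auto)

lemma flow_add: "flow s (flow t y) = flow (s + t) y"
proof -
  have "((\<lambda>s. flow (s + t) y) has_vector_derivative \<xi> (flow (s + t) y)) (at s)" for s
  proof -
    have "((\<lambda>s. s + t) has_vector_derivative 1) (at s)"
      by (auto intro!: derivative_eq_intros)
    then show ?thesis
      using vector_diff_chain_at[of "\<lambda>s. s + t" 1 s "\<lambda>t. flow t y"] flow_derivative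
      by (simp add: o_def)
  qed
  from flow_unique[OF this, of s] show ?thesis by simp
qed

lemma flow_inverse [simp]: "flow (- t) (flow t y) = y" "flow t (flow (- t) y) = y"
  by (simp_all add: flow_add)

lemma flow_fixed: "\<xi> y = 0 \<Longrightarrow> flow t y = y"
  using flow_unique[of "\<lambda>_. y" t] by simp

lemma flow_in_domain:
  assumes "y \<in> D" and "\<And>z. z \<notin> D \<Longrightarrow> \<xi> z = 0"
  shows "flow t y \<in> D"
proof (rule ccontr)
  assume "flow t y \<notin> D"
  then have "flow (- t) (flow t y) = flow t y" using assms(2) flow_fixed by blast
  then show False using assms(1) \<open>flow t y \<notin> D\<close> by simp
qed

lemma flow_lipschitz: "(norm (flow t a - flow t b))\<^sup>2 \<le> (norm (a - b))\<^sup>2 * exp ((2 * K + 1) * \<bar>t\<bar>)"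
proof -
  have "(norm (flow t a - flow t b))\<^sup>2 \<le> ((norm (flow 0 a - flow 0 b))\<^sup>2 + 0\<^sup>2) * exp ((2 * K + 1) * \<bar>t\<bar>)"
  proof (rule gronwall[where T = "\<bar>t\<bar>" and e' = "\<lambda>t. \<xi> (flow t a) - \<xi> (flow t b)"])
    show "((\<lambda>t. flow t a - flow t b) has_vector_derivative \<xi> (flow s a) - \<xi> (flow s b)) (at s)" for s
      by (intro has_vector_derivative_diff flow_derivative)
  qed (use K lip in auto)
  then show ?thesis by simp
qed

lemma variation_exists:
  "\<exists>M. M 0 = mat 1 \<and> (\<forall>t. (M has_vector_derivative D\<xi> (flow t y) ** M t) (at t))"
proof (rule ode_exists[of "\<lambda>t M. D\<xi> (flow t y) ** M" K "mat 1" "K * norm (mat 1 :: real^'n^'n)"])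
  have "continuous_on UNIV (\<lambda>t. flow t y)"
    using flow_derivative by (intro continuous_at_imp_continuous_on) (blast intro: has_vector_derivative_continuous)
  then have "continuous_on UNIV (\<lambda>t. D\<xi> (flow t y))"
    by (intro continuous_on_compose2[OF cont]) auto
  then have "continuous_on UNIV (\<lambda>p :: real \<times> (real^'n^'n). D\<xi> (flow (fst p) y))"
    by (rule continuous_on_compose2) (auto intro!: continuous_intros)
  then show "continuous_on UNIV (\<lambda>(t, M :: real^'n^'n). D\<xi> (flow t y) ** M)"
    unfolding case_prod_unfold by (intro continuous_on_matrix_mult continuous_intros)
  show "norm (D\<xi> (flow t y) ** M - D\<xi> (flow t y) ** N) \<le> K * norm (M - N)" for t and M N :: "real^'n^'n"
    using bound[of "flow t y" "M - N"]
    by (simp add: bounded_bilinear.diff_right[OF bounded_bilinear_matrix_mult])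
  show "norm (D\<xi> (flow t y) ** mat 1) \<le> K * norm (mat 1 :: real^'n^'n)" for t
    by (rule bound)
qed (use K in auto)

text \<open>
  The solution of the variational equation, which is the derivative of the flow in its initial value.
\<close>

definition variation :: "real \<Rightarrow> real^'n \<Rightarrow> real^'n^'n" where
  "variation t y = (SOME M. M 0 = mat 1 \<and> (\<forall>t. (M has_vector_derivative D\<xi> (flow t y) ** M t) (at t))) t"

lemma variation_0 [simp]: "variation 0 y = mat 1"
  and variation_derivative: "((\<lambda>t. variation t y) has_vector_derivative D\<xi> (flow t y) ** variation t y) (at t)"
  using someI_ex[OF variation_exists[of y]] unfolding variation_def by auto

text \<open>
  Let \<open>e\<close> be the difference between the displacement of the flow and its linear prediction. It starts at
  zero and satisfies \<open>\<parallel>e'\<parallel> \<le> K \<parallel>e\<parallel> + C \<parallel>\<Delta>\<parallel>\<^sup>2\<close>, where the displacement \<open>\<Delta>\<close> is itself at most a constant times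
  \<open>\<parallel>h\<parallel>\<close>. Gronwall's inequality therefore makes \<open>e\<close> quadratic in \<open>h\<close>.
\<close>

lemma flow_has_derivative: "(flow t has_derivative (\<lambda>h. variation t y *v h)) (at y)"
proof (rule has_derivative_of_quadratic_bound)
  show "bounded_linear (\<lambda>h. variation t y *v h)" by (rule matrix_vector_mul_bounded_linear)
  define E where "E = exp ((2 * K + 1) * \<bar>t\<bar>)"
  fix h
  define e where "e s = flow s (y + h) - flow s y - variation s y *v h" for s
  define e' where "e' s = \<xi> (flow s (y + h)) - \<xi> (flow s y) - (D\<xi> (flow s y) ** variation s y) *v h" for s
  have "(norm (e t))\<^sup>2 \<le> ((norm (e 0))\<^sup>2 + (C * ((norm h)\<^sup>2 * E))\<^sup>2) * exp ((2 * K + 1) * \<bar>t\<bar>)"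
  proof (rule gronwall[where T = "\<bar>t\<bar>" and e' = e'])
    fix s assume s: "\<bar>s\<bar> \<le> \<bar>t\<bar>"
    have "((\<lambda>s. variation s y *v h) has_vector_derivative (D\<xi> (flow s y) ** variation s y) *v h) (at s)"
      by (rule bounded_linear.has_vector_derivative[OF bounded_linear_matrix_vector_mult_left variation_derivative])
    then show "(e has_vector_derivative e' s) (at s)"
      unfolding e_def e'_def by (intro has_vector_derivative_diff flow_derivative)
    let ?a = "flow s y" and ?b = "flow s (y + h)"
    have "e' s = (\<xi> ?b - \<xi> ?a - D\<xi> ?a *v (?b - ?a)) + D\<xi> ?a *v e s"
      by (simp add: e'_def e_def matrix_vector_mul_assoc[symmetric] matrix_vector_mult_diff_distrib)
    then have "norm (e' s) \<le> C * (norm (?b - ?a))\<^sup>2 + K * norm (e s)"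
      using norm_triangle_mono[OF taylor[of ?b ?a] bound_vec[of ?a "e s"]] by simp
    also have "(norm (?b - ?a))\<^sup>2 \<le> (norm h)\<^sup>2 * E"
    proof -
      have "(norm (?b - ?a))\<^sup>2 \<le> (norm h)\<^sup>2 * exp ((2 * K + 1) * \<bar>s\<bar>)"
        using flow_lipschitz[of s "y + h" y] by simp
      also have "\<dots> \<le> (norm h)\<^sup>2 * E"
        unfolding E_def using s K by (intro mult_left_mono) auto
      finally show ?thesis .
    qed
    finally show "norm (e' s) \<le> K * norm (e s) + C * ((norm h)\<^sup>2 * E)"
      using C by (simp add: mult_left_mono)
  qed (use K in auto)
  also have "norm (e 0) = 0" by (simp add: e_def)
  finally have "(norm (e t))\<^sup>2 \<le> (C * (norm h)\<^sup>2 * E)\<^sup>2 * E"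
    by (simp add: E_def mult.assoc)
  also have "\<dots> \<le> (C * (norm h)\<^sup>2 * E)\<^sup>2 * E\<^sup>2"
  proof (intro mult_left_mono)
    have "1 \<le> E" using K by (simp add: E_def)
    then show "E \<le> E\<^sup>2" by (simp add: power2_eq_square)
  qed simp
  finally have "(norm (e t))\<^sup>2 \<le> (C * E * E * (norm h)\<^sup>2)\<^sup>2"
    by (simp add: power_mult_distrib mult_ac)
  then have "norm (e t) \<le> C * E * E * (norm h)\<^sup>2"
    by (rule power2_le_imp_le) (use C in \<open>auto simp: E_def\<close>)
  then show "norm (flow t (y + h) - flow t y - variation t y *v h) \<le> C * E * E * (norm h)\<^sup>2"
    by (simp add: e_def)
qed

lemma jacobian_flow: "jacobian (flow t) (at y) = variation t y"
  by (simp add: jacobian_def frechet_derivative_at[OF flow_has_derivative, symmetric])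

lemma variation_inverse: "variation t (flow (- t) y) ** variation (- t) y = mat 1"
proof -
  have "((\<lambda>z. flow t (flow (- t) z)) has_derivative (\<lambda>h. variation t (flow (- t) y) *v (variation (- t) y *v h))) (at y)"
    by (rule has_derivative_compose[OF flow_has_derivative flow_has_derivative])
  then have "((\<lambda>z. z) has_derivative (\<lambda>h. (variation t (flow (- t) y) ** variation (- t) y) *v h)) (at y)"
    by (simp add: matrix_vector_mul_assoc)
  then have "(\<lambda>h. (variation t (flow (- t) y) ** variation (- t) y) *v h) = (\<lambda>h. h)"
    using has_derivative_unique has_derivative_ident by blast
  then have "matrix ((*v) (variation t (flow (- t) y) ** variation (- t) y)) = matrix (\<lambda>h. h)"
    by (rule arg_cong)
  also have "matrix (\<lambda>h :: real^'n. h) = mat 1"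
    using matrix_id_mat_1 by (simp add: id_def)
  finally show ?thesis by simp
qed

end

section \<open>Test functions and their gradient fields\<close>

lemma bounded_of_compact_support:
  fixes f :: "'a::metric_space \<Rightarrow> 'b::real_normed_vector"
  assumes "continuous_on UNIV f" "compact S" "\<And>x. x \<notin> S \<Longrightarrow> f x = 0"
  obtains B where "0 \<le> B" "\<And>x. norm (f x) \<le> B"
proof -
  have "bounded (f ` S)"
    using assms(1,2) by (meson compact_continuous_image compact_imp_bounded continuous_on_subset subset_UNIV)
  then obtain B where "\<And>x. x \<in> S \<Longrightarrow> norm (f x) \<le> B"
    by (auto simp: bounded_iff)
  then have "norm (f x) \<le> max B 0" for x
    using assms(3)[of x] by (cases "x \<in> S") (auto simp: le_max_iff_disj)
  then show ?thesis using that[of "max B 0"] by simp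
qed

lemma smooth_has_derivative:
  assumes "smooth f"
  shows "(f has_derivative frechet_derivative f (at x)) (at x)"
proof -
  have "Ck (Suc 0) f" using assms by (simp add: smooth_def del: Ck.simps)
  then show ?thesis by (simp add: frechet_derivative_works)
qed

lemma smooth_directional_derivative:
  assumes "smooth f"
  shows "smooth (\<lambda>x. frechet_derivative f (at x) v)"
proof -
  have "Ck k (\<lambda>x. frechet_derivative f (at x) v)" for k
  proof -
    have "Ck (Suc k) f" using assms by (simp add: smooth_def del: Ck.simps)
    then show ?thesis by simp
  qed
  then show ?thesis by (simp add: smooth_def)
qed

lemma smooth_continuous: "smooth f \<Longrightarrow> continuous_on UNIV f"
  unfolding smooth_def by (metis Ck.simps(1))

lemma frechet_derivative_outside_support:
  fixes f :: "'a::real_normed_vector \<Rightarrow> 'b::real_normed_vector"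
  assumes "x \<notin> closure {x. f x \<noteq> 0}"
  shows "frechet_derivative f (at x) v = 0"
proof -
  have "((\<lambda>_. 0) has_derivative (\<lambda>_. 0)) (at x)" by (rule has_derivative_const)
  then have "(f has_derivative (\<lambda>_. 0)) (at x)"
  proof (rule has_derivative_transform_within_open)
    show "open (- closure {x. f x \<noteq> 0})" by (rule open_Compl[OF closed_closure])
    show "x \<in> - closure {x. f x \<noteq> 0}" using assms by simp
    show "0 = f y" if "y \<in> - closure {x. f x \<noteq> 0}" for y
      using that closure_subset[of "{x. f x \<noteq> 0}"] by auto
  qed
  from fun_cong[OF frechet_derivative_at[OF this], of v] show ?thesis by simp
qed

lemma Ck_scaleR: "Ck k f \<Longrightarrow> Ck k (\<lambda>y. f y *\<^sub>R a)"
proof (induction k arbitrary: f)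
  case 0
  then show ?case by (auto intro: continuous_intros)
next
  case (Suc k)
  have d: "((\<lambda>y. f y *\<^sub>R a) has_derivative (\<lambda>v. frechet_derivative f (at x) v *\<^sub>R a)) (at x)" for x
    using Suc.prems by (auto intro!: has_derivative_scaleR_left simp: frechet_derivative_works)
  have "frechet_derivative (\<lambda>y. f y *\<^sub>R a) (at x) v = frechet_derivative f (at x) v *\<^sub>R a" for x v
    using fun_cong[OF frechet_derivative_at[OF d[of x]], of v] by simp
  moreover have "(\<lambda>y. f y *\<^sub>R a) differentiable (at x)" for x
    using d by (rule differentiableI)
  ultimately show ?case using Suc by simp
qed

text \<open>
  The derivative matrix of the vector field \<open>\<psi> e\<^sub>k\<close>; only its row \<open>k\<close> is nonzero.
\<close>

definition gradient_field :: "'d \<Rightarrow> (real^'d \<Rightarrow> real) \<Rightarrow> real^'d \<Rightarrow> real^'d::finite^'d" where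
  "gradient_field k \<psi> y = (\<chi> i j. if i = k then frechet_derivative \<psi> (at y) (axis j 1) else 0)"

lemma gradient_field_mult:
  fixes \<psi> :: "real^'d::finite \<Rightarrow> real"
  assumes "smooth \<psi>"
  shows "gradient_field k \<psi> y *v v = frechet_derivative \<psi> (at y) v *\<^sub>R axis k 1"
proof -
  have lin: "linear (frechet_derivative \<psi> (at y))"
    using smooth_has_derivative[OF assms] has_derivative_linear by blast
  have "v = (\<Sum>j\<in>UNIV. v $ j *\<^sub>R axis j 1)"
    using basis_expansion[of v] by (simp add: scalar_mult_eq_scaleR)
  then have "frechet_derivative \<psi> (at y) v = frechet_derivative \<psi> (at y) (\<Sum>j\<in>UNIV. v $ j *\<^sub>R axis j 1)"
    by (rule arg_cong)
  also have "\<dots> = (\<Sum>j\<in>UNIV. v $ j * frechet_derivative \<psi> (at y) (axis j 1))"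
    by (simp only: linear_sum[OF lin] linear_scale[OF lin] real_scaleR_def)
  finally have "frechet_derivative \<psi> (at y) v = (\<Sum>j\<in>UNIV. v $ j * frechet_derivative \<psi> (at y) (axis j 1))" .
  then show ?thesis
    by (auto simp: gradient_field_def matrix_vector_mult_def vec_eq_iff axis_def mult.commute)
qed

lemma directional_derivative_sum:
  fixes \<psi> :: "real^'d::finite \<Rightarrow> real"
  assumes "smooth \<psi>"
  shows "frechet_derivative \<psi> (at y) v = (\<Sum>j\<in>UNIV. v $ j * frechet_derivative \<psi> (at y) (axis j 1))"
proof -
  \<comment> \<open>The choice of the row is immaterial.\<close>
  have "(gradient_field undefined \<psi> y *v v) $ undefined = frechet_derivative \<psi> (at y) v"
    by (simp add: gradient_field_mult[OF assms])
  then show ?thesis by (simp add: gradient_field_def matrix_vector_mult_def mult.commute)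
qed

lemma bounded_derivative_of_compact_support:
  fixes \<psi> :: "real^'d::finite \<Rightarrow> real"
  assumes s: "smooth \<psi>" and supp: "compact (closure {x. \<psi> x \<noteq> 0})"
  obtains B where "0 \<le> B" "\<And>x v. \<bar>frechet_derivative \<psi> (at x) v\<bar> \<le> B * norm v"
proof -
  let ?d = "\<lambda>j x. frechet_derivative \<psi> (at x) (axis j 1)"
  have "\<exists>B. 0 \<le> B \<and> (\<forall>x. norm (?d j x) \<le> B)" for j
    using bounded_of_compact_support[OF smooth_continuous[OF smooth_directional_derivative[OF s]] supp
        frechet_derivative_outside_support] by metis
  then obtain B where B: "\<And>j. 0 \<le> B j" "\<And>j x. norm (?d j x) \<le> B j" by metis
  have "\<bar>frechet_derivative \<psi> (at x) v\<bar> \<le> sum B UNIV * norm v" for x v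
  proof -
    have "\<bar>frechet_derivative \<psi> (at x) v\<bar> \<le> (\<Sum>j\<in>UNIV. \<bar>v $ j * ?d j x\<bar>)"
      unfolding directional_derivative_sum[OF s, of x v] by (rule sum_abs)
    also have "\<dots> \<le> (\<Sum>j\<in>UNIV. B j * norm v)"
    proof (rule sum_mono)
      fix j
      have "\<bar>v $ j\<bar> * \<bar>?d j x\<bar> \<le> norm v * B j"
        using component_le_norm_cart[of v j] B(2)[of x j] by (intro mult_mono) auto
      then show "\<bar>v $ j * ?d j x\<bar> \<le> B j * norm v" by (simp add: abs_mult mult.commute)
    qed
    finally show ?thesis by (simp add: sum_distrib_right)
  qed
  moreover have "0 \<le> sum B UNIV" by (intro sum_nonneg B)
  ultimately show ?thesis using that by blast
qed

lemma lipschitz_of_compact_support: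
  fixes \<psi> :: "real^'d::finite \<Rightarrow> real"
  assumes s: "smooth \<psi>" and supp: "compact (closure {x. \<psi> x \<noteq> 0})"
  obtains B where "0 \<le> B" "\<And>x y. \<bar>\<psi> x - \<psi> y\<bar> \<le> B * norm (x - y)"
proof -
  obtain B where B: "0 \<le> B" "\<And>x v. \<bar>frechet_derivative \<psi> (at x) v\<bar> \<le> B * norm v"
    using bounded_derivative_of_compact_support[OF s supp] by blast
  have "norm (\<psi> x - \<psi> y) \<le> B * norm (x - y)" for x y
  proof (rule differentiable_bound[OF convex_UNIV smooth_has_derivative[OF s]])
    show "onorm (frechet_derivative \<psi> (at z)) \<le> B" for z
      by (rule onorm_bound) (use B in auto)
  qed auto
  then show ?thesis using that[of B] B(1) by simp
qed

lemma taylor_of_compact_support: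
  fixes \<psi> :: "real^'d::finite \<Rightarrow> real"
  assumes s: "smooth \<psi>" and supp: "compact (closure {x. \<psi> x \<noteq> 0})"
  obtains C where "0 \<le> C" "\<And>a b. \<bar>\<psi> b - \<psi> a - frechet_derivative \<psi> (at a) (b - a)\<bar> \<le> C * (norm (b - a))\<^sup>2"
proof -
  let ?D = "\<lambda>x. frechet_derivative \<psi> (at x)"
  have "\<exists>B. 0 \<le> B \<and> (\<forall>x y. \<bar>?D x (axis j 1) - ?D y (axis j 1)\<bar> \<le> B * norm (x - y))" for j
  proof -
    have "closure {x. ?D x (axis j 1) \<noteq> 0} \<subseteq> closure {x. \<psi> x \<noteq> 0}"
      by (rule closure_minimal) (use frechet_derivative_outside_support in \<open>force, simp\<close>)
    then have "compact (closure {x. ?D x (axis j 1) \<noteq> 0})"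
      using compact_Int_closed[OF supp closed_closure[of "{x. ?D x (axis j 1) \<noteq> 0}"]]
      by (simp only: Int_absorb1)
    from lipschitz_of_compact_support[OF smooth_directional_derivative[OF s] this] show ?thesis by metis
  qed
  then obtain C where C: "\<And>j. 0 \<le> C j" "\<And>j x y. \<bar>?D x (axis j 1) - ?D y (axis j 1)\<bar> \<le> C j * norm (x - y)"
    by metis
  have diff: "\<bar>?D x v - ?D a v\<bar> \<le> sum C UNIV * norm (x - a) * norm v" for x a v
  proof -
    have "?D x v - ?D a v = (\<Sum>j\<in>UNIV. v $ j * (?D x (axis j 1) - ?D a (axis j 1)))"
      unfolding directional_derivative_sum[OF s, of x v] directional_derivative_sum[OF s, of a v]
      by (simp add: sum_subtractf right_diff_distrib)
    then have "\<bar>?D x v - ?D a v\<bar> \<le> (\<Sum>j\<in>UNIV. \<bar>v $ j * (?D x (axis j 1) - ?D a (axis j 1))\<bar>)"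
      by (simp only: sum_abs)
    also have "\<dots> \<le> (\<Sum>j\<in>UNIV. C j * norm (x - a) * norm v)"
    proof (rule sum_mono)
      fix j
      have "\<bar>v $ j\<bar> * \<bar>?D x (axis j 1) - ?D a (axis j 1)\<bar> \<le> norm v * (C j * norm (x - a))"
        using component_le_norm_cart[of v j] C(2)[of x j a] by (intro mult_mono) auto
      then show "\<bar>v $ j * (?D x (axis j 1) - ?D a (axis j 1))\<bar> \<le> C j * norm (x - a) * norm v"
        by (simp add: abs_mult mult_ac)
    qed
    finally show ?thesis by (simp add: sum_distrib_right)
  qed
  have C0: "0 \<le> sum C UNIV" by (intro sum_nonneg C)
  have "\<bar>\<psi> b - \<psi> a - ?D a (b - a)\<bar> \<le> sum C UNIV * (norm (b - a))\<^sup>2" for a b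
  proof -
    let ?T = "cball a (norm (b - a))"
    have "norm (\<psi> b - \<psi> a - ?D a (b - a)) \<le> norm (b - a) * (sum C UNIV * norm (b - a))"
    proof (rule differentiable_bound_linearization[where S = ?T])
      show "a + t *\<^sub>R (b - a) \<in> ?T" if "t \<in> {0..1}" for t
        using that by (auto simp: dist_norm intro: mult_left_le_one_le)
      show "(\<psi> has_derivative ?D x) (at x within ?T)" for x
        using smooth_has_derivative[OF s] has_derivative_at_withinI by blast
      show "onorm (?D x - ?D a) \<le> sum C UNIV * norm (b - a)" if "x \<in> ?T" for x
      proof (rule onorm_bound)
        fix v :: "real^'d"
        have "norm (x - a) \<le> norm (b - a)" using that by (simp add: dist_norm norm_minus_commute)
        then have "sum C UNIV * norm (x - a) * norm v \<le> sum C UNIV * norm (b - a) * norm v"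
          using C0 by (intro mult_right_mono mult_left_mono) auto
        then show "norm ((?D x - ?D a) v) \<le> sum C UNIV * norm (b - a) * norm v"
          using diff[of x v a] by simp
      qed (use C0 in simp)
    qed simp
    then show ?thesis by (simp add: power2_eq_square mult_ac)
  qed
  then show ?thesis using that C0 by blast
qed

text \<open>
  Compact support turns continuity of the first and second derivatives of \<open>\<psi>\<close> into the global bounds
  that the flow requires.
\<close>

lemma gradient_field_flow:
  fixes \<psi> :: "real^'d::finite \<Rightarrow> real"
  assumes s: "smooth \<psi>" and supp: "compact (closure {x. \<psi> x \<noteq> 0})"
  shows "\<exists>K C. flow_field (\<lambda>y. \<psi> y *\<^sub>R axis k 1) (gradient_field k \<psi>) K C"
proof -
  obtain B1 where B1: "0 \<le> B1" "\<And>x v. \<bar>frechet_derivative \<psi> (at x) v\<bar> \<le> B1 * norm v"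
    using bounded_derivative_of_compact_support[OF s supp] by blast
  obtain B2 where B2: "0 \<le> B2" "\<And>x y. \<bar>\<psi> x - \<psi> y\<bar> \<le> B2 * norm (x - y)"
    using lipschitz_of_compact_support[OF s supp] by blast
  obtain C where C: "0 \<le> C"
    "\<And>a b. \<bar>\<psi> b - \<psi> a - frechet_derivative \<psi> (at a) (b - a)\<bar> \<le> C * (norm (b - a))\<^sup>2"
    using taylor_of_compact_support[OF s supp] by blast
  have G0: "gradient_field k \<psi> x = 0" if "x \<notin> closure {x. \<psi> x \<noteq> 0}" for x
    using frechet_derivative_outside_support[OF that] by (simp add: gradient_field_def vec_eq_iff)
  have Gc: "continuous_on UNIV (gradient_field k \<psi>)"
  proof -
    have "continuous_on UNIV (\<lambda>y. if i = k then frechet_derivative \<psi> (at y) (axis j 1) else 0)" for i j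
      using smooth_continuous[OF smooth_directional_derivative[OF s]] by (cases "i = k") auto
    then show ?thesis
      unfolding gradient_field_def by (intro continuous_on_vec_lambda)
  qed
  obtain B3 where B3: "0 \<le> B3" "\<And>x. norm (gradient_field k \<psi> x) \<le> B3"
    using bounded_of_compact_support[OF Gc supp G0] by blast
  obtain c where c: "0 < c" "\<And>(A :: real^'d^'d) (M :: real^'d^'d). norm (A ** M) \<le> norm A * norm M * c"
    using bounded_bilinear.pos_bounded[OF bounded_bilinear_matrix_mult] by metis
  define K where "K = B1 + B2 + B3 * c + 1"
  have K: "B1 \<le> K" "B2 \<le> K" "B3 * c \<le> K" "0 < K"
    using B1(1) B2(1) B3(1) c(1) by (auto simp: K_def intro!: add_nonneg_pos)
  let ?e = "axis k 1 :: real^'d"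
  have "flow_field (\<lambda>y. \<psi> y *\<^sub>R ?e) (gradient_field k \<psi>) K C"
  proof
    show "norm (\<psi> a *\<^sub>R ?e - \<psi> b *\<^sub>R ?e) \<le> K * norm (a - b)" for a b
    proof -
      have "B2 * norm (a - b) \<le> K * norm (a - b)" using K by (intro mult_right_mono) auto
      then show ?thesis
        using B2(2)[of a b] by (simp add: scaleR_diff_left[symmetric] norm_axis_1)
    qed
    show "norm (\<psi> b *\<^sub>R ?e - \<psi> a *\<^sub>R ?e - gradient_field k \<psi> a *v (b - a)) \<le> C * (norm (b - a))\<^sup>2" for a b
      using C(2)[of b a] by (simp add: gradient_field_mult[OF s] scaleR_diff_left[symmetric] norm_axis_1)
    show "norm (gradient_field k \<psi> a ** M) \<le> K * norm M" for a and M :: "real^'d^'d"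
    proof -
      have "norm (gradient_field k \<psi> a ** M) \<le> norm (gradient_field k \<psi> a) * (norm M * c)"
        using c(2)[of "gradient_field k \<psi> a" M] by (simp add: mult.assoc)
      also have "\<dots> \<le> B3 * (norm M * c)" using B3(2) c(1) by (intro mult_right_mono) auto
      also have "\<dots> = (B3 * c) * norm M" by simp
      also have "\<dots> \<le> K * norm M" using K by (intro mult_right_mono) auto
      finally show ?thesis .
    qed
    show "norm (gradient_field k \<psi> a *v v) \<le> K * norm v" for a v
    proof -
      have "B1 * norm v \<le> K * norm v" using K by (intro mult_right_mono) auto
      then show ?thesis
        using B1(2)[of a v] by (simp add: gradient_field_mult[OF s] norm_axis_1)
    qed
  qed (use K C Gc in auto)
  then show ?thesis by blast
qed

section \<open>Weak divergence of the tensor\<close>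

lemma set_integral_sum_finite:
  fixes f :: "'k::finite \<Rightarrow> 'a \<Rightarrow> real"
  assumes "\<And>k. set_integrable M A (f k)"
  shows "set_integrable M A (\<lambda>y. \<Sum>k\<in>UNIV. f k y)"
    and "(LINT y:A|M. \<Sum>k\<in>UNIV. f k y) = (\<Sum>k\<in>UNIV. LINT y:A|M. f k y)"
  using assms unfolding set_integrable_def set_lebesgue_integral_def scaleR_sum_right
  by (rule Bochner_Integration.integrable_sum, rule Bochner_Integration.integral_sum)

lemma integrable_times_test:
  fixes f g :: "real^'d::finite \<Rightarrow> real"
  assumes f: "locally_integrable D f" and g: "continuous_on UNIV g"
    and T: "compact T" "T \<subseteq> D" "\<And>x. x \<notin> T \<Longrightarrow> g x = 0"
  shows "set_integrable lebesgue D (\<lambda>y. f y * g y)"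
proof -
  obtain B where B: "0 \<le> B" "\<And>x. norm (g x) \<le> B"
    using bounded_of_compact_support[OF g T(1,3)] by blast
  have i: "integrable lebesgue (\<lambda>y. indicator T y *\<^sub>R f y)"
    using f T(1,2) unfolding locally_integrable_def set_integrable_def by blast
  have gm: "g \<in> borel_measurable lebesgue"
    by (rule measurable_completion) (simp add: borel_measurable_continuous_onI[OF g])
  have "integrable lebesgue (\<lambda>y. (indicator T y *\<^sub>R f y) * g y)"
  proof (rule Bochner_Integration.integrable_bound)
    show "integrable lebesgue (\<lambda>y. B * (indicator T y *\<^sub>R f y))"
      using i by (rule integrable_mult_right)
    show "(\<lambda>y. (indicator T y *\<^sub>R f y) * g y) \<in> borel_measurable lebesgue"
      using borel_measurable_integrable[OF i] gm by (rule borel_measurable_times)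
    show "AE y in lebesgue. norm ((indicator T y *\<^sub>R f y) * g y) \<le> norm (B * (indicator T y *\<^sub>R f y))"
    proof (rule AE_I2)
      fix y
      have "\<bar>g y\<bar> * \<bar>indicator T y *\<^sub>R f y\<bar> \<le> B * \<bar>indicator T y *\<^sub>R f y\<bar>"
        using B(2)[of y] by (intro mult_right_mono) auto
      then show "norm ((indicator T y *\<^sub>R f y) * g y) \<le> norm (B * (indicator T y *\<^sub>R f y))"
        using B(1) by (simp add: abs_mult mult.commute)
    qed
  qed
  moreover have "(\<lambda>y. (indicator T y *\<^sub>R f y) * g y) = (\<lambda>y. indicator D y *\<^sub>R (f y * g y))"
    using T(2,3) by (auto simp: fun_eq_iff indicator_def)
  ultimately show ?thesis by (simp only: set_integrable_def)
qed

text \<open>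
  The integrand at \<open>y\<close> is \<open>L (N(\<epsilon>)\<^sup>* \<alpha>(y)) \<bar>det U(\<epsilon>)\<bar>\<close>, where \<open>U(\<epsilon>)\<close> is the Jacobian matrix at \<open>y\<close> of the
  backward flow and \<open>N(\<epsilon>)\<close> its inverse. At \<open>\<epsilon> = 0\<close> their velocities are \<open>- D\<xi>(y)\<close> and \<open>D\<xi>(y)\<close>, and the two
  trace terms cancel.
\<close>

lemma deriv_transformed_integrand:
  fixes \<psi> :: "real^'d::{finite,linorder} \<Rightarrow> real"
  assumes p: "1 \<le> p" and L: "smooth_on_forms p L" and A: "\<alpha> y \<in> forms p"
    and F: "flow_field \<xi> D\<xi> K C"
  shows "deriv (\<lambda>\<epsilon>. transformed_integrand p L \<alpha> (flow_field.flow \<xi>) \<epsilon> y) 0 =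
    - (\<Sum>i\<in>UNIV. \<Sum>j\<in>UNIV. D\<xi> y $ i $ j * tensor p L (\<alpha> y) $ i $ j)"
proof -
  interpret flow_field \<xi> D\<xi> K C by (rule F)
  define U where "U \<epsilon> = variation (- \<epsilon>) y" for \<epsilon>
  define N where "N \<epsilon> = mat 1 ** matrix_inv (U \<epsilon>)" for \<epsilon>
  have U': "(U has_vector_derivative - D\<xi> y) (at 0)"
    unfolding U_def using has_vector_derivative_reflect[of "\<lambda>t. variation t y" _ 0] variation_derivative[of y 0] by simp
  have inv: "invertible (U \<epsilon>)" for \<epsilon>
    unfolding U_def using variation_inverse[of \<epsilon> y] by (metis invertible_left_inverse)
  have N: "variation \<epsilon> (flow (- \<epsilon>) y) = N \<epsilon>" for \<epsilon>
  proof -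
    have "variation \<epsilon> (flow (- \<epsilon>) y) ** (U \<epsilon> ** matrix_inv (U \<epsilon>)) = matrix_inv (U \<epsilon>)"
      using variation_inverse[of \<epsilon> y] by (simp add: U_def matrix_mul_assoc)
    then show ?thesis by (simp add: matrix_inv_mult[OF inv] N_def)
  qed
  have U0: "U 0 = mat 1" by (simp add: U_def)
  have N0: "N 0 = mat 1"
    using matrix_inv_mult(1)[OF inv[of 0]] by (simp add: N_def U0)
  have N': "(N has_vector_derivative D\<xi> y) (at 0)"
  proof (rule differentiable_quotient_path[OF inv U' has_vector_derivative_const[of "mat 1"]])
    fix c' assume c': "((\<lambda>s. mat 1 ** matrix_inv (U s)) has_vector_derivative c') (at 0)"
      "c' ** U 0 + mat 1 ** matrix_inv (U 0) ** - D\<xi> y = 0"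
    have "mat 1 ** matrix_inv (U 0) = mat 1" using N0 by (simp add: N_def)
    then have "c' = D\<xi> y" using c'(2) by (simp add: U0)
    then show ?thesis using c'(1) unfolding N_def by simp
  qed
  have d1: "((\<lambda>\<epsilon>. L (pullback p (N \<epsilon>) (\<alpha> y))) has_real_derivative
      (L (\<alpha> y) * trace (D\<xi> y) - (\<Sum>i\<in>UNIV. \<Sum>j\<in>UNIV. D\<xi> y $ i $ j * tensor p L (\<alpha> y) $ i $ j))) (at 0)"
    by (rule lagrangian_derivative[OF p L A N0 N'])
  have "((\<lambda>\<epsilon>. det (U \<epsilon>)) has_derivative (\<lambda>h. trace (h *\<^sub>R (- D\<xi> y)))) (at 0)"
    by (rule has_derivative_compose[OF U'[unfolded has_vector_derivative_def]])
       (simp add: U0 has_derivative_det_mat_1)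
  moreover have "(\<lambda>h. trace (h *\<^sub>R (- D\<xi> y))) = (*) (- trace (D\<xi> y))"
    by (rule ext) (simp add: trace_def sum_distrib_left sum_negf mult.commute)
  ultimately have det: "((\<lambda>\<epsilon>. det (U \<epsilon>)) has_real_derivative - trace (D\<xi> y)) (at 0)"
    by (simp only: has_field_derivative_def)
  have "\<forall>\<^sub>F \<epsilon> in nhds 0. det (U \<epsilon>) \<in> {0<..}"
    using DERIV_isCont[OF det] by (intro eventually_nhds_of_isCont) (auto simp: U0)
  then obtain T where T: "open T" "0 \<in> T" "\<And>\<epsilon>. \<epsilon> \<in> T \<Longrightarrow> 0 < det (U \<epsilon>)"
    unfolding eventually_nhds by auto
  have d2: "((\<lambda>\<epsilon>. \<bar>det (U \<epsilon>)\<bar>) has_real_derivative - trace (D\<xi> y)) (at 0)"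
    by (rule has_field_derivative_transform_within_open[OF det T(1,2)]) (use T(3) in force)
  have "((\<lambda>\<epsilon>. L (pullback p (N \<epsilon>) (\<alpha> y)) * \<bar>det (U \<epsilon>)\<bar>) has_real_derivative
      (L (\<alpha> y) * trace (D\<xi> y) - (\<Sum>i\<in>UNIV. \<Sum>j\<in>UNIV. D\<xi> y $ i $ j * tensor p L (\<alpha> y) $ i $ j)) * \<bar>det (U 0)\<bar>
        + (- trace (D\<xi> y)) * L (pullback p (N 0) (\<alpha> y))) (at 0)"
    by (rule DERIV_mult[OF d1 d2])
  moreover have "transformed_integrand p L \<alpha> flow \<epsilon> y = L (pullback p (N \<epsilon>) (\<alpha> y)) * \<bar>det (U \<epsilon>)\<bar>" for \<epsilon>
    by (simp add: transformed_integrand_def pullback_field_def jacobian_flow N) (simp add: U_def)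
  ultimately show ?thesis
    by (subst DERIV_imp_deriv) (auto simp: U0 N0 pullback_mat_1[OF p A])
qed

lemma test_function_field:
  assumes "test_function D \<psi>"
  shows "test_function D (\<lambda>y. \<psi> y *\<^sub>R axis k (1 :: real))"
proof -
  have "{y. \<psi> y *\<^sub>R axis k (1 :: real) \<noteq> 0} = {y. \<psi> y \<noteq> 0}"
    by (auto simp: axis_eq_0_iff)
  then show ?thesis
    using assms by (auto simp: test_function_def smooth_def intro: Ck_scaleR)
qed

text \<open>
  The flow maps \<open>D\<close> onto itself, because \<open>\<psi> e\<^sub>k\<close> vanishes outside \<open>D\<close>. Hence the change of variables
  identifies the action of the pulled back form with the integral whose derivative at \<open>0\<close> may be
  computed under the integral sign.
\<close>

theorem weak_divergence_tensor:
  fixes \<psi> :: "'d::{finite,linorder} vector \<Rightarrow> real"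
  assumes p: "1 \<le> p" and L: "smooth_on_forms p L"
    and D: "open D" and forms: "\<And>y. y \<in> D \<Longrightarrow> \<alpha> y \<in> forms p"
    and regular: "variationally_regular p D L \<alpha>" and crit: "critical_point p D L \<alpha>"
    and \<psi>: "test_function D \<psi>"
  shows "(LINT y:D|lebesgue. \<Sum>j\<in>UNIV. tensor p L (\<alpha> y) $ k $ j * frechet_derivative \<psi> (at y) (axis j 1)) = 0"
proof -
  let ?\<xi> = "\<lambda>y. \<psi> y *\<^sub>R axis k 1 :: 'd vector"
  have s: "smooth \<psi>" and supp: "compact (closure {x. \<psi> x \<noteq> 0})" "closure {x. \<psi> x \<noteq> 0} \<subseteq> D"
    using \<psi> by (auto simp: test_function_def)
  obtain K C where F: "flow_field ?\<xi> (gradient_field k \<psi>) K C"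
    using gradient_field_flow[OF s supp(1)] by blast
  then interpret flow_field ?\<xi> "gradient_field k \<psi>" K C .
  have out: "?\<xi> z = 0" if "z \<notin> D" for z
    using that supp(2) closure_subset[of "{x. \<psi> x \<noteq> 0}"] by auto
  have inD: "flow t y \<in> D" if "y \<in> D" for t y
    by (rule flow_in_domain[OF that out])
  have flow: "flow_on D ?\<xi> flow"
    unfolding flow_on_def using inD flow_derivative by auto
  note tf = test_function_field[OF \<psi>, of k]
  have img: "flow t ` D = D" for t
  proof
    show "flow t ` D \<subseteq> D" using inD by auto
    show "D \<subseteq> flow t ` D"
    proof
      fix y assume "y \<in> D"
      then have "flow (- t) y \<in> D" by (rule inD)
      moreover have "y = flow t (flow (- t) y)" by (rule flow_inverse(2)[symmetric])
      ultimately show "y \<in> flow t ` D" by (rule rev_image_eqI)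
    qed
  qed
  have ev: "\<forall>\<^sub>F \<epsilon> in nhds 0. set_integrable lebesgue D (\<lambda>z. L (pullback_field p (flow \<epsilon>) \<alpha> z))"
    and der: "((\<lambda>\<epsilon>. LINT y:D|lebesgue. transformed_integrand p L \<alpha> flow \<epsilon> y) has_real_derivative
           (LINT y:D|lebesgue. deriv (\<lambda>\<epsilon>. transformed_integrand p L \<alpha> flow \<epsilon> y) 0)) (at 0)"
    using regular tf flow unfolding variationally_regular_def by blast+
  have act: "((\<lambda>\<epsilon>. action D L (pullback_field p (flow \<epsilon>) \<alpha>)) has_real_derivative 0) (at 0)"
    using crit tf flow unfolding critical_point_def by blast
  have eq: "action D L (pullback_field p (flow \<epsilon>) \<alpha>) = (LINT y:D|lebesgue. transformed_integrand p L \<alpha> flow \<epsilon> y)"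
    if "set_integrable lebesgue D (\<lambda>z. L (pullback_field p (flow \<epsilon>) \<alpha> z))" for \<epsilon>
  proof -
    let ?f = "\<lambda>z. L (pullback_field p (flow \<epsilon>) \<alpha> z)"
    have "(LINT y:D|lebesgue. \<bar>det (matrix (\<lambda>h. variation (- \<epsilon>) y *v h))\<bar> * ?f (flow (- \<epsilon>) y)) = (LINT y:flow (- \<epsilon>) ` D|lebesgue. ?f y)"
    proof (rule change_of_variables)
      show "D \<in> sets lebesgue" using D by (simp add: borel_open)
      show "(flow (- \<epsilon>) has_derivative (\<lambda>h. variation (- \<epsilon>) y *v h)) (at y within D)" for y
        by (rule has_derivative_at_withinI[OF flow_has_derivative])
      show "inj_on (flow (- \<epsilon>)) D"
        by (rule inj_on_inverseI[of _ "flow \<epsilon>"]) simp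
      show "set_integrable lebesgue (flow (- \<epsilon>) ` D) ?f" unfolding img by (rule that)
    qed
    then show ?thesis
      unfolding img by (simp add: action_def transformed_integrand_def jacobian_flow mult.commute)
  qed
  have "((\<lambda>\<epsilon>. LINT y:D|lebesgue. transformed_integrand p L \<alpha> flow \<epsilon> y) has_real_derivative 0) (at 0)"
  proof -
    obtain T where T: "open T" "0 \<in> T"
      "\<And>\<epsilon>. \<epsilon> \<in> T \<Longrightarrow> set_integrable lebesgue D (\<lambda>z. L (pullback_field p (flow \<epsilon>) \<alpha> z))"
      using ev unfolding eventually_nhds by blast
    show ?thesis
      by (rule has_field_derivative_transform_within_open[OF act T(1,2)]) (rule eq[OF T(3)])
  qed
  then have zero: "(LINT y:D|lebesgue. deriv (\<lambda>\<epsilon>. transformed_integrand p L \<alpha> flow \<epsilon> y) 0) = 0"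
    using DERIV_unique[OF der] by blast
  have "(LINT y:D|lebesgue. deriv (\<lambda>\<epsilon>. transformed_integrand p L \<alpha> flow \<epsilon> y) 0) =
      (LINT y:D|lebesgue. - (\<Sum>j\<in>UNIV. tensor p L (\<alpha> y) $ k $ j * frechet_derivative \<psi> (at y) (axis j 1)))"
  proof (rule set_lebesgue_integral_cong)
    show "D \<in> sets lebesgue" using D by (simp add: borel_open)
    show "\<forall>y. y \<in> D \<longrightarrow> deriv (\<lambda>\<epsilon>. transformed_integrand p L \<alpha> flow \<epsilon> y) 0 =
        - (\<Sum>j\<in>UNIV. tensor p L (\<alpha> y) $ k $ j * frechet_derivative \<psi> (at y) (axis j 1))"
    proof (intro allI impI)
      fix y assume "y \<in> D"
      have "(\<Sum>i\<in>UNIV. \<Sum>j\<in>UNIV. gradient_field k \<psi> y $ i $ j * tensor p L (\<alpha> y) $ i $ j) =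
        (\<Sum>i\<in>UNIV. if i = k then (\<Sum>j\<in>UNIV. tensor p L (\<alpha> y) $ k $ j * frechet_derivative \<psi> (at y) (axis j 1)) else 0)"
        by (intro sum.cong refl) (auto simp: gradient_field_def mult.commute)
      then show "deriv (\<lambda>\<epsilon>. transformed_integrand p L \<alpha> flow \<epsilon> y) 0 =
          - (\<Sum>j\<in>UNIV. tensor p L (\<alpha> y) $ k $ j * frechet_derivative \<psi> (at y) (axis j 1))"
        using deriv_transformed_integrand[where \<alpha> = \<alpha> and y = y, OF p L forms[OF \<open>y \<in> D\<close>] F] by simp
    qed
  qed
  then show ?thesis using zero by (simp add: set_lebesgue_integral_def)
qed

text \<open>
  Multiplication from the left by a constant matrix only forms linear combinations of the rows.
\<close>

theorem divergence_free_tensor: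
  fixes B :: "'d::{finite,linorder} matrix" and D :: "'d vector set"
  assumes p: "1 \<le> p" and L: "smooth_on_forms p L"
    and D: "open D" and forms: "\<And>y. y \<in> D \<Longrightarrow> \<alpha> y \<in> forms p"
    and regular: "variationally_regular p D L \<alpha>" and crit: "critical_point p D L \<alpha>"
  shows "divergence_free D (\<lambda>y. B ** tensor p L (\<alpha> y))"
  unfolding divergence_free_def
proof (intro conjI allI impI)
  let ?T = "\<lambda>y. tensor p L (\<alpha> y)"
  have T: "locally_integrable D (\<lambda>y. ?T y $ i $ j)" for i j
    using regular unfolding variationally_regular_def by blast
  have entry: "(B ** ?T y) $ i $ j = (\<Sum>k\<in>UNIV. B $ i $ k * ?T y $ k $ j)" for y i j
    by (simp add: matrix_matrix_mult_def)
  show "locally_integrable D (\<lambda>y. (B ** ?T y) $ i $ j)" for i j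
    unfolding locally_integrable_def entry
  proof (intro allI impI)
    fix E assume "compact E \<and> E \<subseteq> D"
    then have "set_integrable lebesgue E (\<lambda>y. ?T y $ k $ j)" for k
      using T unfolding locally_integrable_def by blast
    then show "set_integrable lebesgue E (\<lambda>y. \<Sum>k\<in>UNIV. B $ i $ k * ?T y $ k $ j)"
      by (intro set_integral_sum_finite(1) set_integrable_mult_right) auto
  qed
  fix i and \<psi> :: "'d vector \<Rightarrow> real"
  assume \<psi>: "test_function D \<psi>"
  let ?d = "\<lambda>j y. frechet_derivative \<psi> (at y) (axis j 1)"
  have int: "set_integrable lebesgue D (\<lambda>y. ?T y $ k $ j * ?d j y)" for k j
  proof (rule integrable_times_test[OF T])
    show "continuous_on UNIV (?d j)"
      using \<psi> by (intro smooth_continuous smooth_directional_derivative) (simp add: test_function_def)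
    show "?d j x = 0" if "x \<notin> closure {x. \<psi> x \<noteq> 0}" for x
      by (rule frechet_derivative_outside_support[OF that])
  qed (use \<psi> in \<open>auto simp: test_function_def\<close>)
  have lin: "(LINT y:D|lebesgue. (B ** ?T y) $ i $ j * ?d j y) =
      (\<Sum>k\<in>UNIV. B $ i $ k * (LINT y:D|lebesgue. ?T y $ k $ j * ?d j y))" for j
  proof -
    have "(LINT y:D|lebesgue. (B ** ?T y) $ i $ j * ?d j y) =
        (LINT y:D|lebesgue. \<Sum>k\<in>UNIV. B $ i $ k * (?T y $ k $ j * ?d j y))"
      by (simp add: entry sum_distrib_right mult.assoc)
    also have "\<dots> = (\<Sum>k\<in>UNIV. LINT y:D|lebesgue. B $ i $ k * (?T y $ k $ j * ?d j y))"
      by (rule set_integral_sum_finite(2)) (intro set_integrable_mult_right impI int)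
    finally show ?thesis by simp
  qed
  have zero: "(\<Sum>j\<in>UNIV. LINT y:D|lebesgue. ?T y $ k $ j * ?d j y) = 0" for k
  proof -
    have "(\<Sum>j\<in>UNIV. LINT y:D|lebesgue. ?T y $ k $ j * ?d j y) = (LINT y:D|lebesgue. \<Sum>j\<in>UNIV. ?T y $ k $ j * ?d j y)"
      by (rule set_integral_sum_finite(2)[symmetric]) (rule int)
    then show ?thesis
      using weak_divergence_tensor[OF p L D forms regular crit \<psi>] by simp
  qed
  have "(\<Sum>j\<in>UNIV. LINT y:D|lebesgue. (B ** ?T y) $ i $ j * ?d j y) =
     (\<Sum>k\<in>UNIV. B $ i $ k * (\<Sum>j\<in>UNIV. LINT y:D|lebesgue. ?T y $ k $ j * ?d j y))"
    unfolding lin sum_distrib_left by (rule sum.swap)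
  then show "(\<Sum>j\<in>UNIV. LINT y:D|lebesgue. (B ** ?T y) $ i $ j * ?d j y) = 0"
    by (simp add: zero)
qed

theorem theorem2p2:
  fixes p :: nat
    and L :: "('d::{finite,linorder}) form \<Rightarrow> real"
    and S :: "'d matrix"
  assumes "1 \<le> p" and "p \<le> CARD('d) - 1"
    and "smooth_on_forms p L"
    and "transpose S = S" and "invertible S"
  shows "((\<forall>A\<in>forms p. transpose (matrix_inv S ** tensor p L A) = matrix_inv S ** tensor p L A)
            \<longleftrightarrow> (\<forall>M\<in>neutral_component S. \<forall>A\<in>forms p. L (pullback p M A) = L A))
         \<and> (\<forall>(D :: 'd vector set) \<alpha>.
              open D \<and> closed_form p D \<alpha> \<and> variationally_regular p D L \<alpha> \<and> critical_point p D L \<alpha>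
              \<longrightarrow> divergence_free D (\<lambda>y. matrix_inv S ** tensor p L (\<alpha> y)))"
proof (intro conjI allI impI)
  show "(\<forall>A\<in>forms p. transpose (matrix_inv S ** tensor p L A) = matrix_inv S ** tensor p L A)
      \<longleftrightarrow> (\<forall>M\<in>neutral_component S. \<forall>A\<in>forms p. L (pullback p M A) = L A)"
    using invariant_if_symmetric[OF assms(1,3-5)] symmetric_if_invariant[OF assms(1,3-5)] by blast
next
  fix D :: "'d vector set" and \<alpha>
  assume "open D \<and> closed_form p D \<alpha> \<and> variationally_regular p D L \<alpha> \<and> critical_point p D L \<alpha>"
  moreover from this have "\<And>y. y \<in> D \<Longrightarrow> \<alpha> y \<in> forms p"
    by (simp add: closed_form_def)
  ultimately show "divergence_free D (\<lambda>y. matrix_inv S ** tensor p L (\<alpha> y))"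
    using divergence_free_tensor[OF assms(1,3)] by blast
qed

end
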